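(* Let $L$ be an admissible lattice of $\mathbb{R}^2$. Then: (1) There exists $C>0$ such that for all $t$ large enough, $\frac{1}{C}\log(t)\leqslant V(L,t)\leqslant C\log(t)$. (2) Let $a,b>0$, let $P=\mathrm{Rect}(a,b)$, and let $\rho$ be a probability density on $[0,1]$. When $t\in[0,T]$ is random, distributed according to $\frac{1}{T}\rho\left(\frac{t}{T}\right)dt$, and $T\to\infty$, the random variable $$\mathbb{E}_{X\in\mathbb{R}^2/L}\left(\left(\frac{\mathcal{R}(tP+X,L)}{\sqrt{V(L^{\perp},t)}}\right)^2\right)$$ converges in distribution and in probability towards the constant $\frac{1}{4\pi^4\,\mathrm{Covol}(L)^2}$.
   Context: A lattice $L$ of $\mathbb{R}^2$ is admissible if there is $C>0$ with $|l_1l_2|\geqslant C$ for all $l=(l_1,l_2)\in L\setminus\{0\}$. $\mathrm{Covol}(L)$ is the area of a fundamental domain of $L$. The dual lattice is $L^{\perp}=\{x\in\mathbb{R}^2 : \langle l,x\rangle\in\mathbb{Z}\ \ \forall l\in L\}$ ($L^\perp$ is admissible when $L$ is). $\|\cdot\|$ is the Euclidean norm. For a lattice $L$ with $l_1l_2\neq0$ for all $l\in L$ with $0<\|l\|\leqslant t$, $V(L,t)=\sum_{l\in L,\ 0<\|l\|\leqslant t}\frac{1}{l_1^2l_2^2}$. $\mathrm{Rect}(a,b)$ is the rectangle $[-a,a]\times[-b,b]$. For $P\subset\mathbb{R}^2$, $t>0$, $X\in\mathbb{R}^2$, $N(tP+X,L)=|(tP+X)\cap L|$ and $\mathcal{R}(tP+X,L)=N(tP+X,L)-t^2\frac{\mathrm{Area}(P)}{\mathrm{Covol}(L)}$.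 For a function $f(t,X)$ that is $L$-periodic in $X$, $\mathbb{E}_{X\in\mathbb{R}^2/L}(f)(t)=\frac{1}{\mathrm{Covol}(L)}\int_{\mathbb{R}^2/L}f(t,X)\,dX$. For the bounded set of small $t$ with $V(L^\perp,t)=0$, the quotient may be given an arbitrary value; the probability of this set tends to $0$ as $T\to\infty$. *)

theory Defs
  imports "HOL-Probability.Probability"
begin

section \<open>Lattices of the plane\<close>

definition planar_lattice :: "(real^2) set \<Rightarrow> bool" where
  "planar_lattice L \<longleftrightarrow>
     (\<exists>u v. u \<noteq> v \<and> independent {u, v} \<and>
            L = {of_int m *\<^sub>R u + of_int n *\<^sub>R v | m n. True})"

definition admissible :: "(real^2) set \<Rightarrow> bool" where
  "admissible L \<longleftrightarrow> (\<exists>C>0. \<forall>l\<in>L - {0}. C \<le> \<bar>l$1 * l$2\<bar>)"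

definition dual_lattice :: "(real^2) set \<Rightarrow> (real^2) set" where
  "dual_lattice L = {x. \<forall>l\<in>L. l \<bullet> x \<in> \<int>}"

definition fundamental_domain :: "(real^2) set \<Rightarrow> (real^2) set \<Rightarrow> bool" where
  "fundamental_domain L F \<longleftrightarrow> F \<in> sets borel \<and> (\<forall>x. \<exists>!l. l \<in> L \<and> x - l \<in> F)"

text \<open>
  Covolumes and averages over the torus do not depend on the choice made here: see
  \<open>fundamental_domain_exists\<close>, \<open>covol_eq\<close> and \<open>torus_mean_eq\<close> below.
\<close>

definition fund_domain :: "(real^2) set \<Rightarrow> (real^2) set" where
  "fund_domain L = (SOME F. fundamental_domain L F)"

definition covol :: "(real^2) set \<Rightarrow> real" where
  "covol L = measure lborel (fund_domain L)"

text \<open>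
  The integral of an \<open>L\<close>-periodic function over the quotient torus is its integral over a
  fundamental domain.
\<close>

definition torus_mean :: "(real^2) set \<Rightarrow> (real^2 \<Rightarrow> real) \<Rightarrow> real" where
  "torus_mean L f = 1 / covol L * (LINT X:fund_domain L|lborel. f X)"

definition V :: "(real^2) set \<Rightarrow> real \<Rightarrow> real" where
  "V L t = (\<Sum>l | l \<in> L \<and> 0 < norm l \<and> norm l \<le> t. 1 / ((l$1)\<^sup>2 * (l$2)\<^sup>2))"


section \<open>Counting lattice points\<close>

definition Rect :: "real \<Rightarrow> real \<Rightarrow> (real^2) set" where
  "Rect a b = {x. x$1 \<in> {-a..a} \<and> x$2 \<in> {-b..b}}"

definition dilate_shift :: "real \<Rightarrow> (real^2) set \<Rightarrow> real^2 \<Rightarrow> (real^2) set" where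
  "dilate_shift t P X = (\<lambda>p. t *\<^sub>R p + X) ` P"

definition lattice_count :: "(real^2) set \<Rightarrow> (real^2) set \<Rightarrow> nat" where
  "lattice_count S L = card (S \<inter> L)"

definition discrepancy :: "real \<Rightarrow> (real^2) set \<Rightarrow> real^2 \<Rightarrow> (real^2) set \<Rightarrow> real" where
  "discrepancy t P X L =
     real (lattice_count (dilate_shift t P X) L) - t\<^sup>2 * (measure lebesgue P / covol L)"

text \<open>
  At the small \<open>t\<close> for which \<open>V (dual_lattice L) t = 0\<close>, the quotient takes the value \<open>0\<close>.
\<close>

definition normalized_variance :: "(real^2) set \<Rightarrow> (real^2) set \<Rightarrow> real \<Rightarrow> real" where
  "normalized_variance P L t =
     torus_mean L (\<lambda>X. (discrepancy t P X L / sqrt (V (dual_lattice L) t))\<^sup>2)"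


section \<open>Random dilations and modes of convergence\<close>

definition prob_density_01 :: "(real \<Rightarrow> real) \<Rightarrow> bool" where
  "prob_density_01 \<rho> \<longleftrightarrow>
     set_borel_measurable borel {0..1} \<rho> \<and> (\<forall>x\<in>{0..1}. 0 \<le> \<rho> x) \<and>
     (\<integral>\<^sup>+x\<in>{0..1}. ennreal (\<rho> x) \<partial>lborel) = 1"

definition dilation_law :: "(real \<Rightarrow> real) \<Rightarrow> real \<Rightarrow> real measure" where
  "dilation_law \<rho> T =
     density lborel (\<lambda>t. ennreal (indicator {0..T} t * (1 / T * \<rho> (t / T))))"

text \<open>
  The library only has convergence in distribution along sequences; here the parameter runs
  along an arbitrary filter (for \<open>T \<rightarrow> \<infinity>\<close> over the reals).
\<close>

definition converges_in_distribution ::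
    "('i \<Rightarrow> real measure) \<Rightarrow> real measure \<Rightarrow> 'i filter \<Rightarrow> bool" where
  "converges_in_distribution Ms M F \<longleftrightarrow>
     (\<forall>x. isCont (cdf M) x \<longrightarrow> ((\<lambda>i. cdf (Ms i) x) \<longlongrightarrow> cdf M x) F)"

lemma converges_in_distribution_sequentially:
  "converges_in_distribution Ms M sequentially \<longleftrightarrow> weak_conv_m Ms M"
  by (simp add: converges_in_distribution_def weak_conv_m_def weak_conv_def)

definition converges_in_probability ::
    "('i \<Rightarrow> 'a measure) \<Rightarrow> ('a \<Rightarrow> real) \<Rightarrow> real \<Rightarrow> 'i filter \<Rightarrow> bool" where
  "converges_in_probability Ms X c F \<longleftrightarrow>
     (\<forall>\<epsilon>>0. ((\<lambda>i. measure (Ms i) {\<omega> \<in> space (Ms i). \<epsilon> < \<bar>X \<omega> - c\<bar>}) \<longlongrightarrow> 0) F)"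

lemma prob_space_dilation_law:
  assumes "prob_density_01 \<rho>" "0 < T"
  shows "prob_space (dilation_law \<rho> T)"
proof
  define g where "g x = ennreal (indicator {0..1} x * \<rho> x)" for x
  have "(\<lambda>x. indicator {0..1} x * \<rho> x) \<in> borel_measurable borel"
    using assms(1) by (simp add: prob_density_01_def set_borel_measurable_def)
  then have g [measurable]: "g \<in> borel_measurable borel"
    unfolding g_def by measurable
  have "1 = (\<integral>\<^sup>+x. g x \<partial>lborel)"
  proof -
    have "g = (\<lambda>x. ennreal (\<rho> x) * indicator {0..1} x)"
      by (simp add: fun_eq_iff g_def indicator_def)
    then show ?thesis using assms(1) by (simp add: prob_density_01_def)
  qed
  also have "\<dots> = ennreal \<bar>1 / T\<bar> * (\<integral>\<^sup>+x. g (0 + 1 / T * x) \<partial>lborel)"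
    using assms(2) by (intro nn_integral_real_affine) auto
  also have "\<dots> = (\<integral>\<^sup>+x. ennreal (1 / T) * g (x / T) \<partial>lborel)"
    using assms(2) by (subst nn_integral_cmult) auto
  also have eq: "(\<lambda>x. ennreal (1 / T) * g (x / T)) =
             (\<lambda>t. ennreal (indicator {0..T} t * (1 / T * \<rho> (t / T))))"
    using assms(2) unfolding g_def
    by (intro ext, subst ennreal_mult'[symmetric])
       (auto simp: indicator_def field_simps intro!: arg_cong[of _ _ ennreal])
  finally have 1: "(\<integral>\<^sup>+t. ennreal (indicator {0..T} t * (1 / T * \<rho> (t / T))) \<partial>lborel) = 1"
    by simp
  have "(\<lambda>t. ennreal (indicator {0..T} t * (1 / T * \<rho> (t / T)))) \<in> borel_measurable borel"
    unfolding eq[symmetric] by measurable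
  then show "emeasure (dilation_law \<rho> T) (space (dilation_law \<rho> T)) = 1"
    using 1 by (simp add: dilation_law_def emeasure_density)
qed


section \<open>Independence of the fundamental domain\<close>

lemma planar_lattice_props:
  assumes "planar_lattice L"
  shows "countable L" "\<And>x. x \<in> L \<Longrightarrow> - x \<in> L"
proof -
  obtain u v where L: "L = {of_int m *\<^sub>R u + of_int n *\<^sub>R v | m n. True}"
    using assms unfolding planar_lattice_def by (elim exE conjE)
  have "L = (\<lambda>(m, n). of_int m *\<^sub>R u + of_int n *\<^sub>R v) ` (UNIV :: (int \<times> int) set)"
    unfolding L by auto
  then show "countable L" by simp
  show "- x \<in> L" if x: "x \<in> L" for x
  proof -
    obtain m n where "x = of_int m *\<^sub>R u + of_int n *\<^sub>R v" using x unfolding L mem_Collect_eq by (elim exE conjE)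
    then have "- x = of_int (- m) *\<^sub>R u + of_int (- n) *\<^sub>R v" by simp
    then show ?thesis unfolding L by blast
  qed
qed

lemma fundamental_domain_exists:
  assumes "planar_lattice L"
  shows "\<exists>F. fundamental_domain L F"
proof -
  obtain u v where uv: "u \<noteq> v" "independent {u, v}"
    and L: "L = {of_int m *\<^sub>R u + of_int n *\<^sub>R v | m n. True}"
    using assms unfolding planar_lattice_def by (elim exE conjE)
  have ind: "s = 0 \<and> r = 0" if "s *\<^sub>R u + r *\<^sub>R v = 0" for s r
  proof -
    define c where "c = (\<lambda>x. if x = u then s else r)"
    have "(\<Sum>x\<in>{u, v}. c x *\<^sub>R x) = 0" using uv(1) that by (simp add: c_def)
    then have "c u = 0" "c v = 0" by (auto intro!: independentD[OF uv(2), of "{u, v}" c])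
    then show ?thesis using uv(1) by (simp add: c_def)
  qed
  define d where "d = u$1 * v$2 - u$2 * v$1"
  have d: "d \<noteq> 0"
  proof
    assume "d = 0"
    then have "v$2 *\<^sub>R u + (- u$2) *\<^sub>R v = 0" "v$1 *\<^sub>R u + (- u$1) *\<^sub>R v = 0"
      by (simp_all add: d_def vec_eq_iff forall_2 algebra_simps)
    from ind[OF this(1)] ind[OF this(2)] have "u = 0" "v = 0"
      by (simp_all add: vec_eq_iff forall_2)
    with uv(1) show False by simp
  qed
  define S R where "S x = (x$1 * v$2 - x$2 * v$1) / d" and "R x = (u$1 * x$2 - u$2 * x$1) / d"
    for x :: "real^2"
  have SR: "S x *\<^sub>R u + R x *\<^sub>R v = x" for x
  proof -
    have "S x * u$i + R x * v$i = x$i" if "i = 1 \<or> i = 2" for i :: 2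
      using d that unfolding S_def R_def by (auto simp: field_simps) (auto simp: d_def algebra_simps)
    then show ?thesis by (simp add: vec_eq_iff forall_2)
  qed
  have lin: "S (x - (m *\<^sub>R u + n *\<^sub>R v)) = S x - m" "R (x - (m *\<^sub>R u + n *\<^sub>R v)) = R x - n" for x m n
  proof -
    have "(x - (m *\<^sub>R u + n *\<^sub>R v))$1 * v$2 - (x - (m *\<^sub>R u + n *\<^sub>R v))$2 * v$1
        = (x$1 * v$2 - x$2 * v$1) - m * d"
      and "u$1 * (x - (m *\<^sub>R u + n *\<^sub>R v))$2 - u$2 * (x - (m *\<^sub>R u + n *\<^sub>R v))$1
        = (u$1 * x$2 - u$2 * x$1) - n * d"
      by (simp_all add: d_def algebra_simps)
    then show "S (x - (m *\<^sub>R u + n *\<^sub>R v)) = S x - m"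
      and "R (x - (m *\<^sub>R u + n *\<^sub>R v)) = R x - n"
      unfolding S_def R_def using d by (simp_all add: diff_divide_distrib)
  qed
  define F where "F = {x. 0 \<le> S x \<and> S x < 1 \<and> 0 \<le> R x \<and> R x < 1}"
  have [measurable]: "S \<in> borel_measurable borel" "R \<in> borel_measurable borel"
    unfolding S_def R_def by measurable
  have "F \<in> sets borel" unfolding F_def by measurable
  moreover have "\<exists>!l. l \<in> L \<and> x - l \<in> F" for x
  proof (rule ex1I)
    let ?l = "of_int \<lfloor>S x\<rfloor> *\<^sub>R u + of_int \<lfloor>R x\<rfloor> *\<^sub>R v"
    show "?l \<in> L \<and> x - ?l \<in> F"
      unfolding F_def mem_Collect_eq lin L by (auto; linarith)
    fix l assume l: "l \<in> L \<and> x - l \<in> F"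
    then obtain m n where mn: "l = of_int m *\<^sub>R u + of_int n *\<^sub>R v" unfolding L by blast
    have "\<lfloor>S x\<rfloor> = m" "\<lfloor>R x\<rfloor> = n"
      using l unfolding F_def mem_Collect_eq mn lin by linarith+
    with mn show "l = ?l" by simp
  qed
  ultimately show ?thesis unfolding fundamental_domain_def by blast
qed

lemma fundamental_domain_fund_domain:
  "planar_lattice L \<Longrightarrow> fundamental_domain L (fund_domain L)"
  unfolding fund_domain_def by (rule someI_ex) (rule fundamental_domain_exists)

lemma nn_integral_fundamental_domain_eq:
  fixes f :: "real^2 \<Rightarrow> ennreal"
  assumes L: "planar_lattice L" and F: "fundamental_domain L F" and G: "fundamental_domain L G"
    and f [measurable]: "f \<in> borel_measurable borel"
    and per: "\<And>x l. l \<in> L \<Longrightarrow> f (x + l) = f x"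
  shows "(\<integral>\<^sup>+x\<in>F. f x \<partial>lborel) = (\<integral>\<^sup>+x\<in>G. f x \<partial>lborel)"
proof -
  note cL = planar_lattice_props(1)[OF L] and mL = planar_lattice_props(2)[OF L]
  have [measurable]: "F \<in> sets borel" "G \<in> sets borel"
    using F G by (auto simp: fundamental_domain_def)
  have one: "(\<integral>\<^sup>+l. indicator H (x - l) \<partial>count_space L) = 1"
    if H: "fundamental_domain L H" for H and x :: "real^2"
  proof -
    have ex: "\<exists>!l. l \<in> L \<and> x - l \<in> H"
      using H unfolding fundamental_domain_def by (elim conjE allE)
    define l0 where "l0 = (THE l. l \<in> L \<and> x - l \<in> H)"
    have l0: "l0 \<in> L" "x - l0 \<in> H"
      using theI'[OF ex] by (simp_all add: l0_def)
    moreover have "l = l0" if "l \<in> L" "x - l \<in> H" for l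
      unfolding l0_def by (rule the1_equality[OF ex, symmetric]) (simp add: that)
    ultimately have "l \<in> L \<Longrightarrow> x - l \<in> H \<longleftrightarrow> l = l0" for l
      by blast
    then have "(\<integral>\<^sup>+l. indicator H (x - l) \<partial>count_space L) =
          (\<integral>\<^sup>+l. indicator {l0} l \<partial>count_space L)"
      by (intro nn_integral_cong) (simp add: indicator_def)
    also have "\<dots> = 1" using l0(1) by simp
    finally show ?thesis .
  qed
  have "(\<integral>\<^sup>+x\<in>F. f x \<partial>lborel) =
        (\<integral>\<^sup>+x. (\<integral>\<^sup>+l. (f x * indicator F x) * indicator G (x - l) \<partial>count_space L) \<partial>lborel)"
    by (simp add: nn_integral_cmult one[OF G])
  also have "\<dots> = (\<integral>\<^sup>+l. (\<integral>\<^sup>+x. (f x * indicator F x) * indicator G (x - l) \<partial>lborel) \<partial>count_space L)"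
    by (rule nn_integral_count_space_nn_integral[OF cL]) measurable
  also have "\<dots> = (\<integral>\<^sup>+l. (\<integral>\<^sup>+x. (f x * indicator G x) * indicator F (x - (- l)) \<partial>lborel) \<partial>count_space L)"
  proof (rule nn_integral_cong)
    fix l assume "l \<in> space (count_space L)"
    then have l: "l \<in> L" by simp
    have "(\<integral>\<^sup>+x. (f x * indicator F x) * indicator G (x - l) \<partial>lborel) =
          (\<integral>\<^sup>+x. (f x * indicator F x) * indicator G (x - l) \<partial>distr lborel borel ((+) l))"
      by (simp add: lborel_distr_plus)
    also have "\<dots> = (\<integral>\<^sup>+x. (f (l + x) * indicator F (l + x)) * indicator G (l + x - l) \<partial>lborel)"
      by (rule nn_integral_distr) measurable
    also have "\<dots> = (\<integral>\<^sup>+x. (f x * indicator G x) * indicator F (x - (- l)) \<partial>lborel)"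
      using per[OF l] by (intro nn_integral_cong) (simp add: add.commute mult_ac)
    finally show "(\<integral>\<^sup>+x. (f x * indicator F x) * indicator G (x - l) \<partial>lborel) =
      (\<integral>\<^sup>+x. (f x * indicator G x) * indicator F (x - (- l)) \<partial>lborel)" .
  qed
  also have "\<dots> = (\<integral>\<^sup>+x. (\<integral>\<^sup>+l. (f x * indicator G x) * indicator F (x - (- l)) \<partial>count_space L) \<partial>lborel)"
    by (rule nn_integral_count_space_nn_integral[OF cL, symmetric]) measurable
  also have "\<dots> = (\<integral>\<^sup>+x\<in>G. f x \<partial>lborel)"
  proof -
    have bij: "bij_betw uminus L L"
      by (rule bij_betwI[of _ _ _ uminus]) (auto intro: mL)
    have "(\<integral>\<^sup>+l. indicator F (x - (- l)) \<partial>count_space L) = 1" for x :: "real^2"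
      using nn_integral_bij_count_space[OF bij, of "\<lambda>l. indicator F (x - l)"] one[OF F, of x]
      by simp
    then show ?thesis by (simp add: nn_integral_cmult)
  qed
  finally show ?thesis .
qed

lemma covol_eq:
  assumes "planar_lattice L" "fundamental_domain L F"
  shows "covol L = measure lborel F"
proof -
  have "F \<in> sets borel" "fund_domain L \<in> sets borel"
    using assms fundamental_domain_fund_domain by (auto simp: fundamental_domain_def)
  then show ?thesis
    using nn_integral_fundamental_domain_eq[OF assms(1) fundamental_domain_fund_domain[OF assms(1)]
        assms(2), of "\<lambda>_. 1"]
    by (simp add: covol_def measure_def)
qed

lemma torus_mean_eq:
  assumes L: "planar_lattice L" and F: "fundamental_domain L F"
    and f [measurable]: "f \<in> borel_measurable borel"
    and per: "\<And>x l. l \<in> L \<Longrightarrow> f (x + l) = f x"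
  shows "torus_mean L f = 1 / covol L * (LINT X:F|lborel. f X)"
proof -
  let ?G = "fund_domain L"
  note G = fundamental_domain_fund_domain[OF L]
  have [measurable]: "F \<in> sets borel" "?G \<in> sets borel"
    using F G by (auto simp: fundamental_domain_def)
  have split: "(\<integral>\<^sup>+x. ennreal (indicator H x *\<^sub>R g x) \<partial>lborel) = (\<integral>\<^sup>+x\<in>H. ennreal (g x) \<partial>lborel)"
    for g :: "real^2 \<Rightarrow> real" and H
    by (intro nn_integral_cong) (simp add: indicator_def)
  have eq: "(\<integral>\<^sup>+x. ennreal (indicator ?G x *\<^sub>R g x) \<partial>lborel) =
            (\<integral>\<^sup>+x. ennreal (indicator F x *\<^sub>R g x) \<partial>lborel)"
    if [measurable]: "g \<in> borel_measurable borel" and "\<And>x l. l \<in> L \<Longrightarrow> g (x + l) = g x" for g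
    unfolding split using that by (intro nn_integral_fundamental_domain_eq[OF L G F]) auto
  have norm_eq: "norm (indicator H x *\<^sub>R f x) = indicator H x *\<^sub>R norm (f x)" for H x
    by (simp add: indicator_def)
  have "integrable lborel (\<lambda>x. indicator ?G x *\<^sub>R f x) \<longleftrightarrow>
        integrable lborel (\<lambda>x. indicator F x *\<^sub>R f x)"
    unfolding integrable_iff_bounded norm_eq using eq[of "\<lambda>x. norm (f x)"] per by simp
  moreover have "(\<integral>\<^sup>+x. ennreal (- (indicator ?G x *\<^sub>R f x)) \<partial>lborel) =
            (\<integral>\<^sup>+x. ennreal (- (indicator F x *\<^sub>R f x)) \<partial>lborel)"
    using eq[of "\<lambda>x. - f x"] per by simp
  ultimately have "(LINT X:?G|lborel. f X) = (LINT X:F|lborel. f X)"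
    unfolding set_lebesgue_integral_def
    using eq[of f] per
    by (cases "integrable lborel (\<lambda>x. indicator ?G x *\<^sub>R f x)")
       (simp_all add: real_lebesgue_integral_def not_integrable_integral_eq)
  then show ?thesis by (simp add: torus_mean_def)
qed

end

theory Submission
  imports Defs
begin

text \<open>
  Parseval turns the variance into the sum of
  \<open>sin\<^sup>2 (2 \<pi> a m\<^sub>1 t) sin\<^sup>2 (2 \<pi> b m\<^sub>2 t) / (m\<^sub>1 m\<^sub>2)\<^sup>2\<close> over the nonzero dual vectors
  \<open>m\<close>, up to the factor \<open>1 / (\<pi>\<^sup>4 covol\<^sup>2)\<close>. It is obtained here as Poisson summation at the origin for the
  autocorrelation of the rectangle, a product of two tent functions. By admissibility a box of area
  less than \<open>C\<close> contains at most one lattice point, so every dyadic layer \<open>R \<le> |m\<^sub>2| < 2 R\<close>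
  carries bounded mass of the weight \<open>1 / (m\<^sub>1 m\<^sub>2)\<^sup>2\<close>, while Dirichlet's pigeonhole argument shows that
  the layers in a geometric progression carry mass bounded below; hence \<open>V\<close> grows like a logarithm.
  The same layers show that the vectors with \<open>|m| > T\<close> contribute \<open>O(1)\<close> when \<open>t \<le> T\<close>. Expanding
  \<open>4 sin\<^sup>2 x sin\<^sup>2 y = 1 - cos 2x - cos 2y + (cos (2x + 2y) + cos (2x - 2y)) / 2\<close> on the remaining ones,
  the constant term gives \<open>V\<close>. The second moment over \<open>[0, T]\<close> of each oscillating sum is \<open>O(T V(T))\<close>:
  pairs of vectors of comparable norm have total mass \<open>O(V)\<close>, and for all other pairs the frequencies
  are at distance at least \<open>c / (|m| + |m'|)\<close>. Since \<open>O(V) = o(V\<^sup>2)\<close>, Chebyshev's inequality applies.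
\<close>

section \<open>Sums over lattice vectors\<close>

text \<open>The count of lattice points is discontinuous in \<open>X\<close>, so its Fourier series
  is never evaluated. Its second moment over the torus is a finite sum over \<open>L\<close> of the
  autocorrelation, which is continuous with compact support and has a nonnegative transform; only
  absolute summability of that transform on the dual lattice remains to be shown. The weights alone
  are not summable, since \<open>V\<close> is unbounded. The sines help through
  \<open>(sin z)\<^sup>2 \<le> \<bar>z\<bar> powr (1/2)\<close>: half a power of one coordinate is
  traded for \<open>T powr (1/2)\<close>, which the tail beyond norm \<open>T\<close> pays back. The
  second obstacle is the mixed frequencies. Admissibility separates single coordinates of distinct
  vectors but says nothing about a linear form in both, which may nearly vanish where the
  coordinates are comparable. These directions are cut out as a cone; the weight decays there like
  the fourth power of the norm and has bounded sum. Truncating at norm \<open>T\<close> for all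
  \<open>t \<le> T\<close> keeps one trigonometric polynomial on the whole interval. The price,
  replacing \<open>V M T\<close> by \<open>V M t\<close>, is bounded once \<open>t\<close> exceeds a
  fixed fraction of \<open>T\<close>.\<close>

lemma abs_nth_le_norm: "\<bar>x $ i\<bar> \<le> norm (x::real^2)"
  by (rule component_le_norm_cart)

lemma norm_le_nth: "i \<noteq> j \<Longrightarrow> norm (x::real^2) \<le> \<bar>x $ i\<bar> + \<bar>x $ j\<bar>" for i j :: 2
  using norm_le_l1_cart[of x] exhaust_2[of i] exhaust_2[of j] by (auto simp: sum_2)

lemma index_two_cases: "i \<noteq> j \<Longrightarrow> (i = 1 \<and> j = 2) \<or> (i = 2 \<and> j = 1)" for i j :: 2
  using exhaust_2[of i] exhaust_2[of j] by auto

lemma one_neq_two: "(1 :: 2) \<noteq> 2"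
  by simp

lemma sum_le_fibres:
  fixes h :: "'a \<Rightarrow> real" and c :: "'b \<Rightarrow> real"
  assumes "finite A" "finite B" "\<And>x. x \<in> A \<Longrightarrow> f x \<in> B"
    and "\<And>b. b \<in> B \<Longrightarrow> (\<Sum>x\<in>{x\<in>A. f x = b}. h x) \<le> c b"
  shows "sum h A \<le> sum c B"
proof -
  have "sum h A = (\<Sum>b\<in>B. \<Sum>x\<in>{x\<in>A. f x = b}. h x)"
    using assms(1-3) by (intro sum.group[symmetric]) auto
  also have "\<dots> \<le> sum c B" using assms(4) by (rule sum_mono)
  finally show ?thesis .
qed

lemma sum_le_fibres_geometric:
  fixes h :: "'a \<Rightarrow> real" and f :: "'a \<Rightarrow> nat"
  assumes A: "finite A" and q: "0 \<le> q" "q < 1" and K: "0 \<le> K"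
    and le: "\<And>n. (\<Sum>x\<in>{x\<in>A. f x = n}. h x) \<le> K * q ^ n"
  shows "sum h A \<le> K / (1 - q)"
proof -
  have "sum h A \<le> (\<Sum>n\<in>f ` A. K * q ^ n)"
    using A le by (intro sum_le_fibres) auto
  also have "\<dots> = K * (\<Sum>n\<in>f ` A. q ^ n)" by (simp add: sum_distrib_left)
  also have "\<dots> \<le> K * (1 / (1 - q))"
  proof (intro mult_left_mono K)
    have "(\<Sum>n\<in>f ` A. q ^ n) \<le> (\<Sum>n. q ^ n)"
      using A q by (intro sum_le_suminf summable_geometric) auto
    then show "(\<Sum>n\<in>f ` A. q ^ n) \<le> 1 / (1 - q)"
      using q by (simp add: suminf_geometric)
  qed
  finally show ?thesis by simp
qed

lemma dyadic_floor:
  fixes x :: real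
  assumes "0 < x"
  defines "n \<equiv> \<lfloor>log 2 x\<rfloor>"
  shows "2 powr n \<le> x" "x < 2 * 2 powr n"
proof -
  have n: "n \<le> log 2 x" "log 2 x < n + 1" unfolding n_def by linarith+
  show "2 powr n \<le> x" using n(1) assms(1) by (simp add: le_log_iff)
  have "x < 2 powr (n + 1)" using n(2) assms(1) by (simp add: log_less_iff)
  then show "x < 2 * 2 powr n" by (simp add: powr_add)
qed

text \<open>For shell masses that decay with the scale, the lowest shell times a geometric series of
  ratio \<open>2 powr - s\<close> bounds the total. The shells start exactly at \<open>R0\<close>,
  so no partial shell is left over.\<close>

lemma sum_dyadic_up:
  fixes h \<phi> :: "'a \<Rightarrow> real"
  assumes A: "finite A" and R0: "0 < R0" and s: "0 < s" and K: "0 \<le> K"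
    and ge: "\<And>x. x \<in> A \<Longrightarrow> R0 \<le> \<phi> x"
    and le: "\<And>R. 0 < R \<Longrightarrow> (\<Sum>x\<in>{x\<in>A. R \<le> \<phi> x \<and> \<phi> x < 2 * R}. h x) \<le> K * R powr - s"
  shows "sum h A \<le> K * R0 powr - s / (1 - 2 powr - s)"
proof (rule sum_le_fibres_geometric[where f="\<lambda>x. nat \<lfloor>log 2 (\<phi> x / R0)\<rfloor>"])
  fix n :: nat
  have "{x\<in>A. nat \<lfloor>log 2 (\<phi> x / R0)\<rfloor> = n} = {x\<in>A. R0 * 2 ^ n \<le> \<phi> x \<and> \<phi> x < 2 * (R0 * 2 ^ n)}"
  proof (intro Collect_cong conj_cong refl)
    fix x assume x: "x \<in> A"
    have p: "1 \<le> \<phi> x / R0" using ge[OF x] R0 by simp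
    then have "0 \<le> log 2 (\<phi> x / R0)" by simp
    then have "nat \<lfloor>log 2 (\<phi> x / R0)\<rfloor> = n \<longleftrightarrow> real n \<le> log 2 (\<phi> x / R0) \<and> log 2 (\<phi> x / R0) < real n + 1"
      by linarith
    also have "\<dots> \<longleftrightarrow> 2 powr real n \<le> \<phi> x / R0 \<and> \<phi> x / R0 < 2 powr (real n + 1)"
      using p by (subst le_log_iff, auto simp: log_less_iff)
    also have "\<dots> \<longleftrightarrow> R0 * 2 ^ n \<le> \<phi> x \<and> \<phi> x < 2 * (R0 * 2 ^ n)"
      using R0 by (simp add: powr_add powr_realpow field_simps)
    finally show "nat \<lfloor>log 2 (\<phi> x / R0)\<rfloor> = n \<longleftrightarrow> R0 * 2 ^ n \<le> \<phi> x \<and> \<phi> x < 2 * (R0 * 2 ^ n)" .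
  qed
  then have "(\<Sum>x\<in>{x\<in>A. nat \<lfloor>log 2 (\<phi> x / R0)\<rfloor> = n}. h x) \<le> K * (R0 * 2 ^ n) powr - s"
    using le[of "R0 * 2 ^ n"] R0 by simp
  also have "(R0 * 2 ^ n) powr - s = R0 powr - s * (2 powr - s) ^ n"
    using R0 by (simp add: powr_mult powr_realpow[symmetric] powr_powr mult.commute)
  finally show "(\<Sum>x\<in>{x\<in>A. nat \<lfloor>log 2 (\<phi> x / R0)\<rfloor> = n}. h x) \<le> K * R0 powr - s * (2 powr - s) ^ n"
    by simp
qed (use A K s in \<open>auto simp: powr_less_one\<close>)

lemma sum_dyadic_down:
  fixes h \<phi> :: "'a \<Rightarrow> real"
  assumes A: "finite A" and T: "0 < T" and K: "0 \<le> K"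
    and pos: "\<And>x. x \<in> A \<Longrightarrow> 0 < \<phi> x" and ge: "\<And>x. x \<in> A \<Longrightarrow> \<phi> x \<le> T"
    and le: "\<And>R. 0 < R \<Longrightarrow> (\<Sum>x\<in>{x\<in>A. R \<le> \<phi> x \<and> \<phi> x < 2 * R}. h x) \<le> K * R"
  shows "sum h A \<le> 2 * K * T"
proof -
  have "sum h A \<le> (K * T) / (1 - 1 / 2)"
  \<comment> \<open>The ceiling numbers the shells downwards as half-open intervals from
    \<open>T / 2 ^ n\<close> to \<open>2 * (T / 2 ^ n)\<close>, so that the extreme value
    \<open>\<phi> x = T\<close> falls into shell 0.\<close>
  proof (rule sum_le_fibres_geometric[where f="\<lambda>x. nat \<lceil>log 2 (T / \<phi> x)\<rceil>"])
    fix n :: nat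
    have "{x\<in>A. nat \<lceil>log 2 (T / \<phi> x)\<rceil> = n} = {x\<in>A. T / 2 ^ n \<le> \<phi> x \<and> \<phi> x < 2 * (T / 2 ^ n)}"
    proof (intro Collect_cong conj_cong refl)
      fix x assume x: "x \<in> A"
      have p: "1 \<le> T / \<phi> x" using ge[OF x] pos[OF x] by simp
      then have "0 \<le> log 2 (T / \<phi> x)" by simp
      then have "nat \<lceil>log 2 (T / \<phi> x)\<rceil> = n \<longleftrightarrow> log 2 (T / \<phi> x) \<le> real n \<and> real n - 1 < log 2 (T / \<phi> x)"
        by linarith
      also have "\<dots> \<longleftrightarrow> T / \<phi> x \<le> 2 powr real n \<and> 2 powr (real n - 1) < T / \<phi> x"
        using p by (subst less_log_iff, auto simp: log_le_iff)
      also have "\<dots> \<longleftrightarrow> T / 2 ^ n \<le> \<phi> x \<and> \<phi> x < 2 * (T / 2 ^ n)"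
        using pos[OF x] T by (simp add: powr_diff powr_realpow field_simps)
      finally show "nat \<lceil>log 2 (T / \<phi> x)\<rceil> = n \<longleftrightarrow> T / 2 ^ n \<le> \<phi> x \<and> \<phi> x < 2 * (T / 2 ^ n)" .
    qed
    then have "(\<Sum>x\<in>{x\<in>A. nat \<lceil>log 2 (T / \<phi> x)\<rceil> = n}. h x) \<le> K * (T / 2 ^ n)"
      using le[of "T / 2 ^ n"] T by simp
    then show "(\<Sum>x\<in>{x\<in>A. nat \<lceil>log 2 (T / \<phi> x)\<rceil> = n}. h x) \<le> K * T * (1 / 2) ^ n"
      by (simp add: power_divide)
  qed (use A K T in auto)
  then show ?thesis by simp
qed

section \<open>The mass of dyadic layers and shells in an admissible group\<close>

definition weight :: "real^2 \<Rightarrow> real" where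
  "weight l = 1 / ((l$1)\<^sup>2 * (l$2)\<^sup>2)"

lemma weight_nonneg: "0 \<le> weight l"
  by (simp add: weight_def)

lemma weight_eq: "i \<noteq> j \<Longrightarrow> weight l = 1 / ((l$i)\<^sup>2 * (l$j)\<^sup>2)" for i j :: 2
  using index_two_cases[of i j] by (auto simp: weight_def mult.commute)

text \<open>Covers both \<open>L\<close> and its dual. No basis is assumed: discreteness and all
  upper bounds follow from closure under differences together with \<open>adm\<close>. A basis
  enters only for the lower bound on \<open>V\<close>, where enough vectors have to exist.\<close>

locale admissible_group =
  fixes M :: "(real^2) set" and C :: real
  assumes C_pos: "0 < C"
    and diff_mem: "x \<in> M \<Longrightarrow> y \<in> M \<Longrightarrow> x - y \<in> M"
    and adm: "l \<in> M \<Longrightarrow> l \<noteq> 0 \<Longrightarrow> C \<le> \<bar>l$1 * l$2\<bar>"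
begin

lemma uminus_mem: "x \<in> M \<Longrightarrow> - x \<in> M"
  using diff_mem[of x x] diff_mem[of 0 x] diff_mem by fastforce

lemma add_mem: "x \<in> M \<Longrightarrow> y \<in> M \<Longrightarrow> x + y \<in> M"
  using diff_mem[of x "- y"] uminus_mem by simp

lemma adm_nth: "l \<in> M \<Longrightarrow> l \<noteq> 0 \<Longrightarrow> i \<noteq> j \<Longrightarrow> C \<le> \<bar>l$i\<bar> * \<bar>l$j\<bar>"
  using adm[of l] index_two_cases[of i j] by (auto simp: abs_mult mult.commute)

lemma nth_nonzero: "l \<in> M \<Longrightarrow> l \<noteq> 0 \<Longrightarrow> l$i \<noteq> 0"
  using adm[of l] C_pos exhaust_2[of i] by auto

lemma nth_pos: "l \<in> M \<Longrightarrow> l \<noteq> 0 \<Longrightarrow> 0 < \<bar>l$i\<bar>"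
  using nth_nonzero by simp

lemma norm_ge: "l \<in> M \<Longrightarrow> l \<noteq> 0 \<Longrightarrow> sqrt C \<le> norm l"
proof (rule real_le_lsqrt)
  assume l: "l \<in> M" "l \<noteq> 0"
  have "\<bar>l$1\<bar> * \<bar>l$2\<bar> \<le> norm l * norm l"
    by (intro mult_mono abs_nth_le_norm) auto
  then show "C \<le> (norm l)\<^sup>2" using adm_nth[OF l, of 1 2] by (simp add: power2_eq_square)
qed (use C_pos in auto)

text \<open>Two distinct points differ by a nonzero element and are therefore at least
  \<open>sqrt C\<close> apart, whereas a bounded infinite set accumulates.\<close>

lemma finite_bounded: "finite {l\<in>M. norm l \<le> t}"
proof (rule ccontr)
  assume inf: "infinite {l\<in>M. norm l \<le> t}"
  have "bounded {l\<in>M. norm l \<le> t}" by (rule boundedI[of _ t]) auto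
  then obtain x where x: "x islimpt {l\<in>M. norm l \<le> t}"
    using bounded_infinite_imp_islimpt[OF subset_refl _ inf] by blast
  have "\<not> x islimpt M"
  proof (rule discrete_imp_not_islimpt[of "sqrt C"])
    fix x y assume "x \<in> M" "y \<in> M" "dist y x < sqrt C"
    then show "y = x" using norm_ge[of "y - x"] diff_mem[of y x] by (auto simp: dist_norm)
  qed (use C_pos in simp)
  then show False using x islimpt_subset by blast
qed

text \<open>Slicing the strip along coordinate \<open>i\<close> into steps of length
  \<open>C / R\<close> leaves at most one point per step and quadrant. The point in step
  \<open>k\<close> has \<open>\<bar>l$i\<bar>\<close> at least \<open>C / (2 * R) * (k + 1)\<close>,
  so each quadrant is dominated by the convergent series \<open>Z\<close>, scaled by
  \<open>R powr p\<close>.\<close>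

lemma layer_bound:
  fixes i j :: 2
  assumes ij: "i \<noteq> j" and p: "1 < p"
  shows "\<exists>K>0. \<forall>R>0. \<forall>A. finite A \<longrightarrow> A \<subseteq> M - {0} \<longrightarrow> (\<forall>l\<in>A. R \<le> \<bar>l$j\<bar> \<and> \<bar>l$j\<bar> < 2 * R) \<longrightarrow>
     (\<Sum>l\<in>A. \<bar>l$i\<bar> powr - p) \<le> K * R powr p"
proof -
  define Z where "Z = (\<Sum>k. real (Suc k) powr - p)"
  have summ: "summable (\<lambda>k. real (Suc k) powr - p)"
    using p by (subst summable_Suc_iff, subst summable_real_powr_iff) auto
  have Z: "0 < Z" unfolding Z_def by (rule suminf_pos[OF summ]) simp
  show ?thesis
  proof (intro exI[of _ "4 * ((2 / C) powr p * Z)"] conjI allI impI)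
    show "0 < 4 * ((2 / C) powr p * Z)" using Z C_pos by simp
    fix R :: real and A
    assume R: "0 < R" and A: "finite A" "A \<subseteq> M - {0}" "\<forall>l\<in>A. R \<le> \<bar>l$j\<bar> \<and> \<bar>l$j\<bar> < 2 * R"
    define k where "k l = nat \<lfloor>\<bar>l$i\<bar> * (R / C)\<rfloor>" for l :: "real^2"
    have k: "real (k l) \<le> \<bar>l$i\<bar> * (R / C)" "\<bar>l$i\<bar> * (R / C) < real (k l) + 1" for l
    proof -
      have "0 \<le> \<bar>l$i\<bar> * (R / C)" using R C_pos by simp
      then show "real (k l) \<le> \<bar>l$i\<bar> * (R / C)" "\<bar>l$i\<bar> * (R / C) < real (k l) + 1"
        unfolding k_def by linarith+
    qed
    have low: "C / (2 * R) * (real (k l) + 1) \<le> \<bar>l$i\<bar>" if "l \<in> A" for l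
    proof -
      have l: "l \<in> M" "l \<noteq> 0" "\<bar>l$j\<bar> < 2 * R" using A that by auto
      have "C \<le> \<bar>l$i\<bar> * (2 * R)"
        using adm_nth[OF l(1,2) ij] mult_left_mono[of "\<bar>l$j\<bar>" "2 * R" "\<bar>l$i\<bar>"] l(3) by linarith
      then have 1: "1 \<le> \<bar>l$i\<bar> * (2 * R) / C" using C_pos by simp
      have "real (k l) + 1 \<le> \<bar>l$i\<bar> * (2 * R) / C"
      \<comment> \<open>In the first step the floor carries no information and the bound is
        admissibility itself; in the later ones \<open>k + 1 \<le> 2 * k\<close> suffices.\<close>
      proof (cases "k l = 0")
        case False
        then have "real (k l) + 1 \<le> 2 * real (k l)" by simp
        then show ?thesis using mult_left_mono[OF k(1)[of l], of 2] by (simp add: mult_ac)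
      qed (use 1 in simp)
      then show ?thesis using R C_pos by (simp add: field_simps)
    qed
    define quad where "quad l = (0 < l$i, 0 < l$j)" for l :: "real^2"
    have "(\<Sum>l\<in>A. \<bar>l$i\<bar> powr - p) \<le> (\<Sum>b\<in>(UNIV :: (bool \<times> bool) set). (2 / C) powr p * Z * R powr p)"
    proof (rule sum_le_fibres[where f=quad])
      fix b :: "bool \<times> bool"
      let ?B = "{l\<in>A. quad l = b}"
      \<comment> \<open>In one quadrant, two points of the layer with the same \<open>k\<close> would differ by a lattice
        vector with coordinate product less than \<open>C\<close>.\<close>
      have inj: "inj_on k ?B"
      proof (rule inj_onI, rule ccontr)
        fix l l' assume l: "l \<in> ?B" "l' \<in> ?B" and eq: "k l = k l'" and ne: "l \<noteq> l'"
        have sg: "0 < l$i \<longleftrightarrow> 0 < l'$i" "0 < l$j \<longleftrightarrow> 0 < l'$j"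
          using l unfolding quad_def by auto
        have *: "\<bar>\<bar>l$i\<bar> * (R / C) - \<bar>l'$i\<bar> * (R / C)\<bar> < 1"
          using k[of l] k[of l'] eq by linarith
        have i': "\<bar>(l - l')$i\<bar> * (R / C) < 1"
        proof -
          have "\<bar>(l - l')$i\<bar> = \<bar>\<bar>l$i\<bar> - \<bar>l'$i\<bar>\<bar>" using sg(1) by auto
          then have "\<bar>(l - l')$i\<bar> * (R / C) = \<bar>\<bar>l$i\<bar> * (R / C) - \<bar>l'$i\<bar> * (R / C)\<bar>"
            using R C_pos by (simp only: left_diff_distrib[symmetric] abs_mult) (simp add: abs_of_pos)
          then show ?thesis using * by simp
        qed
        have "\<bar>(l - l')$j\<bar> < R"
          using sg(2) A(3) l by (smt (verit, best) mem_Collect_eq vector_minus_component)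
        then have "\<bar>(l - l')$i\<bar> * \<bar>(l - l')$j\<bar> \<le> \<bar>(l - l')$i\<bar> * R" by (intro mult_left_mono) auto
        also have "\<dots> < C" using i' C_pos by (simp add: field_simps)
        finally show False
          using adm_nth[of "l - l'" i j] diff_mem l ne A(2) ij by fastforce
      qed
      have "(\<Sum>l\<in>?B. \<bar>l$i\<bar> powr - p) \<le> (\<Sum>l\<in>?B. (C / (2 * R) * (real (k l) + 1)) powr - p)"
        using low p C_pos R by (intro sum_mono powr_mono2') auto
      also have "\<dots> = (\<Sum>l\<in>?B. (C / (2 * R)) powr - p * real (Suc (k l)) powr - p)"
        using C_pos R by (intro sum.cong refl) (subst powr_mult, auto simp: add.commute)
      also have "\<dots> = (C / (2 * R)) powr - p * (\<Sum>n\<in>k ` ?B. real (Suc n) powr - p)"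
        by (simp add: sum_distrib_left sum.reindex[OF inj])
      also have "\<dots> \<le> (C / (2 * R)) powr - p * Z"
        unfolding Z_def using A(1) by (intro mult_left_mono sum_le_suminf summ) auto
      also have "(C / (2 * R)) powr - p = (2 / C) powr p * R powr p"
        using C_pos R by (simp add: powr_minus powr_divide powr_mult field_simps)
      finally show "(\<Sum>l\<in>?B. \<bar>l$i\<bar> powr - p) \<le> (2 / C) powr p * Z * R powr p"
        by (simp add: mult_ac)
    qed (use A in auto)
    then show "(\<Sum>l\<in>A. \<bar>l$i\<bar> powr - p) \<le> 4 * ((2 / C) powr p * Z) * R powr p"
      by (simp add: UNIV_Times_UNIV[symmetric] card_cartesian_product del: UNIV_Times_UNIV)
  qed
qed

text \<open>The exponent \<open>p = 2\<close> is the one for which \<open>R powr p\<close> cancels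
  against the factor \<open>1 / R\<^sup>2\<close> coming from the other coordinate. The bound is
  thus the same at every scale, which is the source of the logarithm.\<close>

lemma weight_layer_bound:
  fixes i j :: 2
  assumes ij: "i \<noteq> j"
  shows "\<exists>K>0. \<forall>R>0. \<forall>A. finite A \<longrightarrow> A \<subseteq> M - {0} \<longrightarrow> (\<forall>l\<in>A. R \<le> \<bar>l$j\<bar> \<and> \<bar>l$j\<bar> < 2 * R) \<longrightarrow>
     sum weight A \<le> K"
proof -
  obtain K where K: "0 < K" and le: "\<And>R A. 0 < R \<Longrightarrow> finite A \<Longrightarrow> A \<subseteq> M - {0} \<Longrightarrow>
      (\<forall>l\<in>A. R \<le> \<bar>l$j\<bar> \<and> \<bar>l$j\<bar> < 2 * R) \<Longrightarrow> (\<Sum>l\<in>A. \<bar>l$i\<bar> powr - 2) \<le> K * R powr 2"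
    using layer_bound[OF ij, of 2] by auto
  show ?thesis
  proof (intro exI[of _ K] conjI K allI impI)
    fix R :: real and A assume A: "0 < R" "finite A" "A \<subseteq> M - {0}" "\<forall>l\<in>A. R \<le> \<bar>l$j\<bar> \<and> \<bar>l$j\<bar> < 2 * R"
    have "weight l \<le> \<bar>l$i\<bar> powr - 2 * (1 / R\<^sup>2)" if "l \<in> A" for l
    proof -
      have "R\<^sup>2 \<le> \<bar>l$j\<bar>\<^sup>2" using A that by (intro power_mono) auto
      moreover have "0 < R\<^sup>2" using A(1) by simp
      ultimately have "1 / (l$j)\<^sup>2 \<le> 1 / R\<^sup>2" by (intro divide_left_mono mult_pos_pos) auto
      then have "1 / (l$i)\<^sup>2 * (1 / (l$j)\<^sup>2) \<le> 1 / (l$i)\<^sup>2 * (1 / R\<^sup>2)"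
        by (intro mult_left_mono) auto
      moreover have "\<bar>l$i\<bar> powr - 2 = 1 / (l$i)\<^sup>2"
        using nth_pos[of l i] A that by (subst powr_minus_divide, subst powr_numeral) auto
      ultimately show ?thesis by (simp add: weight_eq[OF ij])
    qed
    then have "sum weight A \<le> (\<Sum>l\<in>A. \<bar>l$i\<bar> powr - 2 * (1 / R\<^sup>2))" by (rule sum_mono)
    also have "\<dots> = (\<Sum>l\<in>A. \<bar>l$i\<bar> powr - 2) * (1 / R\<^sup>2)" by (simp only: sum_distrib_right)
    also have "\<dots> \<le> K * R powr 2 * (1 / R\<^sup>2)"
      using le[OF A] by (intro mult_right_mono) auto
    also have "\<dots> = K" using A(1) by simp
    finally show "sum weight A \<le> K" .
  qed
qed

text \<open>A Euclidean shell is covered by a bounded number of dyadic layers of the two coordinates.\<close>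

lemma weight_shell_bound:
  assumes Q: "1 \<le> Q"
  shows "\<exists>K>0. \<forall>r>0. \<forall>A. finite A \<longrightarrow> A \<subseteq> M - {0} \<longrightarrow> (\<forall>l\<in>A. r \<le> norm l \<and> norm l \<le> Q * r) \<longrightarrow>
     sum weight A \<le> K"
proof -
  obtain K1 where K1: "0 < K1" and le1: "\<And>R A. 0 < R \<Longrightarrow> finite A \<Longrightarrow> A \<subseteq> M - {0} \<Longrightarrow>
      (\<forall>l\<in>A. R \<le> \<bar>l$1\<bar> \<and> \<bar>l$1\<bar> < 2 * R) \<Longrightarrow> sum weight A \<le> K1"
    using weight_layer_bound[of 2 1] by auto
  obtain K2 where K2: "0 < K2" and le2: "\<And>R A. 0 < R \<Longrightarrow> finite A \<Longrightarrow> A \<subseteq> M - {0} \<Longrightarrow>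
      (\<forall>l\<in>A. R \<le> \<bar>l$2\<bar> \<and> \<bar>l$2\<bar> < 2 * R) \<Longrightarrow> sum weight A \<le> K2"
    using weight_layer_bound[of 1 2] by auto
  \<comment> \<open>The selected coordinate below ranges from \<open>r / 2\<close> to
    \<open>Q * r\<close>, a ratio of \<open>2 * Q\<close>; its layer index therefore never exceeds
    \<open>n\<close>.\<close>
  define n where "n = nat \<lceil>log 2 (2 * Q)\<rceil> + 1"
  define B where "B = (UNIV :: 2 set) \<times> {0..int n}"
  have finB: "finite B" "B \<noteq> {}" unfolding B_def by auto
  have cardB: "0 < card B" using finB by (simp add: card_gt_0_iff)
  show ?thesis
  proof (intro exI[of _ "card B * max K1 K2"] conjI allI impI)
    show "0 < card B * max K1 K2" using cardB K1 by (simp add: less_max_iff_disj)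
    fix r :: real and A
    assume r: "0 < r" and A: "finite A" "A \<subseteq> M - {0}" "\<forall>l\<in>A. r \<le> norm l \<and> norm l \<le> Q * r"
    \<comment> \<open>The norm is at most the sum of the absolute coordinates, so if the first one
      is below \<open>r / 2\<close> the second is not.\<close>
    define c :: "real^2 \<Rightarrow> 2" where "c l = (if r / 2 \<le> \<bar>l$1\<bar> then 1 else 2)" for l
    define d where "d l = \<lfloor>log 2 (\<bar>l$(c l)\<bar> / (r / 2))\<rfloor>" for l :: "real^2"
    have c: "r / 2 \<le> \<bar>l$(c l)\<bar>" "\<bar>l$(c l)\<bar> \<le> Q * r" if "l \<in> A" for l
    proof -
      have "norm l \<le> \<bar>l$1\<bar> + \<bar>l$2\<bar>" by (rule norm_le_nth) simp
      then show "r / 2 \<le> \<bar>l$(c l)\<bar>" using A(3) that unfolding c_def by fastforce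
      show "\<bar>l$(c l)\<bar> \<le> Q * r" using A(3) that abs_nth_le_norm[of l "c l"] by fastforce
    qed
    have "sum weight A \<le> (\<Sum>b\<in>B. max K1 K2)"
    proof (rule sum_le_fibres[where f="\<lambda>l. (c l, d l)"])
      fix l assume l: "l \<in> A"
      have 1: "1 \<le> \<bar>l$(c l)\<bar> / (r / 2)" "\<bar>l$(c l)\<bar> / (r / 2) \<le> 2 * Q"
        using c[OF l] r by (auto simp: field_simps)
      then have "0 \<le> log 2 (\<bar>l$(c l)\<bar> / (r / 2))" "log 2 (\<bar>l$(c l)\<bar> / (r / 2)) \<le> log 2 (2 * Q)"
        using Q by (auto intro!: log_mono)
      then have "0 \<le> d l" "d l \<le> int n" unfolding d_def n_def by linarith+
      then show "(c l, d l) \<in> B" unfolding B_def by simp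
    next
      fix b assume "b \<in> B"
      obtain k m where b: "b = (k, m)" by force
      let ?A = "{l\<in>A. (c l, d l) = b}"
      let ?R = "r / 2 * 2 powr m"
      have lay: "\<forall>l\<in>?A. ?R \<le> \<bar>l$k\<bar> \<and> \<bar>l$k\<bar> < 2 * ?R"
      proof
        fix l assume l: "l \<in> ?A"
        have "0 < \<bar>l$(c l)\<bar> / (r / 2)" using c[of l] l r by (auto simp: field_simps)
        from dyadic_floor[OF this] l show "?R \<le> \<bar>l$k\<bar> \<and> \<bar>l$k\<bar> < 2 * ?R"
          using r unfolding b d_def by (auto simp: field_simps)
      qed
      have R: "0 < ?R" using r by simp
      have A': "finite ?A" "?A \<subseteq> M - {0}" using A by auto
      from exhaust_2[of k] show "sum weight ?A \<le> max K1 K2"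
      proof
        assume "k = 1" then show ?thesis using le1[OF R A'] lay by fastforce
      next
        assume "k = 2" then show ?thesis using le2[OF R A'] lay by fastforce
      qed
    qed (use A finB in auto)
    then show "sum weight A \<le> card B * max K1 K2" by simp
  qed
qed

section \<open>Elementary properties of \<open>V\<close> and its logarithmic upper bound\<close>

lemma V_eq: "V M t = sum weight {l\<in>M - {0}. norm l \<le> t}"
  unfolding V_def weight_def by (rule sum.cong) auto

lemma finite_ball: "finite {l\<in>M - {0}. norm l \<le> t}"
  using finite_bounded[of t] by (rule rev_finite_subset) auto

lemma V_nonneg: "0 \<le> V M t"
  unfolding V_eq by (intro sum_nonneg weight_nonneg)

lemma V_mono: "mono (V M)"
  unfolding V_eq by (intro monoI sum_mono2 finite_ball) (auto simp: weight_nonneg)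

text \<open>For a vector of norm at most \<open>t\<close>, admissibility confines
  \<open>\<bar>l$2\<bar>\<close> to the range from \<open>C / t\<close> to \<open>t\<close>. About
  \<open>2 * log 2 t\<close> dyadic layers of the second coordinate exhaust the ball, each of mass
  at most \<open>K\<close>.\<close>

lemma V_upper: "\<exists>K>0. \<forall>\<^sub>F t in at_top. V M t \<le> K * ln t"
proof -
  obtain K where K: "0 < K" and le: "\<And>R A. 0 < R \<Longrightarrow> finite A \<Longrightarrow> A \<subseteq> M - {0} \<Longrightarrow>
      (\<forall>l\<in>A. R \<le> \<bar>l$2\<bar> \<and> \<bar>l$2\<bar> < 2 * R) \<Longrightarrow> sum weight A \<le> K"
    using weight_layer_bound[of 1 2] by auto
  have *: "V M t \<le> K * (log 2 t - log 2 (C / t) + 3)" if t: "1 < t" "C < t" for t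
  proof -
    define B where "B = {\<lfloor>log 2 (C / t)\<rfloor>..\<lfloor>log 2 t\<rfloor>}"
    have "V M t \<le> (\<Sum>n\<in>B. K)"
      unfolding V_eq
    proof (rule sum_le_fibres[where f="\<lambda>l. \<lfloor>log 2 \<bar>l$2\<bar>\<rfloor>"])
      fix l assume l: "l \<in> {l\<in>M - {0}. norm l \<le> t}"
      have "\<bar>l$2\<bar> \<le> t" "\<bar>l$1\<bar> \<le> t" using l abs_nth_le_norm[of l] order_trans by auto
      moreover have "C \<le> t * \<bar>l$2\<bar>"
        using adm_nth[of l 1 2] l \<open>\<bar>l$1\<bar> \<le> t\<close> mult_right_mono[of "\<bar>l$1\<bar>" t "\<bar>l$2\<bar>"] by auto
      then have "C / t \<le> \<bar>l$2\<bar>" using t by (simp add: field_simps)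
      ultimately show "\<lfloor>log 2 \<bar>l$2\<bar>\<rfloor> \<in> B"
        unfolding B_def using C_pos t nth_pos[of l 2] l by (auto intro!: floor_mono log_mono)
    next
      fix n
      have "0 < \<bar>l$2\<bar>" if "l \<in> M - {0}" for l using nth_pos that by auto
      from dyadic_floor[OF this] show "sum weight {x \<in> {l \<in> M - {0}. norm l \<le> t}. \<lfloor>log 2 \<bar>x$2\<bar>\<rfloor> = n} \<le> K"
        by (intro le[of "2 powr n"] finite_subset[OF _ finite_ball[of t]]) auto
    qed (use finite_ball[of t] in \<open>auto simp: B_def\<close>)
    also have "\<dots> = K * card B" by simp
    also have "\<dots> \<le> K * (log 2 t - log 2 (C / t) + 3)"
    proof (intro mult_left_mono)
      have "C \<le> t * t" using t mult_mono[of 1 t C t] C_pos by simp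
      then have "log 2 (C / t) \<le> log 2 t" using t C_pos by (intro log_mono) (auto simp: pos_divide_le_eq)
      then show "real (card B) \<le> log 2 t - log 2 (C / t) + 3" unfolding B_def by simp linarith
    qed (use K in simp)
    finally show ?thesis .
  qed
  \<comment> \<open>The number of layers is bounded by
    \<open>(2 * ln t - ln C + 3 * ln 2) / ln 2\<close>; the 4 doubles the leading term so that it
    absorbs the constants for large \<open>t\<close>.\<close>
  show ?thesis
  proof (intro exI[of _ "K * (4 / ln 2)"] conjI)
    show "0 < K * (4 / ln 2)" using K by simp
    have "\<forall>\<^sub>F t in at_top. (3 * ln 2 - ln C) / 2 \<le> ln (t :: real)"
      using ln_at_top unfolding filterlim_at_top by blast
    then show "\<forall>\<^sub>F t in at_top. V M t \<le> K * (4 / ln 2) * ln t"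
      using eventually_gt_at_top[of "1::real"] eventually_gt_at_top[of C]
    proof eventually_elim
      fix t assume t: "(3 * ln 2 - ln C) / 2 \<le> ln (t :: real)" "1 < t" "C < t"
      have "log 2 t - log 2 (C / t) + 3 = (2 * ln t - ln C + 3 * ln 2) / ln 2"
        using t C_pos by (simp add: log_def ln_div field_simps)
      also have "\<dots> \<le> (4 * ln t) / ln 2" using t by (intro divide_right_mono) auto
      finally have "K * (log 2 t - log 2 (C / t) + 3) \<le> K * (4 * ln t / ln 2)"
        using K by (intro mult_left_mono) auto
      with *[OF t(2,3)] show "V M t \<le> K * (4 / ln 2) * ln t" by simp
    qed
  qed
qed

section \<open>Sums over tails and over the cone of comparable coordinates\<close>

text \<open>The exponent \<open>3/2\<close> lies strictly between 1, above which
  \<open>layer_bound\<close> applies, and 2, where the layers stop decaying. A layer at scale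
  \<open>R\<close> now has mass of order \<open>R powr (3/2) / R\<^sup>2\<close>, and these sum
  geometrically upwards.\<close>

lemma tail_layer_bound:
  fixes i j :: 2
  assumes ij: "i \<noteq> j"
  shows "\<exists>K>0. \<forall>R>0. \<forall>A. finite A \<longrightarrow> A \<subseteq> M - {0} \<longrightarrow> (\<forall>l\<in>A. R \<le> \<bar>l$j\<bar>) \<longrightarrow>
     (\<Sum>l\<in>A. \<bar>l$i\<bar> powr - (3/2) / (l$j)\<^sup>2) \<le> K * R powr - (1/2)"
proof -
  obtain K where K: "0 < K" and le: "\<And>R A. 0 < R \<Longrightarrow> finite A \<Longrightarrow> A \<subseteq> M - {0} \<Longrightarrow>
      (\<forall>l\<in>A. R \<le> \<bar>l$j\<bar> \<and> \<bar>l$j\<bar> < 2 * R) \<Longrightarrow> (\<Sum>l\<in>A. \<bar>l$i\<bar> powr - (3/2)) \<le> K * R powr (3/2)"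
    using layer_bound[OF ij, of "3/2"] by auto
  define q :: real where "q = 1 - 2 powr - (1/2)"
  have q: "0 < q" unfolding q_def by (simp add: powr_less_one)
  show ?thesis
  proof (intro exI[of _ "K / q"] conjI allI impI)
    show "0 < K / q" using K q by simp
    fix R0 :: real and A assume A: "0 < R0" "finite A" "A \<subseteq> M - {0}" "\<forall>l\<in>A. R0 \<le> \<bar>l$j\<bar>"
    have "(\<Sum>l\<in>A. \<bar>l$i\<bar> powr - (3/2) / (l$j)\<^sup>2) \<le> K * R0 powr - (1/2) / (1 - 2 powr - (1/2))"
    proof (rule sum_dyadic_up[where \<phi>="\<lambda>l. \<bar>l$j\<bar>"])
      fix R :: real assume R: "0 < R"
      let ?A = "{l\<in>A. R \<le> \<bar>l$j\<bar> \<and> \<bar>l$j\<bar> < 2 * R}"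
      have "(\<Sum>l\<in>?A. \<bar>l$i\<bar> powr - (3/2) / (l$j)\<^sup>2) \<le> (\<Sum>l\<in>?A. \<bar>l$i\<bar> powr - (3/2) / R\<^sup>2)"
      proof (rule sum_mono)
        fix l assume "l \<in> ?A"
        then have "R\<^sup>2 \<le> \<bar>l$j\<bar>\<^sup>2" using R by (intro power_mono) auto
        moreover have "0 < R\<^sup>2" using R by simp
        ultimately show "\<bar>l$i\<bar> powr - (3/2) / (l$j)\<^sup>2 \<le> \<bar>l$i\<bar> powr - (3/2) / R\<^sup>2"
          by (intro divide_left_mono mult_pos_pos) auto
      qed
      also have "\<dots> = (\<Sum>l\<in>?A. \<bar>l$i\<bar> powr - (3/2)) / R\<^sup>2" by (simp only: sum_divide_distrib)
      also have "\<dots> \<le> K * R powr (3/2) / R\<^sup>2"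
        using A R by (intro divide_right_mono le) auto
      also have "\<dots> = K * R powr - (1/2)"
      proof -
        have "R powr (3/2) = R powr - (1/2) * R powr 2" by (simp add: powr_add[symmetric])
        then show ?thesis using R by simp
      qed
      finally show "(\<Sum>l\<in>?A. \<bar>l$i\<bar> powr - (3/2) / (l$j)\<^sup>2) \<le> K * R powr - (1/2)" .
    qed (use A K in auto)
    then show "(\<Sum>l\<in>A. \<bar>l$i\<bar> powr - (3/2) / (l$j)\<^sup>2) \<le> K / q * R0 powr - (1/2)"
      by (simp add: q_def)
  qed
qed

text \<open>Inside the cone both coordinates are bounded below, so a factor
  \<open>\<bar>l$1\<bar> powr - (1/2)\<close> of the weight can be replaced by a constant. What
  remains is the summand of \<open>tail_layer_bound\<close>.\<close>

lemma weight_cone_bound: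
  assumes e: "0 < e"
  shows "\<exists>K>0. \<forall>A. finite A \<longrightarrow> A \<subseteq> M - {0} \<longrightarrow> (\<forall>l\<in>A. e * \<bar>l$1\<bar> \<le> \<bar>l$2\<bar> \<and> e * \<bar>l$2\<bar> \<le> \<bar>l$1\<bar>) \<longrightarrow>
     sum weight A \<le> K"
proof -
  obtain K where K: "0 < K" and le: "\<And>R A. 0 < R \<Longrightarrow> finite A \<Longrightarrow> A \<subseteq> M - {0} \<Longrightarrow> (\<forall>l\<in>A. R \<le> \<bar>l$2\<bar>) \<Longrightarrow>
     (\<Sum>l\<in>A. \<bar>l$1\<bar> powr - (3/2) / (l$2)\<^sup>2) \<le> K * R powr - (1/2)"
    using tail_layer_bound[of 1 2] by auto
  \<comment> \<open>A lower bound for \<open>\<bar>l$2\<bar>\<close> on the cone: \<open>C * e \<le>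
    e * \<bar>l$1\<bar> * \<bar>l$2\<bar> \<le> \<bar>l$2\<bar>\<^sup>2\<close>.\<close>
  define r where "r = sqrt (C * e)"
  have r: "0 < r" using e C_pos by (simp add: r_def)
  show ?thesis
  proof (intro exI[of _ "(e * r) powr - (1/2) * (K * r powr - (1/2))"] conjI allI impI)
    show "0 < (e * r) powr - (1/2) * (K * r powr - (1/2))" using e r K by simp
    fix A assume A: "finite A" "A \<subseteq> M - {0}" "\<forall>l\<in>A. e * \<bar>l$1\<bar> \<le> \<bar>l$2\<bar> \<and> e * \<bar>l$2\<bar> \<le> \<bar>l$1\<bar>"
    have ge: "r \<le> \<bar>l$2\<bar>" if "l \<in> A" for l
      unfolding r_def
    proof (rule real_le_lsqrt)
      have "C * e \<le> (\<bar>l$1\<bar> * \<bar>l$2\<bar>) * e"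
        using adm_nth[of l 1 2] A that e by (intro mult_right_mono) auto
      also have "\<dots> = (e * \<bar>l$1\<bar>) * \<bar>l$2\<bar>" by simp
      also have "\<dots> \<le> \<bar>l$2\<bar> * \<bar>l$2\<bar>" using A that by (intro mult_right_mono) auto
      finally show "C * e \<le> \<bar>l$2\<bar>\<^sup>2" by (simp add: power2_eq_square)
    qed (use C_pos e in auto)
    have "sum weight A \<le> (\<Sum>l\<in>A. (e * r) powr - (1/2) * (\<bar>l$1\<bar> powr - (3/2) / (l$2)\<^sup>2))"
    proof (rule sum_mono)
      fix l assume l: "l \<in> A"
      have pos: "0 < \<bar>l$1\<bar>" using nth_pos l A by auto
      have "e * r \<le> e * \<bar>l$2\<bar>" using ge[OF l] e by simp
      also have "\<dots> \<le> \<bar>l$1\<bar>" using A l by auto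
      finally have le: "\<bar>l$1\<bar> powr - (1/2) \<le> (e * r) powr - (1/2)"
        using e r by (intro powr_mono2') auto
      have "weight l = \<bar>l$1\<bar> powr - 2 / (l$2)\<^sup>2"
        using pos by (simp add: weight_def powr_minus_divide)
      also have "\<bar>l$1\<bar> powr - 2 = \<bar>l$1\<bar> powr - (1/2) * \<bar>l$1\<bar> powr - (3/2)"
        by (simp add: powr_add[symmetric])
      also have "\<dots> \<le> (e * r) powr - (1/2) * \<bar>l$1\<bar> powr - (3/2)"
        using le by (intro mult_right_mono) auto
      finally show "weight l \<le> (e * r) powr - (1/2) * (\<bar>l$1\<bar> powr - (3/2) / (l$2)\<^sup>2)"
        by (simp add: divide_right_mono)
    qed
    also have "\<dots> = (e * r) powr - (1/2) * (\<Sum>l\<in>A. \<bar>l$1\<bar> powr - (3/2) / (l$2)\<^sup>2)"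
      by (simp only: sum_distrib_left)
    also have "\<dots> \<le> (e * r) powr - (1/2) * (K * r powr - (1/2))"
      using le[OF r A(1,2)] ge by (intro mult_left_mono) auto
    finally show "sum weight A \<le> (e * r) powr - (1/2) * (K * r powr - (1/2))" .
  qed
qed

text \<open>Interpolates between the bound \<open>z\<^sup>2\<close> for small \<open>z\<close> and
  the bound 1 for large \<open>z\<close>. The exponent \<open>1/2\<close> is what turns the weight's
  exponent 2 into the \<open>3/2\<close> of the tail sums.\<close>

lemma sin_squared_le: "(sin z)\<^sup>2 \<le> \<bar>z\<bar> powr (1/2)" for z :: real
proof (cases "\<bar>z\<bar> \<le> 1")
  case True
  have "(sin z)\<^sup>2 \<le> \<bar>z\<bar>\<^sup>2"
    using abs_sin_x_le_abs_x[of z] by (simp add: power2_le_iff_abs_le abs_le_square_iff[symmetric])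
  also have "\<dots> = \<bar>z\<bar> powr 2" by (cases "z = 0") auto
  also have "\<dots> \<le> \<bar>z\<bar> powr (1/2)" using True by (intro powr_mono') auto
  finally show ?thesis .
next
  case False
  have "(sin z)\<^sup>2 \<le> 1" by (simp add: power2_le_iff_abs_le abs_le_square_iff[symmetric] abs_square_le_1)
  also have "1 \<le> \<bar>z\<bar> powr (1/2)" using False by (intro ge_one_powr_ge_zero) auto
  finally show ?thesis .
qed

text \<open>Bounding the squared sine by \<open>(\<alpha> * T * \<bar>l$i\<bar>) powr (1/2)\<close>
  leads to the sum in \<open>tail_layer_bound\<close>, which beyond \<open>T / 2\<close> contributes
  \<open>(T / 2) powr - (1/2)\<close>. The powers of \<open>T\<close> cancel, so the bound is
  uniform in \<open>t\<close> and \<open>T\<close>.\<close>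

lemma half_tail_bound:
  fixes i j :: 2
  assumes ij: "i \<noteq> j" and al: "0 < \<alpha>"
  shows "\<exists>K>0. \<forall>t T A. 0 \<le> t \<longrightarrow> t \<le> T \<longrightarrow> 0 < T \<longrightarrow> finite A \<longrightarrow> A \<subseteq> M - {0} \<longrightarrow> (\<forall>l\<in>A. T / 2 \<le> \<bar>l$j\<bar>) \<longrightarrow>
     (\<Sum>l\<in>A. weight l * (sin (\<alpha> * l$i * t))\<^sup>2) \<le> K"
proof -
  obtain K where K: "0 < K" and le: "\<And>R A. 0 < R \<Longrightarrow> finite A \<Longrightarrow> A \<subseteq> M - {0} \<Longrightarrow> (\<forall>l\<in>A. R \<le> \<bar>l$j\<bar>) \<Longrightarrow>
     (\<Sum>l\<in>A. \<bar>l$i\<bar> powr - (3/2) / (l$j)\<^sup>2) \<le> K * R powr - (1/2)"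
    using tail_layer_bound[OF ij] by auto
  show ?thesis
  proof (intro exI[of _ "K * (2 * \<alpha>) powr (1/2)"] conjI allI impI)
    show "0 < K * (2 * \<alpha>) powr (1/2)" using al K by simp
    fix t T :: real and A
    assume t: "0 \<le> t" "t \<le> T" "0 < T" and A: "finite A" "A \<subseteq> M - {0}" "\<forall>l\<in>A. T / 2 \<le> \<bar>l$j\<bar>"
    have "(\<Sum>l\<in>A. weight l * (sin (\<alpha> * l$i * t))\<^sup>2) \<le>
        (\<Sum>l\<in>A. (\<alpha> * T) powr (1/2) * (\<bar>l$i\<bar> powr - (3/2) / (l$j)\<^sup>2))"
    proof (rule sum_mono)
      fix l assume l: "l \<in> A"
      have pos: "0 < \<bar>l$i\<bar>" using nth_pos l A by auto
      have "(sin (\<alpha> * l$i * t))\<^sup>2 \<le> \<bar>\<alpha> * l$i * t\<bar> powr (1/2)" by (rule sin_squared_le)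
      also have "\<dots> \<le> (\<alpha> * T * \<bar>l$i\<bar>) powr (1/2)"
        using t al by (intro powr_mono2) (auto simp: abs_mult mult.commute[of T] intro!: mult_left_mono)
      also have "\<dots> = (\<alpha> * T) powr (1/2) * \<bar>l$i\<bar> powr (1/2)"
        using t al by (subst powr_mult) auto
      finally have "weight l * (sin (\<alpha> * l$i * t))\<^sup>2 \<le> weight l * ((\<alpha> * T) powr (1/2) * \<bar>l$i\<bar> powr (1/2))"
        by (rule mult_left_mono[OF _ weight_nonneg])
      also have "\<dots> = (\<alpha> * T) powr (1/2) * ((\<bar>l$i\<bar> powr (1/2) * \<bar>l$i\<bar> powr - 2) / (l$j)\<^sup>2)"
        using pos by (simp add: weight_eq[OF ij] powr_minus_divide)
      also have "\<bar>l$i\<bar> powr (1/2) * \<bar>l$i\<bar> powr - 2 = \<bar>l$i\<bar> powr - (3/2)"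
        by (simp add: powr_add[symmetric])
      finally show "weight l * (sin (\<alpha> * l$i * t))\<^sup>2 \<le> (\<alpha> * T) powr (1/2) * (\<bar>l$i\<bar> powr - (3/2) / (l$j)\<^sup>2)" .
    qed
    also have "\<dots> = (\<alpha> * T) powr (1/2) * (\<Sum>l\<in>A. \<bar>l$i\<bar> powr - (3/2) / (l$j)\<^sup>2)"
      by (simp only: sum_distrib_left)
    also have "\<dots> \<le> (\<alpha> * T) powr (1/2) * (K * (T / 2) powr - (1/2))"
      using le[of "T/2"] t A by (intro mult_left_mono) auto
    also have "\<dots> = K * ((\<alpha> * T) powr (1/2) * (1 / (T / 2) powr (1/2)))"
      by (simp only: powr_minus_divide mult_ac)
    also have "(\<alpha> * T) powr (1/2) * (1 / (T / 2) powr (1/2)) = (2 * \<alpha>) powr (1/2)"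
      using t al by (simp add: powr_divide[symmetric] mult.commute)
    finally show "(\<Sum>l\<in>A. weight l * (sin (\<alpha> * l$i * t))\<^sup>2) \<le> K * (2 * \<alpha>) powr (1/2)" .
  qed
qed

text \<open>A vector of norm at least \<open>T\<close> has a coordinate of size at least
  \<open>T / 2\<close>. The sine of that coordinate is bounded by 1, and the other sine makes the
  sum converge.\<close>

lemma tail_bound:
  assumes al: "0 < \<alpha>" and be: "0 < \<beta>"
  shows "\<exists>K>0. \<forall>t T A. 0 \<le> t \<longrightarrow> t \<le> T \<longrightarrow> 0 < T \<longrightarrow> finite A \<longrightarrow> A \<subseteq> M - {0} \<longrightarrow> (\<forall>l\<in>A. T \<le> norm l) \<longrightarrow>
     (\<Sum>l\<in>A. weight l * ((sin (\<alpha> * l$1 * t))\<^sup>2 * (sin (\<beta> * l$2 * t))\<^sup>2)) \<le> K"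
proof -
  obtain K1 where K1: "0 < K1" and le1: "\<And>t T A. 0 \<le> t \<Longrightarrow> t \<le> T \<Longrightarrow> 0 < T \<Longrightarrow> finite A \<Longrightarrow> A \<subseteq> M - {0} \<Longrightarrow>
     (\<forall>l\<in>A. T / 2 \<le> \<bar>l$2\<bar>) \<Longrightarrow> (\<Sum>l\<in>A. weight l * (sin (\<alpha> * l$1 * t))\<^sup>2) \<le> K1"
    using half_tail_bound[of 1 2, OF _ al] by auto
  obtain K2 where K2: "0 < K2" and le2: "\<And>t T A. 0 \<le> t \<Longrightarrow> t \<le> T \<Longrightarrow> 0 < T \<Longrightarrow> finite A \<Longrightarrow> A \<subseteq> M - {0} \<Longrightarrow>
     (\<forall>l\<in>A. T / 2 \<le> \<bar>l$1\<bar>) \<Longrightarrow> (\<Sum>l\<in>A. weight l * (sin (\<beta> * l$2 * t))\<^sup>2) \<le> K2"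
    using half_tail_bound[of 2 1, OF _ be] by auto
  have sin1: "(sin x)\<^sup>2 \<le> 1" for x :: real by (simp add: abs_square_le_1)
  show ?thesis
  proof (intro exI[of _ "K1 + K2"] conjI allI impI)
    show "0 < K1 + K2" using K1 K2 by simp
    fix t T :: real and A
    assume t: "0 \<le> t" "t \<le> T" "0 < T" and A: "finite A" "A \<subseteq> M - {0}" "\<forall>l\<in>A. T \<le> norm l"
    let ?A1 = "{l\<in>A. T / 2 \<le> \<bar>l$2\<bar>}" and ?A2 = "{l\<in>A. \<not> T / 2 \<le> \<bar>l$2\<bar>}"
    let ?s = "\<lambda>l. (sin (\<alpha> * l$1 * t))\<^sup>2" and ?s' = "\<lambda>l. (sin (\<beta> * l$2 * t))\<^sup>2"
    have "A = ?A1 \<union> ?A2" by auto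
    then have "(\<Sum>l\<in>A. weight l * (?s l * ?s' l)) =
        (\<Sum>l\<in>?A1. weight l * (?s l * ?s' l)) + (\<Sum>l\<in>?A2. weight l * (?s l * ?s' l))"
      using A(1) by (subst sum.union_disjoint[symmetric]) auto
    also have "\<dots> \<le> (\<Sum>l\<in>?A1. weight l * ?s l) + (\<Sum>l\<in>?A2. weight l * ?s' l)"
      using sin1 by (intro add_mono sum_mono mult_left_mono weight_nonneg)
        (auto intro: mult_left_le mult_left_le_one_le)
    also have "\<dots> \<le> K1 + K2"
    proof (intro add_mono le1[OF t] le2[OF t])
      show "\<forall>l\<in>?A2. T / 2 \<le> \<bar>l$1\<bar>"
        using A(3) norm_le_nth[of 1 2, OF one_neq_two] by (smt (verit, best) field_sum_of_halves mem_Collect_eq)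
    qed (use A in auto)
    finally show "(\<Sum>l\<in>A. weight l * (?s l * ?s' l)) \<le> K1 + K2" .
  qed
qed

text \<open>Layers of bounded mass, multiplied by their scale, sum geometrically to the scale of the
  top one. The two coordinates are treated separately because a layer controls only one of
  them.\<close>

lemma weight_norm_bound:
  "\<exists>K>0. \<forall>T>0. (\<Sum>l | l \<in> M - {0} \<and> norm l \<le> T. weight l * norm l) \<le> K * T"
proof -
  have *: "\<exists>K>0. \<forall>T>0. (\<Sum>l | l \<in> M - {0} \<and> norm l \<le> T. weight l * \<bar>l$j\<bar>) \<le> K * T" if ij: "i \<noteq> j" for i j :: 2
  proof -
    obtain K where K: "0 < K" and le: "\<And>R A. 0 < R \<Longrightarrow> finite A \<Longrightarrow> A \<subseteq> M - {0} \<Longrightarrow>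
        (\<forall>l\<in>A. R \<le> \<bar>l$j\<bar> \<and> \<bar>l$j\<bar> < 2 * R) \<Longrightarrow> sum weight A \<le> K"
      using weight_layer_bound[OF ij] by auto
    show ?thesis
    proof (intro exI[of _ "2 * (2 * K)"] conjI allI impI)
      show "0 < 2 * (2 * K)" using K by simp
      fix T :: real assume T: "0 < T"
      show "(\<Sum>l | l \<in> M - {0} \<and> norm l \<le> T. weight l * \<bar>l$j\<bar>) \<le> 2 * (2 * K) * T"
      proof (rule sum_dyadic_down[where \<phi>="\<lambda>l. \<bar>l$j\<bar>"])
        fix R :: real assume R: "0 < R"
        let ?A = "{l \<in> {l. l \<in> M - {0} \<and> norm l \<le> T}. R \<le> \<bar>l$j\<bar> \<and> \<bar>l$j\<bar> < 2 * R}"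
        have "(\<Sum>l\<in>?A. weight l * \<bar>l$j\<bar>) \<le> (\<Sum>l\<in>?A. weight l * (2 * R))"
          by (intro sum_mono mult_left_mono weight_nonneg) auto
        also have "\<dots> = sum weight ?A * (2 * R)" by (simp only: sum_distrib_right)
        also have "\<dots> \<le> K * (2 * R)"
          using R by (intro mult_right_mono le finite_subset[OF _ finite_ball[of T]]) auto
        finally show "(\<Sum>l\<in>?A. weight l * \<bar>l$j\<bar>) \<le> 2 * K * R" by simp
      qed (use K T nth_pos finite_ball abs_nth_le_norm order_trans in \<open>auto, blast\<close>)
    qed
  qed
  obtain K1 where K1: "0 < K1" "\<And>T. 0 < T \<Longrightarrow> (\<Sum>l | l \<in> M - {0} \<and> norm l \<le> T. weight l * \<bar>l$1\<bar>) \<le> K1 * T"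
    using *[of 2 1] by auto
  obtain K2 where K2: "0 < K2" "\<And>T. 0 < T \<Longrightarrow> (\<Sum>l | l \<in> M - {0} \<and> norm l \<le> T. weight l * \<bar>l$2\<bar>) \<le> K2 * T"
    using *[of 1 2] by auto
  show ?thesis
  proof (intro exI[of _ "K1 + K2"] conjI allI impI)
    show "0 < K1 + K2" using K1 K2 by simp
    fix T :: real assume T: "0 < T"
    have "(\<Sum>l | l \<in> M - {0} \<and> norm l \<le> T. weight l * norm l) \<le>
        (\<Sum>l | l \<in> M - {0} \<and> norm l \<le> T. weight l * \<bar>l$1\<bar> + weight l * \<bar>l$2\<bar>)"
      using norm_le_nth[of 1 2] weight_nonneg
      by (intro sum_mono) (auto simp: distrib_left[symmetric] intro!: mult_left_mono)
    also have "\<dots> \<le> (K1 + K2) * T"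
      using K1(2)[OF T] K2(2)[OF T] by (simp only: sum.distrib) (simp add: distrib_right)
    finally show "(\<Sum>l | l \<in> M - {0} \<and> norm l \<le> T. weight l * norm l) \<le> (K1 + K2) * T" .
  qed
qed

end

section \<open>Second moments of oscillating sums\<close>

text \<open>The product has the frequencies \<open>\<alpha> - \<beta>\<close> and
  \<open>\<alpha> + \<beta>\<close>, and
  \<open>\<bar>\<bar>\<alpha>\<bar> - \<bar>\<beta>\<bar>\<bar>\<close> is the smaller of their
  absolute values; each contributes half of the bound.\<close>

lemma cos_product_integral_le:
  fixes \<alpha> \<beta> T :: real
  assumes T: "0 \<le> T" and ne: "\<bar>\<alpha>\<bar> \<noteq> \<bar>\<beta>\<bar>"
  shows "\<bar>integral {0..T} (\<lambda>t. cos (\<alpha> * t) * cos (\<beta> * t))\<bar> \<le> 1 / \<bar>\<bar>\<alpha>\<bar> - \<bar>\<beta>\<bar>\<bar>"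
proof -
  define m p where "m = \<alpha> - \<beta>" and "p = \<alpha> + \<beta>"
  have mp: "m \<noteq> 0" "p \<noteq> 0" using ne unfolding m_def p_def by auto
  define F where "F t = sin (m * t) / (2 * m) + sin (p * t) / (2 * p)" for t
  have "((\<lambda>t. cos (\<alpha> * t) * cos (\<beta> * t)) has_integral (F T - F 0)) {0..T}"
  proof (rule fundamental_theorem_of_calculus[OF T])
    fix t
    have "(F has_real_derivative (cos (m * t) * m / (2 * m) + cos (p * t) * p / (2 * p))) (at t within {0..T})"
      unfolding F_def using mp by (auto intro!: derivative_eq_intros)
    also have "cos (m * t) * m / (2 * m) + cos (p * t) * p / (2 * p) = cos (\<alpha> * t) * cos (\<beta> * t)"
      proof -
      have "cos (m * t) * m / (2 * m) + cos (p * t) * p / (2 * p) = (cos (m * t) + cos (p * t)) / 2"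
        using mp by simp
      also have "\<dots> = cos (\<alpha> * t) * cos (\<beta> * t)"
        by (simp add: cos_times_cos m_def p_def left_diff_distrib distrib_right)
      finally show ?thesis .
    qed
    finally show "(F has_vector_derivative cos (\<alpha> * t) * cos (\<beta> * t)) (at t within {0..T})"
      by (simp add: has_real_derivative_iff_has_vector_derivative)
  qed
  then have "\<bar>integral {0..T} (\<lambda>t. cos (\<alpha> * t) * cos (\<beta> * t))\<bar> = \<bar>F T\<bar>"
    by (simp add: integral_unique F_def)
  also have "\<dots> \<le> \<bar>sin (m * T) / (2 * m)\<bar> + \<bar>sin (p * T) / (2 * p)\<bar>"
    unfolding F_def by (rule abs_triangle_ineq)
  also have "\<dots> \<le> 1 / (2 * \<bar>m\<bar>) + 1 / (2 * \<bar>p\<bar>)"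
    by (intro add_mono) (auto simp: abs_mult intro!: divide_right_mono)
  also have "\<dots> \<le> 1 / (2 * \<bar>\<bar>\<alpha>\<bar> - \<bar>\<beta>\<bar>\<bar>) + 1 / (2 * \<bar>\<bar>\<alpha>\<bar> - \<bar>\<beta>\<bar>\<bar>)"
    using ne mp by (intro add_mono divide_left_mono mult_pos_pos mult_left_mono) (auto simp: m_def p_def)
  also have "\<dots> = 1 / \<bar>\<bar>\<alpha>\<bar> - \<bar>\<beta>\<bar>\<bar>" by simp
  finally show ?thesis .
qed

lemma cos_product_integral_le_length:
  fixes \<alpha> \<beta> T :: real
  assumes T: "0 \<le> T"
  shows "\<bar>integral {0..T} (\<lambda>t. cos (\<alpha> * t) * cos (\<beta> * t))\<bar> \<le> T"
proof -
  have "norm (integral {0..T} (\<lambda>t. cos (\<alpha> * t) * cos (\<beta> * t))) \<le> 1 * (T - 0)"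
    by (rule integral_bound[OF T]) (auto simp: abs_mult intro!: continuous_intros mult_le_one)
  then show ?thesis by simp
qed

context admissible_group
begin

text \<open>For fixed \<open>l\<close>, the vectors of comparable norm lie in one shell of bounded
  mass, so the trivial bound \<open>T\<close> for the integral costs \<open>T * K1\<close> per unit
  of weight. The remaining pairs cost \<open>(norm l + norm l') / c\<close>; by symmetry their sum
  is at most \<open>2 / c\<close> times the total weight times the sum of
  \<open>weight l * norm l\<close>, and the latter is \<open>O(T)\<close>. The gain over the trivial
  bound is one factor \<open>V M T\<close>.\<close>

lemma second_moment_bound:
  fixes f :: "real^2 \<Rightarrow> real"
  assumes D: "D \<subseteq> M - {0}" and Q: "1 \<le> Q" and c: "0 < c"
    and sep: "\<And>l l'. l \<in> D \<Longrightarrow> l' \<in> D \<Longrightarrow> Q * norm l' < norm l \<Longrightarrow> c / (norm l + norm l') \<le> \<bar>\<bar>f l\<bar> - \<bar>f l'\<bar>\<bar>"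
  shows "\<exists>K>0. \<forall>T>0. integral {0..T} (\<lambda>t. (\<Sum>l | l \<in> D \<and> norm l \<le> T. weight l * cos (f l * t))\<^sup>2) \<le> K * T * V M T"
proof -
  \<comment> \<open>Norms within a factor \<open>Q\<close> of \<open>norm l\<close> on either side
    span a ratio of \<open>Q\<^sup>2\<close>.\<close>
  have Q2: "1 \<le> Q\<^sup>2" using Q by simp
  obtain K1 where K1: "0 < K1" and shell: "\<And>r A. 0 < r \<Longrightarrow> finite A \<Longrightarrow> A \<subseteq> M - {0} \<Longrightarrow>
      (\<forall>l\<in>A. r \<le> norm l \<and> norm l \<le> Q\<^sup>2 * r) \<Longrightarrow> sum weight A \<le> K1"
    using weight_shell_bound[OF Q2] by auto
  obtain K2 where K2: "0 < K2" and wn: "\<And>T. 0 < T \<Longrightarrow> (\<Sum>l | l \<in> M - {0} \<and> norm l \<le> T. weight l * norm l) \<le> K2 * T"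
    using weight_norm_bound by auto
  show ?thesis
  proof (intro exI[of _ "K1 + 2 * K2 / c"] conjI allI impI)
    show "0 < K1 + 2 * K2 / c" using K1 K2 c by (simp add: add_pos_pos)
    fix T :: real assume T: "0 < T"
    let ?B = "{l. l \<in> D \<and> norm l \<le> T}"
    let ?I = "\<lambda>l l'. integral {0..T} (\<lambda>t. cos (f l * t) * cos (f l' * t))"
    let ?cl = "\<lambda>l l'. norm l \<le> Q * norm l' \<and> norm l' \<le> Q * norm l"
    have finB: "finite ?B" using D by (intro finite_subset[OF _ finite_ball[of T]]) auto
    have V: "sum weight ?B \<le> V M T"
      unfolding V_eq using D by (intro sum_mono2 finite_ball) (auto simp: weight_nonneg)
    have W: "(\<Sum>l\<in>?B. weight l * norm l) \<le> K2 * T"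
    proof -
      have "(\<Sum>l\<in>?B. weight l * norm l) \<le> (\<Sum>l | l \<in> M - {0} \<and> norm l \<le> T. weight l * norm l)"
        using D by (intro sum_mono2 finite_ball) (auto simp: weight_nonneg)
      then show ?thesis using wn[OF T] by simp
    qed
    have I: "?I l l' \<le> (if ?cl l l' then T else 0) + (norm l + norm l') / c" if l: "l \<in> ?B" "l' \<in> ?B" for l l'
    proof (cases "?cl l l'")
      case True
      then show ?thesis
        using cos_product_integral_le_length[of T "f l" "f l'"] T c by (simp add: add_increasing2)
    next
      case False
      have pos: "0 < norm l" "0 < norm l'" using l D by auto
      have ge: "c / (norm l + norm l') \<le> \<bar>\<bar>f l\<bar> - \<bar>f l'\<bar>\<bar>"
        using False sep[of l l'] sep[of l' l] l by (auto simp: not_le add.commute abs_minus_commute)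
      have "0 < c / (norm l + norm l')" using c pos by (intro divide_pos_pos add_pos_pos)
      with ge have pos': "0 < \<bar>\<bar>f l\<bar> - \<bar>f l'\<bar>\<bar>" by linarith
      have "1 / \<bar>\<bar>f l\<bar> - \<bar>f l'\<bar>\<bar> \<le> 1 / (c / (norm l + norm l'))"
        by (rule divide_left_mono[OF ge]) (simp, intro mult_pos_pos pos' divide_pos_pos add_pos_pos c pos)
      moreover from pos' have "\<bar>f l\<bar> \<noteq> \<bar>f l'\<bar>" by linarith
      from cos_product_integral_le[OF less_imp_le[OF T] this]
      have "?I l l' \<le> 1 / \<bar>\<bar>f l\<bar> - \<bar>f l'\<bar>\<bar>" by linarith
      ultimately have "?I l l' \<le> 1 / (c / (norm l + norm l'))" by linarith
      then show ?thesis using False by auto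
    qed
    have "integral {0..T} (\<lambda>t. (\<Sum>l\<in>?B. weight l * cos (f l * t))\<^sup>2) =
        integral {0..T} (\<lambda>t. \<Sum>l\<in>?B. \<Sum>l'\<in>?B. weight l * weight l' * (cos (f l * t) * cos (f l' * t)))"
      by (simp add: power2_eq_square sum_product mult_ac)
    also have "\<dots> = (\<Sum>l\<in>?B. integral {0..T} (\<lambda>t. \<Sum>l'\<in>?B. weight l * weight l' * (cos (f l * t) * cos (f l' * t))))"
      by (rule integral_sum[OF finB]) (intro integrable_continuous_interval continuous_intros)
    also have "\<dots> = (\<Sum>l\<in>?B. \<Sum>l'\<in>?B. integral {0..T} (\<lambda>t. weight l * weight l' * (cos (f l * t) * cos (f l' * t))))"
      by (rule sum.cong[OF refl], rule integral_sum[OF finB]) (intro integrable_continuous_interval continuous_intros)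
    also have "\<dots> = (\<Sum>l\<in>?B. \<Sum>l'\<in>?B. weight l * weight l' * ?I l l')"
      by simp
    also have "\<dots> \<le> (\<Sum>l\<in>?B. \<Sum>l'\<in>?B. weight l * weight l' * ((if ?cl l l' then T else 0) + (norm l + norm l') / c))"
      by (intro sum_mono mult_left_mono I mult_nonneg_nonneg weight_nonneg)
    also have "\<dots> = (\<Sum>l\<in>?B. weight l * T * (\<Sum>l'\<in>?B. if ?cl l l' then weight l' else 0)) +
        (\<Sum>l\<in>?B. \<Sum>l'\<in>?B. weight l * weight l' * ((norm l + norm l') / c))"
      unfolding sum_distrib_left sum.distrib[symmetric]
      by (intro sum.cong refl) (simp add: distrib_left)
    also have "(\<Sum>l\<in>?B. \<Sum>l'\<in>?B. weight l * weight l' * ((norm l + norm l') / c)) =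
        2 / c * (sum weight ?B * (\<Sum>l\<in>?B. weight l * norm l))"
    proof -
      have "(\<Sum>l\<in>?B. \<Sum>l'\<in>?B. weight l * weight l' * ((norm l + norm l') / c)) =
          (\<Sum>l\<in>?B. \<Sum>l'\<in>?B. (weight l * norm l) * weight l' / c) + (\<Sum>l\<in>?B. \<Sum>l'\<in>?B. weight l * (weight l' * norm l') / c)"
        by (simp add: sum.distrib[symmetric] algebra_simps add_divide_distrib)
      also have "\<dots> = (\<Sum>l\<in>?B. weight l * norm l) * sum weight ?B / c + sum weight ?B * (\<Sum>l\<in>?B. weight l * norm l) / c"
        by (simp only: sum_product sum_divide_distrib)
      finally show ?thesis by (simp add: algebra_simps)
    qed
    also have "(\<Sum>l\<in>?B. weight l * T * (\<Sum>l'\<in>?B. if ?cl l l' then weight l' else 0)) \<le> (\<Sum>l\<in>?B. weight l * T * K1)"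
    proof (intro sum_mono mult_left_mono)
      fix l assume l: "l \<in> ?B"
      have "(\<Sum>l'\<in>?B. if ?cl l l' then weight l' else 0) = sum weight {l'\<in>?B. ?cl l l'}"
        by (rule sum.inter_filter[OF finB, symmetric])
      also have "\<dots> \<le> K1"
      proof (rule shell[of "norm l / Q"])
        show "0 < norm l / Q" using l D Q by (intro divide_pos_pos) auto
        show "\<forall>l'\<in>{l'\<in>?B. ?cl l l'}. norm l / Q \<le> norm l' \<and> norm l' \<le> Q\<^sup>2 * (norm l / Q)"
          using Q by (auto simp: pos_divide_le_eq power2_eq_square mult.commute)
        show "finite {l'\<in>?B. ?cl l l'}" using finB by (rule rev_finite_subset) auto
      qed (use D in auto)
      finally show "(\<Sum>l'\<in>?B. if ?cl l l' then weight l' else 0) \<le> K1" .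
      show "0 \<le> weight l * T" using T by (simp add: weight_nonneg)
    qed
    also have "(\<Sum>l\<in>?B. weight l * T * K1) = sum weight ?B * (T * K1)"
      unfolding sum_distrib_right by (simp add: mult_ac)
    also have "sum weight ?B * (T * K1) + 2 / c * (sum weight ?B * (\<Sum>l\<in>?B. weight l * norm l)) \<le>
        V M T * (T * K1) + 2 / c * (V M T * (K2 * T))"
      using V W T K1 c V_nonneg
      by (intro add_mono mult_mono mult_left_mono mult_right_mono) (auto intro!: sum_nonneg mult_nonneg_nonneg weight_nonneg)
    also have "\<dots> = (K1 + 2 * K2 / c) * T * V M T" by (simp add: algebra_simps)
    finally show "integral {0..T} (\<lambda>t. (\<Sum>l\<in>?B. weight l * cos (f l * t))\<^sup>2) \<le> (K1 + 2 * K2 / c) * T * V M T"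
      by simp
  qed
qed

text \<open>Both \<open>l - l'\<close> and \<open>l + l'\<close> belong to \<open>M\<close> and have
  norm at most \<open>norm l + norm l'\<close>, so admissibility bounds their coordinate
  \<open>i\<close> below by \<open>C / (norm l + norm l')\<close>. The smaller of the two is the
  distance of the absolute frequencies. Taking \<open>Q = 1\<close> is possible because unequal
  norms already make both vectors nonzero.\<close>

lemma nth_second_moment_bound:
  fixes i j :: 2
  assumes ij: "i \<noteq> j" and al: "0 < \<alpha>"
  shows "\<exists>K>0. \<forall>T>0. integral {0..T} (\<lambda>t. (\<Sum>l | l \<in> M - {0} \<and> norm l \<le> T. weight l * cos (\<alpha> * l$i * t))\<^sup>2) \<le> K * T * V M T"
proof (rule second_moment_bound[where Q=1 and c="\<alpha> * C"])
  fix l l' assume l: "l \<in> M - {0}" "l' \<in> M - {0}" "1 * norm l' < norm l"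
  have key: "C / (norm l + norm l') \<le> \<bar>x$i\<bar>" if x: "x \<in> M" "x \<noteq> 0" "norm x \<le> norm l + norm l'" for x
  proof -
    have "C \<le> \<bar>x$i\<bar> * \<bar>x$j\<bar>" using adm_nth[OF x(1,2) ij] .
    also have "\<dots> \<le> \<bar>x$i\<bar> * (norm l + norm l')"
      using abs_nth_le_norm[of x j] x(3) by (intro mult_left_mono) auto
    finally show ?thesis using l by (simp add: pos_divide_le_eq add_pos_pos)
  qed
  have "C / (norm l + norm l') \<le> \<bar>(l - l')$i\<bar>"
    using l by (intro key diff_mem norm_triangle_ineq4) auto
  moreover have "l + l' \<noteq> 0"
  proof
    assume "l + l' = 0"
    then have "norm l = norm l'" by (metis add_eq_0_iff norm_minus_cancel)
    then show False using l by simp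
  qed
  then have "C / (norm l + norm l') \<le> \<bar>(l + l')$i\<bar>"
    using l by (intro key add_mem norm_triangle_ineq) auto
  ultimately have "C / (norm l + norm l') \<le> \<bar>\<bar>l$i\<bar> - \<bar>l'$i\<bar>\<bar>"
    unfolding vector_minus_component vector_add_component by linarith
  then have "\<alpha> * (C / (norm l + norm l')) \<le> \<alpha> * \<bar>\<bar>l$i\<bar> - \<bar>l'$i\<bar>\<bar>"
    using al by (intro mult_left_mono) auto
  also have "\<dots> = \<bar>\<bar>\<alpha> * l$i\<bar> - \<bar>\<alpha> * l'$i\<bar>\<bar>"
    using al by (simp add: abs_mult right_diff_distrib[symmetric])
  finally show "\<alpha> * C / (norm l + norm l') \<le> \<bar>\<bar>\<alpha> * l$i\<bar> - \<bar>\<alpha> * l'$i\<bar>\<bar>" by simp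
qed (use al C_pos in auto)

text \<open>Away from the two resonant directions a linear form is comparable to the norm.\<close>

lemma mixed_second_moment_bound:
  assumes al: "0 < \<alpha>" and be: "0 < \<bar>\<beta>\<bar>" and e: "0 < e" "e \<le> 1/2" "e * \<bar>\<beta>\<bar> \<le> \<alpha> / 2" "e * \<alpha> \<le> \<bar>\<beta>\<bar> / 2"
  defines "D \<equiv> {l\<in>M - {0}. \<not> (e * \<bar>l$1\<bar> \<le> \<bar>l$2\<bar> \<and> e * \<bar>l$2\<bar> \<le> \<bar>l$1\<bar>)}"
  shows "\<exists>K>0. \<forall>T>0. integral {0..T} (\<lambda>t. (\<Sum>l | l \<in> D \<and> norm l \<le> T. weight l * cos ((\<alpha> * l$1 + \<beta> * l$2) * t))\<^sup>2) \<le> K * T * V M T"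
proof -
  \<comment> \<open>Off the cone one coordinate dominates: it is at least half the norm, and the
    other term of the linear form takes away at most half of the dominant one. The two halves give
    the divisor 4.\<close>
  define c where "c = min \<alpha> \<bar>\<beta>\<bar> / 4"
  define d where "d = \<alpha> + \<bar>\<beta>\<bar>"
  have c: "0 < c" "c \<le> d" using al be by (auto simp: c_def d_def)
  have up: "\<bar>\<alpha> * l$1 + \<beta> * l$2\<bar> \<le> d * norm l" for l :: "real^2"
  proof -
    have "\<bar>\<alpha> * l$1 + \<beta> * l$2\<bar> \<le> \<alpha> * \<bar>l$1\<bar> + \<bar>\<beta>\<bar> * \<bar>l$2\<bar>"
      using abs_triangle_ineq[of "\<alpha> * l$1" "\<beta> * l$2"] al by (simp add: abs_mult)
    also have "\<dots> \<le> \<alpha> * norm l + \<bar>\<beta>\<bar> * norm l"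
      using al by (intro add_mono mult_left_mono abs_nth_le_norm) auto
    finally show ?thesis by (simp add: d_def distrib_right)
  qed
  have low: "c * norm l \<le> \<bar>\<alpha> * l$1 + \<beta> * l$2\<bar>" if l: "l \<in> D" for l
  proof -
    have nl: "norm l \<le> \<bar>l$1\<bar> + \<bar>l$2\<bar>" by (rule norm_le_nth) simp
    have tri: "\<bar>\<alpha> * \<bar>l$1\<bar> - \<bar>\<beta>\<bar> * \<bar>l$2\<bar>\<bar> \<le> \<bar>\<alpha> * l$1 + \<beta> * l$2\<bar>"
      using abs_triangle_ineq3[of "\<alpha> * l$1" "- (\<beta> * l$2)"] al by (simp add: abs_mult)
    consider "\<bar>l$2\<bar> < e * \<bar>l$1\<bar>" | "\<bar>l$1\<bar> < e * \<bar>l$2\<bar>" using l unfolding D_def by fastforce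
    then show ?thesis
    proof cases
      case 1
      have "\<bar>\<beta>\<bar> * \<bar>l$2\<bar> \<le> \<bar>\<beta>\<bar> * (e * \<bar>l$1\<bar>)" using 1 by (intro mult_left_mono) auto
      also have "\<dots> = (e * \<bar>\<beta>\<bar>) * \<bar>l$1\<bar>" by simp
      also have "\<dots> \<le> \<alpha> / 2 * \<bar>l$1\<bar>" using e by (intro mult_right_mono) auto
      finally have a: "\<alpha> / 2 * \<bar>l$1\<bar> \<le> \<alpha> * \<bar>l$1\<bar> - \<bar>\<beta>\<bar> * \<bar>l$2\<bar>" by simp
      have "e * \<bar>l$1\<bar> \<le> 1 * \<bar>l$1\<bar>" using e by (intro mult_right_mono) auto
      then have "norm l \<le> 2 * \<bar>l$1\<bar>" using nl 1 by simp
      then have "c * norm l \<le> \<alpha> / 4 * (2 * \<bar>l$1\<bar>)" using al unfolding c_def by (intro mult_mono) auto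
      then show ?thesis using a tri by linarith
    next
      case 2
      have "\<alpha> * \<bar>l$1\<bar> \<le> \<alpha> * (e * \<bar>l$2\<bar>)" using 2 al by (intro mult_left_mono) auto
      also have "\<dots> = (e * \<alpha>) * \<bar>l$2\<bar>" by simp
      also have "\<dots> \<le> \<bar>\<beta>\<bar> / 2 * \<bar>l$2\<bar>" using e by (intro mult_right_mono) auto
      finally have a: "\<bar>\<beta>\<bar> / 2 * \<bar>l$2\<bar> \<le> \<bar>\<beta>\<bar> * \<bar>l$2\<bar> - \<alpha> * \<bar>l$1\<bar>" by simp
      have "e * \<bar>l$2\<bar> \<le> 1 * \<bar>l$2\<bar>" using e by (intro mult_right_mono) auto
      then have "norm l \<le> 2 * \<bar>l$2\<bar>" using nl 2 by simp
      then have "c * norm l \<le> \<bar>\<beta>\<bar> / 4 * (2 * \<bar>l$2\<bar>)" unfolding c_def by (intro mult_mono) auto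
      then show ?thesis using a tri by linarith
    qed
  qed
  show ?thesis
  \<comment> \<open>With norms a factor \<open>2 * d / c\<close> apart, the absolute frequencies
    differ by at least \<open>c * norm l / 2\<close>; the inequality
    \<open>C \<le> norm l * norm l\<close> converts this into the required reciprocal form.\<close>
  proof (rule second_moment_bound[where Q="2 * d / c" and c="c / 2 * C"])
    fix l l' assume l: "l \<in> D" "l' \<in> D" "2 * d / c * norm l' < norm l"
    have lM: "l \<in> M" "l \<noteq> 0" using l unfolding D_def by auto
    have "d * norm l' \<le> c * norm l / 2" using l(3) c by (simp add: field_simps)
    then have "c * norm l / 2 \<le> \<bar>\<bar>\<alpha> * l$1 + \<beta> * l$2\<bar> - \<bar>\<alpha> * l'$1 + \<beta> * l'$2\<bar>\<bar>"
      using low[OF l(1)] up[of l'] by linarith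
    moreover have "c / 2 * C / (norm l + norm l') \<le> c * norm l / 2"
    proof -
      have "C \<le> norm l * norm l"
        using norm_ge[OF lM] C_pos by (metis abs_norm_cancel power2_eq_square real_sqrt_abs real_sqrt_le_iff)
      also have "\<dots> \<le> norm l * (norm l + norm l')" by (intro mult_left_mono) auto
      finally have "c / 2 * C \<le> c / 2 * (norm l * (norm l + norm l'))" using c by (intro mult_left_mono) auto
      then have "c / 2 * C \<le> c * norm l / 2 * (norm l + norm l')" by (simp add: mult_ac)
      moreover have "0 < norm l + norm l'" using lM by (simp add: add_pos_nonneg)
      ultimately show ?thesis by (subst pos_divide_le_eq)
    qed
    ultimately show "c / 2 * C / (norm l + norm l') \<le> \<bar>\<bar>\<alpha> * l$1 + \<beta> * l$2\<bar> - \<bar>\<alpha> * l'$1 + \<beta> * l'$2\<bar>\<bar>"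
      by linarith
  qed (use c C_pos D_def in auto)
qed

end

section \<open>Dirichlet's argument and the growth of the weight\<close>

context admissible_group
begin

text \<open>The combinations with coefficients between 0 and \<open>N\<close> have first coordinates
  of size at most \<open>N * s\<close>. When this range is cut into pieces of length
  \<open>2 * s / N\<close>, two combinations share a piece; their difference is small in the first
  coordinate and \<open>O(N)\<close> in the second, and \<open>ind\<close> keeps it from
  vanishing.\<close>

lemma dirichlet_pigeonhole:
  assumes M: "M = {of_int m *\<^sub>R u + of_int n *\<^sub>R v | m n. True}"
    and ind: "\<And>m n :: int. of_int m *\<^sub>R u + of_int n *\<^sub>R v = 0 \<Longrightarrow> m = 0 \<and> n = 0"
  shows "\<exists>K\<ge>1. \<forall>N\<ge>1. \<exists>l\<in>M - {0}. \<bar>l$1\<bar> \<le> K / real N \<and> \<bar>l$2\<bar> \<le> K * real N"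
proof -
  define s where "s = \<bar>u$1\<bar> + \<bar>v$1\<bar> + 1"
  define K where "K = 2 * s + \<bar>u$2\<bar> + \<bar>v$2\<bar>"
  have s: "1 \<le> s" by (simp add: s_def)
  show ?thesis
  proof (intro exI[of _ K] conjI allI impI)
    show "1 \<le> K" using s by (simp add: K_def)
    fix N :: nat assume N: "1 \<le> N"
    define pt where "pt p = of_int (fst p) *\<^sub>R u + of_int (snd p) *\<^sub>R v" for p :: "int \<times> int"
    let ?A = "{0..int N} \<times> {0..int N}"
    define cell where "cell p = \<lfloor>((pt p)$1 + real N * s) * (real N / (2 * s))\<rfloor>" for p
    have b1: "\<bar>(pt p)$1\<bar> \<le> real N * s" if "p \<in> ?A" for p
    proof -
      have "\<bar>(pt p)$1\<bar> \<le> real_of_int (fst p) * \<bar>u$1\<bar> + real_of_int (snd p) * \<bar>v$1\<bar>"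
        using that abs_triangle_ineq[of "real_of_int (fst p) * u$1" "real_of_int (snd p) * v$1"]
        by (auto simp: pt_def abs_mult)
      also have "\<dots> \<le> real N * \<bar>u$1\<bar> + real N * \<bar>v$1\<bar>"
        using that by (intro add_mono mult_right_mono) auto
      also have "\<dots> \<le> real N * s" by (simp add: s_def distrib_left)
      finally show ?thesis .
    qed
    have "cell ` ?A \<subseteq> {0..int N * int N}"
    proof
      fix k assume "k \<in> cell ` ?A"
      then obtain p where p: "p \<in> ?A" "k = cell p" by auto
      have "0 \<le> ((pt p)$1 + real N * s) * (real N / (2 * s))"
        using b1[OF p(1)] s by (intro mult_nonneg_nonneg) (linarith, simp)
      moreover have "((pt p)$1 + real N * s) * (real N / (2 * s)) \<le> (2 * (real N * s)) * (real N / (2 * s))"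
        using b1[OF p(1)] s by (intro mult_right_mono) (linarith, simp)
      then have "((pt p)$1 + real N * s) * (real N / (2 * s)) \<le> of_int (int N * int N)"
        using s by (simp add: field_simps)
      ultimately show "k \<in> {0..int N * int N}"
        unfolding p(2) cell_def by (auto intro: floor_le_iff[THEN iffD2] simp: floor_le_iff)
    qed
    then have "card (cell ` ?A) \<le> card {0..int N * int N}" by (rule card_mono[rotated]) simp
    \<comment> \<open>One index more than \<open>N * N\<close>, because the right end point of the
      range begins a piece of its own. The \<open>(N + 1)\<^sup>2\<close> points still outnumber the
      indices.\<close>
    also have "\<dots> = N * N + 1" by (simp add: nat_add_distrib nat_mult_distrib)
    also have "\<dots> < card ?A" using N by (simp add: card_cartesian_product nat_add_distrib)
    finally have "\<not> inj_on cell ?A" by (rule pigeonhole)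
    then obtain p q where pq: "p \<in> ?A" "q \<in> ?A" "p \<noteq> q" "cell p = cell q"
      unfolding inj_on_def by blast
    define l where "l = of_int (fst p - fst q) *\<^sub>R u + of_int (snd p - snd q) *\<^sub>R v"
    have lpq: "l = pt p - pt q" by (simp add: l_def pt_def algebra_simps)
    have "l \<in> M" unfolding M l_def by blast
    moreover have "l \<noteq> 0"
      using ind[of "fst p - fst q" "snd p - snd q"] pq(3) by (auto simp: l_def prod_eq_iff)
    moreover have "\<bar>l$1\<bar> \<le> K / real N"
    proof -
      have "\<bar>((pt p)$1 + real N * s) * (real N / (2 * s)) - ((pt q)$1 + real N * s) * (real N / (2 * s))\<bar> < 1"
        using pq(4) unfolding cell_def by linarith
      also have "((pt p)$1 + real N * s) * (real N / (2 * s)) - ((pt q)$1 + real N * s) * (real N / (2 * s)) =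
          l$1 * (real N / (2 * s))"
        unfolding lpq by (simp add: algebra_simps)
      finally have "\<bar>l$1\<bar> * (real N / (2 * s)) < 1" using s by (simp add: abs_mult)
      then have "\<bar>l$1\<bar> * real N < 2 * s" using s by (simp add: field_simps)
      also have "\<dots> \<le> K" by (simp add: K_def)
      finally show ?thesis using N by (simp add: field_simps)
    qed
    moreover have "\<bar>l$2\<bar> \<le> K * real N"
    proof -
      have "\<bar>l$2\<bar> \<le> \<bar>real_of_int (fst p - fst q)\<bar> * \<bar>u$2\<bar> + \<bar>real_of_int (snd p - snd q)\<bar> * \<bar>v$2\<bar>"
        using abs_triangle_ineq[of "real_of_int (fst p - fst q) * u$2" "real_of_int (snd p - snd q) * v$2"]
        by (simp add: l_def abs_mult)
      also have "\<dots> \<le> real N * \<bar>u$2\<bar> + real N * \<bar>v$2\<bar>"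
        using pq(1,2) by (intro add_mono mult_right_mono) auto
      also have "\<dots> \<le> K * real N" using s by (simp add: K_def algebra_simps)
      finally show ?thesis .
    qed
    ultimately show "\<exists>l\<in>M - {0}. \<bar>l$1\<bar> \<le> K / real N \<and> \<bar>l$2\<bar> \<le> K * real N" by blast
  qed
qed

text \<open>The vectors found for \<open>N = q ^ k\<close> have coordinate product at most
  \<open>K\<^sup>2\<close>, hence weight at least \<open>1 / K ^ 4\<close>, and norm at most
  \<open>2 * K * q ^ k\<close>. About \<open>ln t / ln q\<close> of them fit into the ball of radius
  \<open>t\<close>.\<close>

lemma V_lower:
  assumes M: "M = {of_int m *\<^sub>R u + of_int n *\<^sub>R v | m n. True}"
    and ind: "\<And>m n :: int. of_int m *\<^sub>R u + of_int n *\<^sub>R v = 0 \<Longrightarrow> m = 0 \<and> n = 0"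
  shows "\<exists>c>0. \<forall>\<^sub>F t in at_top. c * ln t \<le> V M t"
proof -
  obtain K where K: "1 \<le> K" and dir: "\<And>N. 1 \<le> N \<Longrightarrow> \<exists>l\<in>M - {0}. \<bar>l$1\<bar> \<le> K / real N \<and> \<bar>l$2\<bar> \<le> K * real N"
    using dirichlet_pigeonhole[OF M ind] by auto
  \<comment> \<open>The choice \<open>q > K\<^sup>2 / C\<close> puts the upper bound
    \<open>K * q ^ k\<close> for one second coordinate below the lower bound
    \<open>C / K * q ^ (k + 1)\<close> for the next, which makes the vectors distinct.\<close>
  define q where "q = nat \<lceil>K\<^sup>2 / C\<rceil> + 2"
  have q2: "2 \<le> q" "1 < real q" by (auto simp: q_def)
  have qK: "K\<^sup>2 / C < real q" unfolding q_def by linarith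
  have "1 \<le> q ^ k" for k using q2 by simp
  from dir[OF this] have "\<forall>k. \<exists>x. x \<in> M - {0} \<and> \<bar>x$1\<bar> \<le> K / real (q ^ k) \<and> \<bar>x$2\<bar> \<le> K * real (q ^ k)"
    by blast
  from choice[OF this] obtain l
    where l: "\<And>k. l k \<in> M - {0}" "\<And>k. \<bar>l k$1\<bar> \<le> K / real (q ^ k)" "\<And>k. \<bar>l k$2\<bar> \<le> K * real (q ^ k)"
    by blast
  have qp: "0 < real q ^ k" for k using q2 by simp
  have low: "C / K * real q ^ k \<le> \<bar>l k$2\<bar>" for k
  proof -
    have "C \<le> \<bar>l k$1\<bar> * \<bar>l k$2\<bar>" using adm_nth[of "l k" 1 2] l(1)[of k] by auto
    also have "\<dots> \<le> K / real q ^ k * \<bar>l k$2\<bar>" using l(2)[of k] by (intro mult_right_mono) auto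
    finally show ?thesis using K qp[of k] by (simp add: field_simps)
  qed
  have step: "\<bar>l k$2\<bar> < \<bar>l (Suc k)$2\<bar>" for k
  proof -
    have "K * real q ^ k < C / K * (real q * real q ^ k)"
    proof -
      have "K < C / K * real q" using qK K C_pos by (simp add: field_simps power2_eq_square)
      then have "K * real q ^ k < (C / K * real q) * real q ^ k" using qp[of k] by (intro mult_strict_right_mono) auto
      then show ?thesis by simp
    qed
    then show ?thesis using l(3)[of k] low[of "Suc k"] by simp
  qed
  have inj: "inj l"
  proof (rule injI)
    fix k k' assume eq: "l k = l k'"
    have "strict_mono (\<lambda>k. \<bar>l k$2\<bar>)" using step by (simp add: strict_mono_Suc_iff)
    from strict_mono_eq[OF this, of k k'] show "k = k'" using eq by simp
  qed
  have w: "1 / K ^ 4 \<le> weight (l k)" for k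
  proof -
    have "\<bar>l k$1\<bar> * \<bar>l k$2\<bar> \<le> (K / real q ^ k) * (K * real q ^ k)"
      using l(2,3)[of k] K by (intro mult_mono) auto
    then have "\<bar>l k$1\<bar> * \<bar>l k$2\<bar> \<le> K\<^sup>2" using q2 by (simp add: power2_eq_square)
    then have "(\<bar>l k$1\<bar> * \<bar>l k$2\<bar>)\<^sup>2 \<le> (K\<^sup>2)\<^sup>2" by (intro power_mono) auto
    moreover have "0 < \<bar>l k$1\<bar> * \<bar>l k$2\<bar>"
      using nth_pos[of "l k"] l(1)[of k] by (intro mult_pos_pos) auto
    ultimately have "1 / (K\<^sup>2)\<^sup>2 \<le> 1 / (\<bar>l k$1\<bar> * \<bar>l k$2\<bar>)\<^sup>2"
      using K by (intro divide_left_mono mult_pos_pos) auto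
    then show ?thesis by (simp add: weight_def power_mult_distrib flip: power_mult)
  qed
  \<comment> \<open>The factor 2 is spent on \<open>ln (t / (2 * K))\<close>, which keeps at least
    half of \<open>ln t\<close> for large \<open>t\<close>.\<close>
  define c where "c = 1 / (2 * K ^ 4 * ln (real q))"
  have c: "0 < c" using K q2 by (simp add: c_def)
  have "\<forall>\<^sub>F t in at_top. 2 * ln (2 * K) \<le> ln (t :: real)"
    using ln_at_top unfolding filterlim_at_top by blast
  then have "\<forall>\<^sub>F t in at_top. c * ln t \<le> V M t"
    using eventually_gt_at_top[of "2 * K"]
  proof eventually_elim
    fix t assume t: "2 * ln (2 * K) \<le> ln t" "2 * K < t"
    define n where "n = nat \<lfloor>log (real q) (t / (2 * K))\<rfloor>"
    have t1: "1 < t / (2 * K)" using t K by simp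
    then have l0: "0 \<le> log (real q) (t / (2 * K))" using q2 by simp
    then have n: "real n \<le> log (real q) (t / (2 * K))" "log (real q) (t / (2 * K)) \<le> real n + 1"
      unfolding n_def by linarith+
    have "real q powr real n \<le> t / (2 * K)" using n(1) t1 q2 by (subst (asm) le_log_iff) auto
    then have qn: "2 * K * real q ^ n \<le> t" using q2 K by (simp add: powr_realpow field_simps)
    have "1 / K ^ 4 * (real n + 1) \<le> (\<Sum>k\<in>{0..n}. weight (l k))"
      using sum_mono[of "{0..n}" "\<lambda>k. 1 / K ^ 4" "\<lambda>k. weight (l k)"] w by (simp add: add.commute)
    also have "\<dots> = sum weight (l ` {0..n})"
      using inj by (subst sum.reindex) (auto intro: inj_on_subset)
    also have "\<dots> \<le> V M t"
      unfolding V_eq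
    proof (intro sum_mono2 finite_ball weight_nonneg subsetI)
      fix x assume "x \<in> l ` {0..n}"
      then obtain k where k: "k \<le> n" "x = l k" by auto
      have "norm x \<le> \<bar>x$1\<bar> + \<bar>x$2\<bar>" by (rule norm_le_nth) simp
      also have "\<dots> \<le> K / real q ^ k + K * real q ^ k" using l(2,3)[of k] k by simp
      also have "\<dots> \<le> K * real q ^ k + K * real q ^ k"
      proof -
        have "1 \<le> real q ^ k" using q2 by simp
        moreover from this have "1 / real q ^ k \<le> 1" by (subst divide_le_eq_1) auto
        ultimately have "1 / real q ^ k \<le> real q ^ k" by linarith
        then have "K * (1 / real q ^ k) \<le> K * real q ^ k" using K by (intro mult_left_mono) auto
        then show ?thesis by simp
      qed
      also have "\<dots> = 2 * K * real q ^ k" by simp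
      also have "\<dots> \<le> 2 * K * real q ^ n"
        using k q2 K by (intro mult_left_mono power_increasing) auto
      also have "\<dots> \<le> t" by (rule qn)
      finally show "x \<in> {l \<in> M - {0}. norm l \<le> t}" using l(1)[of k] k by auto
    qed
    finally have 1: "1 / K ^ 4 * (real n + 1) \<le> V M t" .
    have "ln t / 2 \<le> ln (t / (2 * K))" using t K by (simp add: ln_div)
    then have "ln t / 2 / ln (real q) \<le> real n + 1"
      using n(2) q2 by (auto simp: log_def intro: order_trans[OF divide_right_mono])
    then have "1 / K ^ 4 * (ln t / 2 / ln (real q)) \<le> 1 / K ^ 4 * (real n + 1)"
      using K by (intro mult_left_mono) auto
    also have "1 / K ^ 4 * (ln t / 2 / ln (real q)) = c * ln t" by (simp add: c_def)
    finally show "c * ln t \<le> V M t" using 1 by simp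
  qed
  then show ?thesis using c by blast
qed

end

section \<open>Unfolding the torus\<close>

definition pair_vec :: "real \<times> real \<Rightarrow> real^2" where
  "pair_vec p = fst p *\<^sub>R axis 1 1 + snd p *\<^sub>R axis 2 1"

lemma pair_vec_nth [simp]: "pair_vec p $ 1 = fst p" "pair_vec p $ 2 = snd p"
  by (simp_all add: pair_vec_def axis_def)

lemma pair_vec_measurable [measurable]: "pair_vec \<in> borel_measurable borel"
  unfolding pair_vec_def by (intro borel_measurable_continuous_onI continuous_intros)

lemma Basis_vec2: "(Basis :: (real^2) set) = {axis 1 1, axis 2 1}"
  by (auto simp: Basis_vec_def exhaust_2 UNIV_2)

lemma lborel_pair_vec: "distr (lborel \<Otimes>\<^sub>M lborel) borel pair_vec = lborel"
proof (rule lborel_eqI[symmetric])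
  fix l r :: "real^2" assume le: "\<And>b. b \<in> Basis \<Longrightarrow> l \<bullet> b \<le> r \<bullet> b"
  have le': "l$1 \<le> r$1" "l$2 \<le> r$2"
    using le[of "axis 1 1"] le[of "axis 2 1"] by (auto simp: Basis_vec2 inner_axis)
  have "pair_vec -` box l r = {l$1<..<r$1} \<times> {l$2<..<r$2}"
    by (auto simp: mem_box_cart forall_2)
  then have "emeasure (distr (lborel \<Otimes>\<^sub>M lborel) borel pair_vec) (box l r) =
      emeasure (lborel \<Otimes>\<^sub>M lborel) ({l$1<..<r$1} \<times> {l$2<..<r$2})"
    by (subst emeasure_distr) (simp_all add: space_pair_measure lborel_prod)
  also have "\<dots> = emeasure lborel {l$1<..<r$1} * emeasure lborel {l$2<..<r$2}"
    by (rule lborel.emeasure_pair_measure_Times) auto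
  also have "\<dots> = ennreal ((r$1 - l$1) * (r$2 - l$2))"
    using le' by (simp add: ennreal_mult)
  also have "(r$1 - l$1) * (r$2 - l$2) = (\<Prod>b\<in>Basis. (r - l) \<bullet> b)"
    by (simp add: Basis_vec2 inner_axis axis_eq_axis)
  finally show "emeasure (distr (lborel \<Otimes>\<^sub>M lborel) borel pair_vec) (box l r) =
      ennreal (\<Prod>b\<in>Basis. (r - l) \<bullet> b)" .
qed simp

lemma nn_integral_vec2_product:
  assumes [measurable]: "f \<in> borel_measurable borel" "g \<in> borel_measurable borel"
  shows "(\<integral>\<^sup>+x. f (x$1) * g (x$2) \<partial>(lborel :: (real^2) measure)) = (\<integral>\<^sup>+x. f x \<partial>lborel) * (\<integral>\<^sup>+x. g x \<partial>lborel)"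
proof -
  have "(\<integral>\<^sup>+x. f (x$1) * g (x$2) \<partial>(lborel :: (real^2) measure)) =
      (\<integral>\<^sup>+p. f (fst p) * g (snd p) \<partial>(lborel \<Otimes>\<^sub>M lborel))"
    by (subst lborel_pair_vec[symmetric], subst nn_integral_distr) (auto simp: lborel_prod)
  also have "\<dots> = (\<integral>\<^sup>+x. \<integral>\<^sup>+y. f x * g y \<partial>lborel \<partial>lborel)"
    by (subst lborel.nn_integral_fst[symmetric]) auto
  also have "\<dots> = (\<integral>\<^sup>+x. f x \<partial>lborel) * (\<integral>\<^sup>+x. g x \<partial>lborel)"
    by (simp add: nn_integral_cmult nn_integral_multc)
  finally show ?thesis .
qed

lemma integral_vec2_product:
  fixes f g :: "real \<Rightarrow> real"
  assumes f: "integrable lborel f" and g: "integrable lborel g"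
  shows "integrable (lborel :: (real^2) measure) (\<lambda>x. f (x$1) * g (x$2))"
    and "(\<integral>x. f (x$1) * g (x$2) \<partial>(lborel :: (real^2) measure)) = (\<integral>x. f x \<partial>lborel) * (\<integral>x. g x \<partial>lborel)"
proof -
  have [measurable]: "f \<in> borel_measurable borel" "g \<in> borel_measurable borel"
    using f g by auto
  have int: "integrable (lborel \<Otimes>\<^sub>M lborel) (\<lambda>p. f (fst p) * g (snd p))"
    proof (rule lborel_pair.Fubini_integrable)
    show "(\<lambda>p. f (fst p) * g (snd p)) \<in> borel_measurable (lborel \<Otimes>\<^sub>M lborel)" by simp
  qed (use f g in \<open>auto simp: abs_mult\<close>)
  show "integrable (lborel :: (real^2) measure) (\<lambda>x. f (x$1) * g (x$2))"
    by (subst lborel_pair_vec[symmetric], subst integrable_distr_eq) (use int in \<open>auto simp: lborel_prod\<close>)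
  have "(\<integral>x. f (x$1) * g (x$2) \<partial>(lborel :: (real^2) measure)) =
      (\<integral>p. f (fst p) * g (snd p) \<partial>(lborel \<Otimes>\<^sub>M lborel))"
    by (subst lborel_pair_vec[symmetric], subst integral_distr) (auto simp: lborel_prod)
  also have "\<dots> = (\<integral>x. \<integral>y. f x * g y \<partial>lborel \<partial>lborel)"
    using lborel_pair.integral_fst'[OF int] by simp
  also have "\<dots> = (\<integral>x. f x \<partial>lborel) * (\<integral>x. g x \<partial>lborel)" by simp
  finally show "(\<integral>x. f (x$1) * g (x$2) \<partial>(lborel :: (real^2) measure)) = (\<integral>x. f x \<partial>lborel) * (\<integral>x. g x \<partial>lborel)" .
qed

section \<open>Lattice bases, dual bases and the dual lattice\<close>

locale plane_lattice =
  fixes L :: "(real^2) set" and u v :: "real^2" and d :: real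
  assumes L_eq: "L = {of_int m *\<^sub>R u + of_int n *\<^sub>R v | m n. True}"
    and d_eq: "d = u$1 * v$2 - u$2 * v$1" and d_nonzero: "d \<noteq> 0"
begin

text \<open>\<open>p\<close> and \<open>q\<close> are the rows of the inverse of the matrix with
  columns \<open>u\<close> and \<open>v\<close>. They form the dual basis, and
  \<open>x \<bullet> p\<close>, \<open>x \<bullet> q\<close> are the coordinates of \<open>x\<close>
  with respect to \<open>u\<close>, \<open>v\<close>.\<close>

definition p :: "real^2" where "p = pair_vec (v$2 / d, - v$1 / d)"
definition q :: "real^2" where "q = pair_vec (- u$2 / d, u$1 / d)"

lemma inner_2: "x \<bullet> y = x$1 * y$1 + x$2 * y$2" for x y :: "real^2"
  by (simp add: inner_vec_def sum_2)

lemma basis_expand: "(x \<bullet> p) *\<^sub>R u + (x \<bullet> q) *\<^sub>R v = x"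
proof -
  have "(x \<bullet> p) * u$i + (x \<bullet> q) * v$i = x$i" if "i = 1 \<or> i = 2" for i :: 2
    using d_nonzero that unfolding p_def q_def inner_2 by (auto simp: field_simps) (auto simp: d_eq algebra_simps)
  then show ?thesis by (simp add: vec_eq_iff forall_2)
qed

lemma dual_expand: "(x \<bullet> u) *\<^sub>R p + (x \<bullet> v) *\<^sub>R q = x"
proof -
  have "(x \<bullet> u) * p$i + (x \<bullet> v) * q$i = x$i" if "i = 1 \<or> i = 2" for i :: 2
    using d_nonzero that unfolding p_def q_def inner_2 by (auto simp: field_simps) (auto simp: d_eq algebra_simps)
  then show ?thesis by (simp add: vec_eq_iff forall_2)
qed

lemma dual_basis [simp]: "u \<bullet> p = 1" "u \<bullet> q = 0" "v \<bullet> p = 0" "v \<bullet> q = 1"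
  using d_nonzero by (auto simp: p_def q_def inner_2 field_simps) (auto simp: d_eq)

lemma mem_L_iff: "x \<in> L \<longleftrightarrow> x \<bullet> p \<in> \<int> \<and> x \<bullet> q \<in> \<int>"
proof
  assume "x \<in> L"
  then show "x \<bullet> p \<in> \<int> \<and> x \<bullet> q \<in> \<int>" unfolding L_eq by (auto simp: inner_left_distrib)
next
  assume "x \<bullet> p \<in> \<int> \<and> x \<bullet> q \<in> \<int>"
  then obtain m n where "x \<bullet> p = of_int m" "x \<bullet> q = of_int n" by (auto elim!: Ints_cases)
  then have "x = of_int m *\<^sub>R u + of_int n *\<^sub>R v" using basis_expand[of x] by simp
  then show "x \<in> L" unfolding L_eq by blast
qed

lemma L_closed [simp]: "0 \<in> L" "x \<in> L \<Longrightarrow> - x \<in> L" "x \<in> L \<Longrightarrow> y \<in> L \<Longrightarrow> x + y \<in> L" "x \<in> L \<Longrightarrow> y \<in> L \<Longrightarrow> x - y \<in> L"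
  by (auto simp: mem_L_iff inner_left_distrib inner_diff_left)

lemma planar: "planar_lattice L"
proof -
  have ne: "u \<noteq> v" using dual_basis by (metis zero_neq_one)
  have "independent {u, v}"
  proof (rule independent_if_scalars_zero)
    fix f x assume s: "(\<Sum>x\<in>{u, v}. f x *\<^sub>R x) = 0" and x: "x \<in> {u, v}"
    then have "f u *\<^sub>R u + f v *\<^sub>R v = 0" using ne by simp
    from arg_cong[OF this, of "\<lambda>x. x \<bullet> p"] arg_cong[OF this, of "\<lambda>x. x \<bullet> q"]
    show "f x = 0" using x by (auto simp: inner_left_distrib)
  qed simp
  then show ?thesis using ne L_eq unfolding planar_lattice_def by blast
qed

lemma countable_L: "countable L"
  by (rule planar_lattice_props(1)[OF planar])

lemma mem_dual_iff: "x \<in> dual_lattice L \<longleftrightarrow> u \<bullet> x \<in> \<int> \<and> v \<bullet> x \<in> \<int>"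
proof
  assume x: "x \<in> dual_lattice L"
  have "u \<in> L" "v \<in> L" by (auto simp: mem_L_iff)
  with x show "u \<bullet> x \<in> \<int> \<and> v \<bullet> x \<in> \<int>" unfolding dual_lattice_def by auto
next
  assume "u \<bullet> x \<in> \<int> \<and> v \<bullet> x \<in> \<int>"
  then show "x \<in> dual_lattice L"
    unfolding dual_lattice_def L_eq by (auto simp: inner_left_distrib)
qed

lemma dual_eq: "dual_lattice L = {of_int m *\<^sub>R p + of_int n *\<^sub>R q | m n. True}"
proof (intro set_eqI iffI)
  fix x assume "x \<in> dual_lattice L"
  then obtain m n where "u \<bullet> x = of_int m" "v \<bullet> x = of_int n"
    unfolding mem_dual_iff by (auto elim!: Ints_cases)
  then have "x = of_int m *\<^sub>R p + of_int n *\<^sub>R q" using dual_expand[of x] by (simp add: inner_commute)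
  then show "x \<in> {of_int m *\<^sub>R p + of_int n *\<^sub>R q | m n. True}" by blast
next
  fix x assume "x \<in> {of_int m *\<^sub>R p + of_int n *\<^sub>R q | m n. True}"
  then show "x \<in> dual_lattice L" unfolding mem_dual_iff by (auto simp: inner_right_distrib)
qed

lemma dual_independent:
  assumes "of_int m *\<^sub>R p + of_int n *\<^sub>R q = 0"
  shows "m = 0 \<and> n = (0::int)"
  using arg_cong[OF assms, of "\<lambda>x. u \<bullet> x"] arg_cong[OF assms, of "\<lambda>x. v \<bullet> x"]
  by (simp add: inner_right_distrib)

lemma basis_independent:
  assumes "of_int m *\<^sub>R u + of_int n *\<^sub>R v = 0"
  shows "m = 0 \<and> n = (0::int)"
  using arg_cong[OF assms, of "\<lambda>x. x \<bullet> p"] arg_cong[OF assms, of "\<lambda>x. x \<bullet> q"]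
  by (simp add: inner_left_distrib)

lemma dual_closed [simp]: "0 \<in> dual_lattice L" "x \<in> dual_lattice L \<Longrightarrow> - x \<in> dual_lattice L"
    "x \<in> dual_lattice L \<Longrightarrow> y \<in> dual_lattice L \<Longrightarrow> x + y \<in> dual_lattice L"
    "x \<in> dual_lattice L \<Longrightarrow> y \<in> dual_lattice L \<Longrightarrow> x - y \<in> dual_lattice L"
    "p \<in> dual_lattice L" "q \<in> dual_lattice L"
  by (auto simp: mem_dual_iff inner_right_distrib inner_diff_right)

text \<open>In the plane, dual vectors are quarter turns of lattice vectors divided by the
  determinant. This swaps the coordinates up to sign, so admissibility passes to the dual with the
  constant \<open>C / d\<^sup>2\<close>.\<close>

lemma dual_rotation:
  assumes "x \<in> dual_lattice L"
  shows "\<exists>l\<in>L. x$1 = l$2 / d \<and> x$2 = - l$1 / d"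
proof -
  obtain m n where x: "x = of_int m *\<^sub>R p + of_int n *\<^sub>R q" using assms unfolding dual_eq by blast
  have "of_int (- n) *\<^sub>R u + of_int m *\<^sub>R v \<in> L" unfolding L_eq by blast
  moreover have "x$1 = (of_int (- n) *\<^sub>R u + of_int m *\<^sub>R v)$2 / d" "x$2 = - (of_int (- n) *\<^sub>R u + of_int m *\<^sub>R v)$1 / d"
    unfolding x p_def q_def by (simp_all add: field_simps add_divide_distrib diff_divide_distrib)
  ultimately show ?thesis by blast
qed

lemma dual_admissible:
  assumes C: "0 < C" and adm: "\<And>l. l \<in> L \<Longrightarrow> l \<noteq> 0 \<Longrightarrow> C \<le> \<bar>l$1 * l$2\<bar>"
    and x: "x \<in> dual_lattice L" "x \<noteq> 0"
  shows "C / d\<^sup>2 \<le> \<bar>x$1 * x$2\<bar>"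
proof -
  obtain l where l: "l \<in> L" "x$1 = l$2 / d" "x$2 = - l$1 / d" using dual_rotation[OF x(1)] by blast
  have "l \<noteq> 0" using x(2) l(2,3) by (auto simp: vec_eq_iff forall_2)
  then have "C / d\<^sup>2 \<le> \<bar>l$1 * l$2\<bar> / d\<^sup>2" using adm[OF l(1)] by (intro divide_right_mono) auto
  also have "\<dots> = \<bar>x$1 * x$2\<bar>" using l(2,3) by (simp add: abs_mult power2_eq_square)
  finally show ?thesis .
qed

section \<open>The fundamental cell and unfolding\<close>

text \<open>Centred rather than based at a corner: the origin becomes an interior point, and the
  coordinates stay within \<open>1/2\<close> in absolute value, where the squared cosine of
  \<open>pi\<close> times the coordinate decreases away from 0.\<close>

definition cell :: "(real^2) set" where
  "cell = {x. -1/2 \<le> x \<bullet> p \<and> x \<bullet> p < 1/2 \<and> -1/2 \<le> x \<bullet> q \<and> x \<bullet> q < 1/2}"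

lemma cell_sets [measurable]: "cell \<in> sets borel"
  unfolding cell_def by measurable

lemma fundamental_domain_cell: "fundamental_domain L cell"
  unfolding fundamental_domain_def
proof (intro conjI cell_sets allI)
  fix x
  let ?l = "of_int \<lfloor>x \<bullet> p + 1/2\<rfloor> *\<^sub>R u + of_int \<lfloor>x \<bullet> q + 1/2\<rfloor> *\<^sub>R v"
  show "\<exists>!l. l \<in> L \<and> x - l \<in> cell"
  proof (rule ex1I[of _ ?l])
    have "x \<bullet> p - of_int \<lfloor>x \<bullet> p + 1/2\<rfloor> < 1/2" "- 1/2 \<le> x \<bullet> p - of_int \<lfloor>x \<bullet> p + 1/2\<rfloor>"
      "x \<bullet> q - of_int \<lfloor>x \<bullet> q + 1/2\<rfloor> < 1/2" "- 1/2 \<le> x \<bullet> q - of_int \<lfloor>x \<bullet> q + 1/2\<rfloor>" by linarith+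
    then show "?l \<in> L \<and> x - ?l \<in> cell"
      unfolding cell_def by (auto simp: inner_diff_left inner_left_distrib mem_L_iff)
    fix l assume l: "l \<in> L \<and> x - l \<in> cell"
    then obtain m n where mn: "l = of_int m *\<^sub>R u + of_int n *\<^sub>R v" unfolding L_eq by blast
    have "-1/2 \<le> x \<bullet> p - m" "x \<bullet> p - m < 1/2" "-1/2 \<le> x \<bullet> q - n" "x \<bullet> q - n < 1/2"
      using l unfolding cell_def mn by (auto simp: inner_diff_left inner_left_distrib)
    then have "\<lfloor>x \<bullet> p + 1/2\<rfloor> = m" "\<lfloor>x \<bullet> q + 1/2\<rfloor> = n" by linarith+
    with mn show "l = ?l" by simp
  qed
qed

lemma covol_cell: "covol L = measure lborel cell"
  by (rule covol_eq[OF planar fundamental_domain_cell])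

definition radius :: real where "radius = norm u + norm v"

lemma cell_norm: "x \<in> cell \<Longrightarrow> norm x \<le> radius"
proof -
  assume x: "x \<in> cell"
  have "norm x = norm ((x \<bullet> p) *\<^sub>R u + (x \<bullet> q) *\<^sub>R v)" by (simp add: basis_expand)
  also have "\<dots> \<le> \<bar>x \<bullet> p\<bar> * norm u + \<bar>x \<bullet> q\<bar> * norm v" by (rule order_trans[OF norm_triangle_ineq]) simp
  also have "\<dots> \<le> 1 * norm u + 1 * norm v"
    using x by (intro add_mono mult_right_mono) (auto simp: cell_def)
  finally show ?thesis by (simp add: radius_def)
qed

lemma cell_subset: "cell \<subseteq> cball 0 radius"
  using cell_norm by auto

lemma emeasure_cell_finite: "emeasure lborel cell < \<infinity>"
  using emeasure_bounded_finite[OF bounded_subset[OF bounded_cball cell_subset]] .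

lemma set_integrable_cell:
  fixes f :: "real^2 \<Rightarrow> real"
  assumes "continuous_on UNIV f"
  shows "set_integrable lborel cell f"
proof (rule set_integrable_subset)
  show "set_integrable lborel (cball 0 radius) f"
    unfolding set_integrable_def
    by (rule borel_integrable_compact) (auto intro: continuous_on_subset[OF assms])
qed (use cell_subset in auto)

lemma emeasure_cell: "emeasure lborel cell = covol L"
  using emeasure_cell_finite by (simp add: covol_cell emeasure_eq_ennreal_measure)

text \<open>The translates of the cell tile the plane. Tonelli's theorem moves each lattice
  translation from the argument of \<open>f\<close> to the indicator of the cell, and these
  indicators add up to 1.\<close>

lemma nn_integral_unfold:
  assumes f [measurable]: "f \<in> borel_measurable borel"
  shows "(\<integral>\<^sup>+x\<in>cell. (\<integral>\<^sup>+l. f (x + l) \<partial>count_space L) \<partial>lborel) = (\<integral>\<^sup>+x. f x \<partial>lborel)"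
proof -
  have one: "(\<integral>\<^sup>+l. indicator cell (x - l) \<partial>count_space L) = 1" for x :: "real^2"
  proof -
    have ex: "\<exists>!l. l \<in> L \<and> x - l \<in> cell"
      using fundamental_domain_cell unfolding fundamental_domain_def by blast
    then obtain l0 where l0: "l0 \<in> L" "x - l0 \<in> cell" by blast
    have "l \<in> L \<Longrightarrow> x - l \<in> cell \<longleftrightarrow> l = l0" for l
      using ex l0 by blast
    then have "(\<integral>\<^sup>+l. indicator cell (x - l) \<partial>count_space L) = (\<integral>\<^sup>+l. indicator {l0} l \<partial>count_space L)"
      by (intro nn_integral_cong) (simp add: indicator_def)
    also have "\<dots> = 1" using l0(1) by simp
    finally show ?thesis .
  qed
  have "(\<integral>\<^sup>+x\<in>cell. (\<integral>\<^sup>+l. f (x + l) \<partial>count_space L) \<partial>lborel) =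
      (\<integral>\<^sup>+x. (\<integral>\<^sup>+l. f (x + l) * indicator cell x \<partial>count_space L) \<partial>lborel)"
    by (intro nn_integral_cong) (simp add: nn_integral_multc)
  also have "\<dots> = (\<integral>\<^sup>+l. (\<integral>\<^sup>+x. f (x + l) * indicator cell x \<partial>lborel) \<partial>count_space L)"
    by (rule nn_integral_count_space_nn_integral[OF countable_L]) measurable
  also have "\<dots> = (\<integral>\<^sup>+l. (\<integral>\<^sup>+x. f x * indicator cell (x - l) \<partial>lborel) \<partial>count_space L)"
  proof (rule nn_integral_cong)
    fix l :: "real^2"
    have "(\<integral>\<^sup>+x. f x * indicator cell (x - l) \<partial>lborel) =
          (\<integral>\<^sup>+x. f x * indicator cell (x - l) \<partial>distr lborel borel ((+) l))"
      by (simp add: lborel_distr_plus)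
    also have "\<dots> = (\<integral>\<^sup>+x. f (l + x) * indicator cell (l + x - l) \<partial>lborel)"
      by (rule nn_integral_distr) measurable
    finally show "(\<integral>\<^sup>+x. f (x + l) * indicator cell x \<partial>lborel) = (\<integral>\<^sup>+x. f x * indicator cell (x - l) \<partial>lborel)"
      by (simp add: add.commute)
  qed
  also have "\<dots> = (\<integral>\<^sup>+x. (\<integral>\<^sup>+l. f x * indicator cell (x - l) \<partial>count_space L) \<partial>lborel)"
    by (rule nn_integral_count_space_nn_integral[OF countable_L, symmetric]) measurable
  also have "\<dots> = (\<integral>\<^sup>+x. f x \<partial>lborel)" by (simp add: nn_integral_cmult one)
  finally show ?thesis .
qed

text \<open>Unfolding the constant 1: over a null cell the left side would be 0, while the plane has
  infinite measure.\<close>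

lemma covol_pos: "0 < covol L"
proof (rule ccontr)
  assume "\<not> 0 < covol L"
  then have "emeasure lborel cell = 0" by (simp add: emeasure_cell ennreal_neg)
  then have "AE x in lborel. x \<notin> cell" by (intro AE_not_in) (auto simp: null_sets_def)
  then have "(\<integral>\<^sup>+x\<in>cell. (\<integral>\<^sup>+l. 1 \<partial>count_space L) \<partial>lborel) = 0"
    by (subst nn_integral_0_iff_AE) (auto simp: indicator_def)
  then show False using nn_integral_unfold[of "\<lambda>_. 1"] by simp
qed

end

section \<open>Poisson summation at the origin\<close>

context plane_lattice
begin

section \<open>Cosine characters and their orthogonality\<close>

text \<open>Cosines serve instead of complex exponentials because only values at the origin are to
  be recovered, and the odd part of a function vanishes there.\<close>

definition chr :: "real^2 \<Rightarrow> real^2 \<Rightarrow> real" where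
  "chr m x = cos (2 * pi * (m \<bullet> x))"

lemma continuous_chr [continuous_intros]: "continuous_on A (chr m)"
  unfolding chr_def by (intro continuous_intros)

lemma chr_abs_le [simp]: "\<bar>chr m x\<bar> \<le> 1"
  by (simp add: chr_def)

lemma chr_measurable [measurable]: "chr m \<in> borel_measurable borel"
  by (intro borel_measurable_continuous_onI continuous_chr)

lemma chr_mult: "chr m x * chr n x = (chr (m - n) x + chr (m + n) x) / 2"
  unfolding chr_def cos_times_cos by (simp add: inner_diff_left inner_left_distrib algebra_simps)

lemma chr_periodic:
  assumes "m \<in> dual_lattice L" "l \<in> L"
  shows "chr m (x + l) = chr m x"
proof -
  have "l \<bullet> m \<in> \<int>" using assms unfolding dual_lattice_def by blast
  then obtain k where k: "m \<bullet> l = of_int k" by (auto simp: inner_commute elim!: Ints_cases)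
  have "chr m (x + l) = cos (2 * pi * (m \<bullet> x) + 2 * pi * of_int k)"
    by (simp add: chr_def inner_right_distrib k distrib_left)
  also have "\<dots> = chr m x"
    using cos_add[of "2 * pi * (m \<bullet> x)" "2 * pi * of_int k"] cos_int_2pin[of k] sin_int_2pin[of k]
    by (simp add: chr_def)
  finally show ?thesis .
qed

lemma set_integral_cell_const: "(LINT x:cell|lborel. c) = covol L * (c :: real)"
  using emeasure_cell_finite by (simp add: set_lebesgue_integral_def covol_cell)

lemma chr_zero [simp]: "chr 0 x = 1"
  by (simp add: chr_def)

text \<open>Translating by half a period of the character changes the sign of its integral.\<close>

lemma integral_chr:
  assumes m: "m \<in> dual_lattice L" "m \<noteq> 0"
  shows "(LINT x:cell|lborel. chr m x) = 0"
proof -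
  define y where "y = (1 / (2 * (m \<bullet> m))) *\<^sub>R m"
  have y: "m \<bullet> y = 1/2" using m by (simp add: y_def)
  have shift: "chr m (x + y) = - chr m x" for x
    using cos_add[of "2 * pi * (m \<bullet> x)" pi] by (simp add: chr_def inner_right_distrib distrib_left y)
  define F where "F = {x. x - y \<in> cell}"
  have [measurable]: "F \<in> sets borel" unfolding F_def by measurable
  have F: "fundamental_domain L F"
    unfolding fundamental_domain_def
  proof (intro conjI allI)
    fix x
    have "\<exists>!l. l \<in> L \<and> (x - y) - l \<in> cell"
      using fundamental_domain_cell unfolding fundamental_domain_def by blast
    then show "\<exists>!l. l \<in> L \<and> x - l \<in> F" unfolding F_def by (simp add: algebra_simps)
  qed simp
  have "(LINT x:cell|lborel. chr m x) = covol L * torus_mean L (chr m)"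
    using torus_mean_eq[OF planar fundamental_domain_cell, of "chr m"] chr_periodic[OF m(1)] covol_pos by simp
  also have "\<dots> = (LINT x:F|lborel. chr m x)"
    using torus_mean_eq[OF planar F, of "chr m"] chr_periodic[OF m(1)] covol_pos by simp
  also have "\<dots> = (\<integral>x. indicator F x *\<^sub>R chr m x \<partial>distr lborel borel ((+) y))"
    by (simp add: lborel_distr_plus set_lebesgue_integral_def)
  also have "\<dots> = (\<integral>x. indicator F (y + x) *\<^sub>R chr m (y + x) \<partial>lborel)"
    by (rule integral_distr) measurable
  also have "\<dots> = - (LINT x:cell|lborel. chr m x)"
    unfolding set_lebesgue_integral_def integral_minus[symmetric]
    by (rule Bochner_Integration.integral_cong) (auto simp: F_def indicator_def add.commute[of y] shift)
  finally show ?thesis by simp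
qed

text \<open>A cosine does not distinguish \<open>m\<close> from \<open>- m\<close>, so each of them
  carries half of the covolume; for \<open>m = 0\<close> the two conditions coincide and the halves
  add up.\<close>

lemma integral_chr_mult:
  assumes m: "m \<in> dual_lattice L" and n: "n \<in> dual_lattice L"
  shows "(LINT x:cell|lborel. chr n x * chr m x) = covol L / 2 * (of_bool (n = m) + of_bool (n = - m))"
proof -
  have *: "(LINT x:cell|lborel. chr k x) = covol L * of_bool (k = 0)" if "k \<in> dual_lattice L" for k
    using integral_chr[OF that] set_integral_cell_const[of 1] by (cases "k = 0") auto
  have "(LINT x:cell|lborel. chr n x * chr m x) = ((LINT x:cell|lborel. chr (n - m) x) + (LINT x:cell|lborel. chr (n + m) x)) / 2"
    unfolding chr_mult
    by (subst set_integral_add(2)[symmetric]) (auto intro!: set_integrable_cell continuous_intros)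
  also have "\<dots> = covol L / 2 * (of_bool (n = m) + of_bool (n = - m))"
    using m n by (simp add: * distrib_left eq_neg_iff_add_eq_0)
  finally show ?thesis .
qed

section \<open>Peak kernels and uniqueness at the origin\<close>

text \<open>A trigonometric polynomial with values between 0 and 1 that attains 1 within the cell
  only at the origin. Its powers concentrate there, as in the classical uniqueness proof for Fourier
  series of continuous functions.\<close>

definition peak :: "real^2 \<Rightarrow> real" where
  "peak x = (1 + chr p x) / 2 * ((1 + chr q x) / 2)"

lemma continuous_peak [continuous_intros]: "continuous_on A peak"
  unfolding peak_def by (intro continuous_intros) auto

lemma peak_bounds: "0 \<le> peak x" "peak x \<le> 1"
proof -
  have "0 \<le> (1 + chr m x) / 2" "(1 + chr m x) / 2 \<le> 1" for m
    using chr_abs_le[of m x] by (auto simp: abs_le_iff)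
  note b = this
  show "0 \<le> peak x" unfolding peak_def by (intro mult_nonneg_nonneg b)
  show "peak x \<le> 1" unfolding peak_def by (intro mult_le_one b)
qed

lemma peak_eq: "peak x = (cos (pi * (x \<bullet> p)))\<^sup>2 * (cos (pi * (x \<bullet> q)))\<^sup>2"
proof -
  have "(1 + chr m x) / 2 = (cos (pi * (x \<bullet> m)))\<^sup>2" for m
    using cos_double_cos[of "pi * (x \<bullet> m)"] by (simp add: chr_def inner_commute mult_ac)
  then show ?thesis by (simp add: peak_def)
qed

lemma peak_zero [simp]: "peak 0 = 1"
  by (simp add: peak_def chr_def)

lemma cos_squared_le_half:
  assumes "e \<le> \<bar>s\<bar>" "\<bar>s\<bar> \<le> 1/2" "0 < e"
  shows "(cos (pi * s))\<^sup>2 \<le> (cos (pi * e))\<^sup>2"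
proof -
  have "cos (pi * \<bar>s\<bar>) \<le> cos (pi * e)"
    using assms by (intro cos_monotone_0_pi_le) auto
  moreover have "0 \<le> cos (pi * \<bar>s\<bar>)"
    using assms by (intro cos_ge_zero) (auto intro: order_trans[of _ 0])
  ultimately have "(cos (pi * \<bar>s\<bar>))\<^sup>2 \<le> (cos (pi * e))\<^sup>2" by (intro power_mono) auto
  then show ?thesis by (simp add: abs_if split: if_splits)
qed

lemma peak_away:
  assumes e: "0 < e"
  shows "\<exists>r<1. 0 \<le> r \<and> (\<forall>x\<in>cell. e \<le> norm x \<longrightarrow> peak x \<le> r)"
proof -
  \<comment> \<open>If both coordinates of \<open>x\<close> were below
    \<open>e / (radius + 1)\<close>, then \<open>norm x\<close> would be below \<open>e\<close>. The
    cap \<open>1/2\<close> keeps \<open>pi * h\<close> in the range where the cosine is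
    nonnegative.\<close>
  define h where "h = min (e / (radius + 1)) (1/2)"
  have rad: "0 \<le> radius" by (simp add: radius_def)
  have h: "0 < h" using e rad by (simp add: h_def)
  have h2: "h \<le> 1/2" unfolding h_def by (rule min.cobounded2)
  note h = h h2
  have "cos (pi * h) < cos 0"
    using h by (intro cos_monotone_0_pi) auto
  moreover have "0 \<le> cos (pi * h)" using h by (intro cos_ge_zero) (auto intro: order_trans[of _ 0])
  ultimately have r: "(cos (pi * h))\<^sup>2 < 1" using power_strict_mono[of "cos (pi * h)" 1 2] by simp
  have c1: "(cos z)\<^sup>2 \<le> 1" for z :: real by (simp add: abs_square_le_1)
  have "peak x \<le> (cos (pi * h))\<^sup>2" if x: "x \<in> cell" "e \<le> norm x" for x
  proof -
    have "h \<le> \<bar>x \<bullet> p\<bar> \<or> h \<le> \<bar>x \<bullet> q\<bar>"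
    proof (rule ccontr)
      assume "\<not> ?thesis"
      then have lt: "\<bar>x \<bullet> p\<bar> < e / (radius + 1)" "\<bar>x \<bullet> q\<bar> < e / (radius + 1)" by (auto simp: h_def)
      have "norm x = norm ((x \<bullet> p) *\<^sub>R u + (x \<bullet> q) *\<^sub>R v)" by (simp add: basis_expand)
      also have "\<dots> \<le> \<bar>x \<bullet> p\<bar> * norm u + \<bar>x \<bullet> q\<bar> * norm v" by (rule order_trans[OF norm_triangle_ineq]) simp
      also have "\<dots> \<le> e / (radius + 1) * norm u + e / (radius + 1) * norm v"
        using lt by (intro add_mono mult_right_mono) auto
      also have "\<dots> = e / (radius + 1) * radius" by (simp add: radius_def distrib_left)
      also have "\<dots> < e" using rad e by (simp add: field_simps)
      finally show False using x(2) by simp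
    qed
    then show ?thesis
    proof
      assume a: "h \<le> \<bar>x \<bullet> p\<bar>"
      have "(cos (pi * (x \<bullet> p)))\<^sup>2 \<le> (cos (pi * h))\<^sup>2"
        using a x h by (intro cos_squared_le_half) (auto simp: cell_def)
      then have "(cos (pi * (x \<bullet> p)))\<^sup>2 * (cos (pi * (x \<bullet> q)))\<^sup>2 \<le> (cos (pi * h))\<^sup>2 * 1"
        using c1 by (intro mult_mono) auto
      then show ?thesis by (simp add: peak_eq)
    next
      assume a: "h \<le> \<bar>x \<bullet> q\<bar>"
      have "(cos (pi * (x \<bullet> q)))\<^sup>2 \<le> (cos (pi * h))\<^sup>2"
        using a x h by (intro cos_squared_le_half) (auto simp: cell_def)
      then have "(cos (pi * (x \<bullet> p)))\<^sup>2 * (cos (pi * (x \<bullet> q)))\<^sup>2 \<le> 1 * (cos (pi * h))\<^sup>2"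
        using c1 by (intro mult_mono) auto
      then show ?thesis by (simp add: peak_eq)
    qed
  qed
  then show ?thesis using r by (intro exI[of _ "(cos (pi * h))\<^sup>2"]) auto
qed

lemma ball_subset_cell: "\<exists>e>0. ball 0 e \<subseteq> cell"
proof -
  define s where "s = norm p + norm q + 1"
  have s: "0 < s" by (simp add: s_def add_nonneg_pos)
  define e where "e = 1 / (2 * s)"
  have e: "0 < e" using s by (simp add: e_def)
  have "x \<in> cell" if x: "norm x < e" for x
  proof -
    have "\<bar>x \<bullet> m\<bar> < 1/2" if m: "norm m \<le> norm p + norm q" for m
    proof -
      have "\<bar>x \<bullet> m\<bar> \<le> norm x * norm m" by (rule Cauchy_Schwarz_ineq2)
      also have "\<dots> \<le> norm x * s" using m by (intro mult_left_mono) (auto simp: s_def)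
      also have "\<dots> < e * s" using x s by (intro mult_strict_right_mono)
      also have "\<dots> = 1/2" using s by (simp add: e_def)
      finally show ?thesis .
    qed
    from this[of p] this[of q] show ?thesis by (auto simp: cell_def abs_less_iff)
  qed
  then show ?thesis using e by (intro exI[of _ e]) auto
qed

text \<open>Suppose \<open>\<Phi>\<close> is positive at the origin. It is positive within distance
  \<open>e\<close>, and on a small ball \<open>B\<close> the kernel is at least \<open>s\<close>,
  which gives a contribution of order \<open>s ^ N\<close>; beyond distance \<open>e\<close> the
  kernel is at most \<open>r < s\<close>, and the loss is \<open>O(r ^ N)\<close>. In between the
  integrand is nonnegative. For large \<open>N\<close> the integral cannot vanish.\<close>

lemma nonpos_at_zero_if_orthogonal_to_peaks:
  fixes \<Phi> :: "real^2 \<Rightarrow> real"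
  assumes cont: "continuous_on UNIV \<Phi>"
    and orth: "\<And>N. (LINT x:cell|lborel. \<Phi> x * peak x ^ N) = 0"
  shows "\<Phi> 0 \<le> 0"
proof (rule ccontr)
  assume "\<not> \<Phi> 0 \<le> 0"
  then have pos: "0 < \<Phi> 0" by simp
  obtain e0 where e0: "0 < e0" "ball 0 e0 \<subseteq> cell" using ball_subset_cell by blast
  have "isCont \<Phi> 0" using cont by (simp add: continuous_on_eq_continuous_at)
  then obtain e1 where e1: "0 < e1" "\<And>x. norm x < e1 \<Longrightarrow> \<bar>\<Phi> x - \<Phi> 0\<bar> < \<Phi> 0 / 2"
    using pos unfolding continuous_at_eps_delta by (metis dist_norm diff_zero dist_real_def half_gt_zero)
  define e where "e = min e0 e1"
  have e: "0 < e" using e0 e1 by (simp add: e_def)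
  obtain r where r: "r < 1" "0 \<le> r" "\<And>x. x \<in> cell \<Longrightarrow> e \<le> norm x \<Longrightarrow> peak x \<le> r"
    using peak_away[OF e] by blast
  define s where "s = (1 + r) / 2"
  have s: "r < s" "s < 1" "0 < s" using r by (auto simp: s_def)
  have "isCont peak 0" using continuous_peak[of UNIV] by (simp add: continuous_on_eq_continuous_at)
  then obtain e2 where e2: "0 < e2" "\<And>x. norm x < e2 \<Longrightarrow> \<bar>peak x - 1\<bar> < 1 - s"
    using s unfolding continuous_at_eps_delta by (metis dist_norm diff_zero dist_real_def peak_zero diff_gt_0_iff_gt)
  define B where "B = ball (0 :: real^2) (min e e2)"
  have Bm [measurable]: "B \<in> sets borel" by (simp add: B_def)
  have B: "B \<subseteq> cell" "B \<subseteq> ball 0 e" "B \<subseteq> ball 0 e2" using e0 by (auto simp: B_def e_def)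
  have Bpos: "0 < measure lborel B" using e e2 by (simp add: B_def content_ball_pos)
  have Bfin: "emeasure lborel B < \<infinity>" unfolding B_def by (rule emeasure_bounded_finite) simp
  obtain K where K: "0 < K" "\<And>x. x \<in> cell \<Longrightarrow> \<bar>\<Phi> x\<bar> \<le> K"
  proof -
    have "bounded (\<Phi> ` cball 0 radius)"
      by (intro compact_imp_bounded compact_continuous_image continuous_on_subset[OF cont]) auto
    then obtain K where "0 < K" "\<And>x. x \<in> cball 0 radius \<Longrightarrow> norm (\<Phi> x) \<le> K" unfolding bounded_pos by blast
    with that[of K] cell_norm show ?thesis by auto
  qed
  have int_B: "set_integrable lborel cell (indicator B :: _ \<Rightarrow> real)"
    unfolding set_integrable_def
    by (rule Bochner_Integration.integrable_cong[THEN iffD1, OF refl _ integrable_real_indicator[OF _ Bfin]])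
       (use B in \<open>auto simp: indicator_def\<close>)
  have lint_B: "(LINT x:cell|lborel. (indicator B x :: real)) = measure lborel B"
  proof -
    have "(LINT x:cell|lborel. (indicator B x :: real)) = (\<integral>x. indicator B x \<partial>lborel)"
      unfolding set_lebesgue_integral_def
      by (rule Bochner_Integration.integral_cong) (use B in \<open>auto simp: indicator_def\<close>)
    then show ?thesis using Bfin by simp
  qed
  have key: "\<Phi> 0 / 2 * measure lborel B * s ^ N \<le> K * covol L * r ^ N" for N
  proof -
    have "0 = (LINT x:cell|lborel. \<Phi> x * peak x ^ N)" using orth[of N] by simp
    also have "\<dots> \<ge> (LINT x:cell|lborel. \<Phi> 0 / 2 * s ^ N * indicator B x - K * r ^ N)"
    proof (rule set_integral_mono)
      show "set_integrable lborel cell (\<lambda>x. \<Phi> 0 / 2 * s ^ N * indicator B x - K * r ^ N)"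
        by (intro set_integral_diff set_integrable_mult_right impI int_B) (intro set_integrable_cell continuous_intros)
      show "set_integrable lborel cell (\<lambda>x. \<Phi> x * peak x ^ N)"
        by (intro set_integrable_cell continuous_intros cont)
      fix x assume x: "x \<in> cell"
      show "\<Phi> 0 / 2 * s ^ N * indicator B x - K * r ^ N \<le> \<Phi> x * peak x ^ N"
      proof (cases "norm x < e")
        case True
        then have px: "\<Phi> 0 / 2 \<le> \<Phi> x" using e1(2)[of x] by (auto simp: e_def abs_if split: if_splits)
        have "\<Phi> 0 / 2 * s ^ N * indicator B x \<le> \<Phi> x * peak x ^ N"
        proof (cases "x \<in> B")
          case xB: True
          then have "s \<le> peak x" using e2(2)[of x] B(3) by (auto simp: abs_if split: if_splits)
          then have "s ^ N \<le> peak x ^ N" using s by (intro power_mono) auto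
          then have "\<Phi> 0 / 2 * s ^ N \<le> \<Phi> x * peak x ^ N"
            using px pos s by (intro mult_mono) auto
          then show ?thesis using xB by simp
        next
          case False
          then show ?thesis using px pos peak_bounds[of x] by simp
        qed
        then show ?thesis using K r by (simp add: add_increasing2 diff_le_eq)
      next
        case False
        then have "x \<notin> B" using B(2) by auto
        have "peak x ^ N \<le> r ^ N" using r(3)[OF x] False peak_bounds[of x] by (intro power_mono) auto
        then have "\<bar>\<Phi> x\<bar> * peak x ^ N \<le> K * r ^ N"
          using K(2)[OF x] K(1) peak_bounds[of x] by (intro mult_mono) auto
        moreover have "- (\<bar>\<Phi> x\<bar> * peak x ^ N) \<le> \<Phi> x * peak x ^ N"
          unfolding minus_mult_left using peak_bounds[of x] by (intro mult_right_mono) auto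
        ultimately show ?thesis using \<open>x \<notin> B\<close> by simp
      qed
    qed
    moreover have "(LINT x:cell|lborel. \<Phi> 0 / 2 * s ^ N * indicator B x - K * r ^ N) =
        \<Phi> 0 / 2 * s ^ N * measure lborel B - K * r ^ N * covol L"
      using int_B by (subst set_integral_diff(2))
        (auto simp: lint_B set_integral_cell_const intro!: set_integrable_mult_right set_integrable_cell continuous_intros)
    ultimately show ?thesis by (simp add: mult_ac)
  qed
  have "(\<lambda>N. K * covol L * (r / s) ^ N) \<longlonglongrightarrow> K * covol L * 0"
    using r s by (intro tendsto_mult tendsto_const LIMSEQ_power_zero) auto
  then have "\<Phi> 0 / 2 * measure lborel B \<le> K * covol L * 0"
  proof (rule LIMSEQ_le_const, intro exI[of _ 0] allI impI)
    fix N
    show "\<Phi> 0 / 2 * measure lborel B \<le> K * covol L * (r / s) ^ N"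
      using key[of N] s by (simp add: power_divide field_simps)
  qed
  then show False using pos Bpos by (simp add: mult_le_0_iff)
qed

text \<open>Orthogonality to all cosines survives multiplication by a cosine, by the product
  formula, and so by both factors of the kernel. The induction on \<open>N\<close> therefore carries
  all \<open>m\<close> at once. The one-sided statement is then applied to \<open>\<Phi>\<close> and
  to its negative.\<close>

lemma zero_if_orthogonal_to_characters:
  fixes \<Phi> :: "real^2 \<Rightarrow> real"
  assumes cont: "continuous_on UNIV \<Phi>"
    and orth: "\<And>m. m \<in> dual_lattice L \<Longrightarrow> (LINT x:cell|lborel. \<Phi> x * chr m x) = 0"
  shows "\<Phi> 0 = 0"
proof -
  have *: "\<forall>m\<in>dual_lattice L. (LINT x:cell|lborel. \<Phi> x * (\<phi> x * chr n x) * chr m x) = 0"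
    if n: "n \<in> dual_lattice L" and c: "continuous_on UNIV \<phi>"
      and \<phi>: "\<forall>m\<in>dual_lattice L. (LINT x:cell|lborel. \<Phi> x * \<phi> x * chr m x) = 0" for \<phi> n
  proof
    fix m assume m: "m \<in> dual_lattice L"
    have "\<Phi> x * (\<phi> x * chr n x) * chr m x = 1/2 * (\<Phi> x * \<phi> x * chr (n - m) x) + 1/2 * (\<Phi> x * \<phi> x * chr (n + m) x)" for x
      using chr_mult[of n x m] by (simp add: algebra_simps add_divide_distrib)
    then have "(LINT x:cell|lborel. \<Phi> x * (\<phi> x * chr n x) * chr m x) =
        1/2 * (LINT x:cell|lborel. \<Phi> x * \<phi> x * chr (n - m) x) + 1/2 * (LINT x:cell|lborel. \<Phi> x * \<phi> x * chr (n + m) x)"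
      by (simp only:) (subst set_integral_add(2), auto intro!: set_integrable_mult_right set_integrable_cell continuous_intros cont c)
    then show "(LINT x:cell|lborel. \<Phi> x * (\<phi> x * chr n x) * chr m x) = 0"
      using \<phi> n m by simp
  qed
  have half: "\<forall>m\<in>dual_lattice L. (LINT x:cell|lborel. \<Phi> x * (\<phi> x * ((1 + chr n x) / 2)) * chr m x) = 0"
    if n: "n \<in> dual_lattice L" and c: "continuous_on UNIV \<phi>"
      and \<phi>: "\<forall>m\<in>dual_lattice L. (LINT x:cell|lborel. \<Phi> x * \<phi> x * chr m x) = 0" for \<phi> n
  proof
    fix m assume m: "m \<in> dual_lattice L"
    have "\<Phi> x * (\<phi> x * ((1 + chr n x) / 2)) * chr m x = 1/2 * (\<Phi> x * \<phi> x * chr m x) + 1/2 * (\<Phi> x * (\<phi> x * chr n x) * chr m x)" for x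
      by (simp add: algebra_simps add_divide_distrib)
    then have "(LINT x:cell|lborel. \<Phi> x * (\<phi> x * ((1 + chr n x) / 2)) * chr m x) =
        1/2 * (LINT x:cell|lborel. \<Phi> x * \<phi> x * chr m x) + 1/2 * (LINT x:cell|lborel. \<Phi> x * (\<phi> x * chr n x) * chr m x)"
      by (simp only:) (subst set_integral_add(2), auto intro!: set_integrable_mult_right set_integrable_cell continuous_intros cont c)
    then show "(LINT x:cell|lborel. \<Phi> x * (\<phi> x * ((1 + chr n x) / 2)) * chr m x) = 0"
      using \<phi> *[OF n c \<phi>] m by simp
  qed
  have all: "\<forall>m\<in>dual_lattice L. (LINT x:cell|lborel. \<Phi> x * peak x ^ N * chr m x) = 0" for N
  proof (induction N)
    case (Suc N)
    have c1: "continuous_on UNIV (\<lambda>x. peak x ^ N)" by (intro continuous_intros)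
    have c2: "continuous_on UNIV (\<lambda>x. peak x ^ N * ((1 + chr p x) / 2))" by (intro continuous_intros) auto
    have eq: "peak x ^ Suc N = peak x ^ N * ((1 + chr p x) / 2) * ((1 + chr q x) / 2)" for x
      by (simp add: peak_def mult_ac)
    then show ?case using half[OF dual_closed(6) c2 half[OF dual_closed(5) c1 Suc]] by (simp only: eq)
  qed (use orth in simp)
  have peaks: "(LINT x:cell|lborel. \<Phi> x * peak x ^ N) = 0" for N
    using bspec[OF all[of N], of 0] by simp
  have "\<Phi> 0 \<le> 0" by (rule nonpos_at_zero_if_orthogonal_to_peaks[OF cont peaks])
  moreover have "- \<Phi> 0 \<le> 0"
  proof (rule nonpos_at_zero_if_orthogonal_to_peaks[of "\<lambda>x. - \<Phi> x"])
    show "(LINT x:cell|lborel. - \<Phi> x * peak x ^ N) = 0" for N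
      using peaks[of N] by (simp add: set_lebesgue_integral_def)
  qed (intro continuous_intros cont)
  ultimately show ?thesis by simp
qed

section \<open>Periodisation and Poisson summation\<close>

lemma finite_L_bounded: "finite {l\<in>L. norm l \<le> r}"
proof -
  define k where "k = \<lceil>\<bar>r\<bar> * (norm p + norm q)\<rceil>"
  have "{l\<in>L. norm l \<le> r} \<subseteq> (\<lambda>(m, n). of_int m *\<^sub>R u + of_int n *\<^sub>R v) ` ({-k..k} \<times> {-k..k})"
  proof
    fix l assume l: "l \<in> {l\<in>L. norm l \<le> r}"
    then obtain m n where mn: "l = of_int m *\<^sub>R u + of_int n *\<^sub>R v" unfolding L_eq by blast
    have *: "\<bar>l \<bullet> w\<bar> \<le> \<bar>r\<bar> * (norm p + norm q)" if "norm w \<le> norm p + norm q" for w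
    proof -
      have "\<bar>l \<bullet> w\<bar> \<le> norm l * norm w" by (rule Cauchy_Schwarz_ineq2)
      also have "\<dots> \<le> \<bar>r\<bar> * (norm p + norm q)" using l that by (intro mult_mono) auto
      finally show ?thesis .
    qed
    have "\<bar>real_of_int m\<bar> \<le> \<bar>r\<bar> * (norm p + norm q)" "\<bar>real_of_int n\<bar> \<le> \<bar>r\<bar> * (norm p + norm q)"
      using *[of p] *[of q] by (auto simp: mn inner_left_distrib)
    then have "\<bar>m\<bar> \<le> k" "\<bar>n\<bar> \<le> k" unfolding k_def by linarith+
    then show "l \<in> (\<lambda>(m, n). of_int m *\<^sub>R u + of_int n *\<^sub>R v) ` ({-k..k} \<times> {-k..k})"
      unfolding mn by (intro image_eqI[of _ _ "(m, n)"]) auto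
  qed
  then show ?thesis by (rule finite_subset) simp
qed

lemma integrable_compact_support:
  fixes f :: "real^2 \<Rightarrow> real"
  assumes cont: "continuous_on UNIV f" and supp: "\<And>x. \<rho> < norm x \<Longrightarrow> f x = 0"
  shows "integrable lborel f"
proof -
  have "integrable lborel (\<lambda>x. indicator (cball 0 \<rho>) x *\<^sub>R f x)"
    by (rule borel_integrable_compact) (auto intro: continuous_on_subset[OF cont])
  also have "(\<lambda>x. indicator (cball 0 \<rho>) x *\<^sub>R f x) = f"
    using supp by (auto simp: indicator_def fun_eq_iff not_le)
  finally show ?thesis .
qed

text \<open>\<open>\<Lambda>\<close> contains every lattice vector that can carry a point of the
  cell into the support, so over the cell the sum over all of \<open>L\<close> reduces to a finite
  one.\<close>

lemma integral_unfold:
  fixes f :: "real^2 \<Rightarrow> real"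
  assumes cont: "continuous_on UNIV f" and nonneg: "\<And>x. 0 \<le> f x" and supp: "\<And>x. \<rho> < norm x \<Longrightarrow> f x = 0"
  defines "\<Lambda> \<equiv> {l\<in>L. norm l \<le> \<rho> + radius}"
  shows "(LINT x:cell|lborel. \<Sum>l\<in>\<Lambda>. f (x + l)) = (\<integral>x. f x \<partial>lborel)"
proof -
  have fin: "finite \<Lambda>" unfolding \<Lambda>_def by (rule finite_L_bounded)
  have [measurable]: "f \<in> borel_measurable borel" by (rule borel_measurable_continuous_onI[OF cont])
  have int: "set_integrable lborel cell (\<lambda>x. \<Sum>l\<in>\<Lambda>. f (x + l))"
    by (intro set_integrable_cell continuous_intros continuous_on_compose2[OF cont]) auto
  have "ennreal (\<integral>x. f x \<partial>lborel) = (\<integral>\<^sup>+x. f x \<partial>lborel)"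
    using nonneg by (intro nn_integral_eq_integral[symmetric] integrable_compact_support[OF cont supp]) auto
  also have "\<dots> = (\<integral>\<^sup>+x\<in>cell. (\<integral>\<^sup>+l. ennreal (f (x + l)) \<partial>count_space L) \<partial>lborel)"
    by (subst nn_integral_unfold) auto
  also have "\<dots> = (\<integral>\<^sup>+x. ennreal (indicator cell x *\<^sub>R (\<Sum>l\<in>\<Lambda>. f (x + l))) \<partial>lborel)"
  proof (rule nn_integral_cong)
    fix x :: "real^2"
    show "(\<integral>\<^sup>+l. ennreal (f (x + l)) \<partial>count_space L) * indicator cell x = ennreal (indicator cell x *\<^sub>R (\<Sum>l\<in>\<Lambda>. f (x + l)))"
    proof (cases "x \<in> cell")
      case True
      have "(\<integral>\<^sup>+l. ennreal (f (x + l)) \<partial>count_space L) = (\<Sum>l\<in>\<Lambda>. ennreal (f (x + l)))"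
      proof (rule nn_integral_count_space'[OF fin])
        fix l assume l: "l \<in> L" "l \<notin> \<Lambda>"
        have "norm l \<le> norm (x + l) + norm x" using norm_triangle_ineq4[of "x + l" x] by simp
        then have "\<rho> < norm (x + l)" using l cell_norm[OF True] by (auto simp: \<Lambda>_def)
        then show "ennreal (f (x + l)) = 0" using supp by simp
      qed (auto simp: \<Lambda>_def)
      then show ?thesis using True nonneg by simp
    qed simp
  qed
  also have "\<dots> = ennreal (LINT x:cell|lborel. \<Sum>l\<in>\<Lambda>. f (x + l))"
    unfolding set_lebesgue_integral_def
    using int nonneg unfolding set_integrable_def
    by (intro nn_integral_eq_integral) (auto intro!: sum_nonneg AE_I2 mult_nonneg_nonneg)
  finally have "ennreal (\<integral>x. f x \<partial>lborel) = ennreal (LINT x:cell|lborel. \<Sum>l\<in>\<Lambda>. f (x + l))" .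
  moreover have "0 \<le> (LINT x:cell|lborel. \<Sum>l\<in>\<Lambda>. f (x + l))"
    unfolding set_lebesgue_integral_def using nonneg
    by (intro Bochner_Integration.integral_nonneg) (auto intro!: sum_nonneg mult_nonneg_nonneg)
  ultimately show ?thesis using nonneg by (simp add: integral_nonneg)
qed

text \<open>The periodisation \<open>P\<close>, multiplied by the covolume, and the uniformly
  convergent cosine series \<open>S\<close> are continuous and have the same cosine coefficients;
  hence they agree at the origin.\<close>

lemma poisson_summation_at_zero:
  fixes g :: "real^2 \<Rightarrow> real"
  assumes cont: "continuous_on UNIV g" and nonneg: "\<And>x. 0 \<le> g x" and supp: "\<And>x. \<rho> < norm x \<Longrightarrow> g x = 0"
  defines "G \<equiv> \<lambda>m. \<integral>x. g x * chr m x \<partial>lborel"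
  assumes summ: "(\<lambda>m. \<bar>G m\<bar>) summable_on dual_lattice L"
  shows "covol L * (\<Sum>l | l \<in> L \<and> norm l \<le> \<rho>. g l) = (\<Sum>\<^sub>\<infinity>m\<in>dual_lattice L. G m)"
proof -
  define \<Lambda> where "\<Lambda> = {l\<in>L. norm l \<le> \<rho> + radius}"
  have fin: "finite \<Lambda>" unfolding \<Lambda>_def by (rule finite_L_bounded)
  \<comment> \<open>On the cell this finite sum equals the full periodisation. Elsewhere it need not
    be periodic, but only its values on the cell enter the coefficients.\<close>
  define P where "P x = (\<Sum>l\<in>\<Lambda>. g (x + l))" for x
  have P_cont: "continuous_on UNIV P"
    unfolding P_def by (intro continuous_intros continuous_on_compose2[OF cont]) auto
  define S where "S x = (\<Sum>\<^sub>\<infinity>m\<in>dual_lattice L. G m * chr m x)" for x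
  have unif: "uniform_limit UNIV (\<lambda>A x. \<Sum>m\<in>A. G m * chr m x) S (finite_subsets_at_top (dual_lattice L))"
    unfolding S_def
  proof (rule Weierstrass_m_test_general[OF _ summ])
    show "norm (G m * chr m x) \<le> \<bar>G m\<bar>" for m x by (simp add: abs_mult mult_left_le)
  qed
  have S_cont: "continuous_on UNIV S"
    by (rule uniform_limit_theorem[OF _ unif])
       (auto intro!: always_eventually continuous_intros simp: finite_subsets_at_top_neq_bot)
  have G_minus: "G (- m) = G m" for m by (simp add: G_def chr_def)
  have P_coeff: "(LINT x:cell|lborel. P x * chr m x) = G m" if m: "m \<in> dual_lattice L" for m
  proof -
    \<comment> \<open>Adding 1 to the cosine makes the function nonnegative, so that unfolding
      applies to it; the contribution of \<open>g\<close> is then subtracted.\<close>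
    define f where "f x = g x * (1 + chr m x)" for x
    have f_cont: "continuous_on UNIV f" unfolding f_def by (intro continuous_intros cont)
    have f_nonneg: "0 \<le> f x" for x
      unfolding f_def using nonneg chr_abs_le[of m x] by (intro mult_nonneg_nonneg) (auto simp: abs_le_iff)
    have f_supp: "\<rho> < norm x \<Longrightarrow> f x = 0" for x unfolding f_def using supp by simp
    have "P x * chr m x = (\<Sum>l\<in>\<Lambda>. f (x + l)) - (\<Sum>l\<in>\<Lambda>. g (x + l))" for x
    proof -
      have "(\<Sum>l\<in>\<Lambda>. f (x + l)) = (\<Sum>l\<in>\<Lambda>. g (x + l) * (1 + chr m x))"
        unfolding f_def using chr_periodic[OF m] by (intro sum.cong) (auto simp: \<Lambda>_def)
      also have "\<dots> = P x * (1 + chr m x)" by (simp only: P_def sum_distrib_right)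
      finally show ?thesis by (simp add: P_def algebra_simps)
    qed
    then have "(LINT x:cell|lborel. P x * chr m x) =
        (LINT x:cell|lborel. \<Sum>l\<in>\<Lambda>. f (x + l)) - (LINT x:cell|lborel. \<Sum>l\<in>\<Lambda>. g (x + l))"
      by (simp only:) (rule set_integral_diff(2); intro set_integrable_cell continuous_intros
          continuous_on_compose2[OF cont] continuous_on_compose2[OF f_cont]; auto)
    also have "\<dots> = (\<integral>x. f x \<partial>lborel) - (\<integral>x. g x \<partial>lborel)"
      unfolding \<Lambda>_def by (simp add: integral_unfold[OF f_cont f_nonneg f_supp] integral_unfold[OF cont nonneg supp])
    also have "\<dots> = (\<integral>x. f x - g x \<partial>lborel)"
      using integrable_compact_support[OF f_cont f_supp] integrable_compact_support[OF cont supp]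
      by simp
    also have "\<dots> = G m" unfolding G_def f_def by (simp add: algebra_simps)
    finally show ?thesis .
  qed
  have S_coeff: "(LINT x:cell|lborel. S x * chr m x) = covol L * G m" if m: "m \<in> dual_lattice L" for m
  proof -
    have "\<bar>(LINT x:cell|lborel. S x * chr m x) - covol L * G m\<bar> \<le> 0 + e" if e: "0 < e" for e
    proof -
      have e': "0 < e / covol L" using e covol_pos by simp
      have "\<forall>\<^sub>F A in finite_subsets_at_top (dual_lattice L). \<forall>x. dist (\<Sum>m\<in>A. G m * chr m x) (S x) < e / covol L"
        using uniform_limitD[OF unif e'] by simp
      from this[unfolded eventually_finite_subsets_at_top]
      obtain A0 where A0: "finite A0" "A0 \<subseteq> dual_lattice L"
          "\<forall>A. finite A \<and> A0 \<subseteq> A \<and> A \<subseteq> dual_lattice L \<longrightarrow> (\<forall>x. dist (\<Sum>m\<in>A. G m * chr m x) (S x) < e / covol L)"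
        by (elim exE conjE)
      \<comment> \<open>Both signs of \<open>m\<close> are put into the partial sum, since each
        yields only half of the coefficient.\<close>
      define A where "A = A0 \<union> {m, - m}"
      have A: "finite A" "A0 \<subseteq> A" "A \<subseteq> dual_lattice L" "m \<in> A" "- m \<in> A"
        using A0 m by (auto simp: A_def)
      define SA where "SA x = (\<Sum>n\<in>A. G n * chr n x)" for x
      have SA_cont: "continuous_on UNIV SA" unfolding SA_def by (intro continuous_intros)
      have "(LINT x:cell|lborel. SA x * chr m x) = (LINT x:cell|lborel. \<Sum>n\<in>A. G n * (chr n x * chr m x))"
        unfolding SA_def sum_distrib_right by (simp add: mult.assoc)
      also have "\<dots> = (\<Sum>n\<in>A. G n * (LINT x:cell|lborel. chr n x * chr m x))"
      proof -
        have "set_integrable lborel cell (\<lambda>x. G n * (chr n x * chr m x))" for n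
          by (intro set_integrable_cell continuous_intros)
        then show ?thesis
          unfolding set_lebesgue_integral_def set_integrable_def scaleR_sum_right
          by (subst Bochner_Integration.integral_sum) (auto simp: mult.left_commute)
      qed
      also have "\<dots> = (\<Sum>n\<in>A. (if n = m then covol L / 2 * G n else 0) + (if n = - m then covol L / 2 * G n else 0))"
        using A(3) m by (intro sum.cong refl) (subst integral_chr_mult, auto simp: algebra_simps G_minus)
      also have "\<dots> = covol L * G m"
        using A by (simp add: sum.distrib sum.delta G_minus)
      finally have SA_coeff: "(LINT x:cell|lborel. SA x * chr m x) = covol L * G m" .
      have "\<bar>(LINT x:cell|lborel. S x * chr m x) - covol L * G m\<bar> = \<bar>(LINT x:cell|lborel. S x * chr m x - SA x * chr m x)\<bar>"
        unfolding SA_coeff[symmetric]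
        by (subst set_integral_diff(2)) (auto intro!: set_integrable_cell continuous_intros S_cont SA_cont)
      also have "\<dots> \<le> (LINT x:cell|lborel. \<bar>S x * chr m x - SA x * chr m x\<bar>)"
        unfolding set_lebesgue_integral_def
        by (rule order_trans[OF integral_abs_bound]) (simp add: abs_mult)
      also have "\<dots> \<le> (LINT x:cell|lborel. e / covol L)"
      proof (rule set_integral_mono)
        show "\<bar>S x * chr m x - SA x * chr m x\<bar> \<le> e / covol L" for x
        proof -
          have "\<bar>S x * chr m x - SA x * chr m x\<bar> = \<bar>S x - SA x\<bar> * \<bar>chr m x\<bar>"
            by (simp add: left_diff_distrib[symmetric] abs_mult)
          also have "\<dots> \<le> \<bar>S x - SA x\<bar>" by (simp add: mult_left_le)
          also have "\<dots> \<le> e / covol L"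
            using A0(3)[rule_format, of A] A(1-3) unfolding SA_def by (auto simp: dist_real_def abs_minus_commute intro: less_imp_le)
          finally show ?thesis .
        qed
      qed (intro set_integrable_cell continuous_intros S_cont SA_cont)+
      also have "\<dots> = e" using covol_pos by (simp add: set_integral_cell_const)
      finally show ?thesis by simp
    qed
    from field_le_epsilon[OF this] show ?thesis by simp
  qed
  have "covol L * P 0 - S 0 = 0"
  proof (rule zero_if_orthogonal_to_characters)
    show "continuous_on UNIV (\<lambda>x. covol L * P x - S x)" by (intro continuous_intros P_cont S_cont)
    fix m assume m: "m \<in> dual_lattice L"
    have "(LINT x:cell|lborel. (covol L * P x - S x) * chr m x) =
        (LINT x:cell|lborel. covol L * (P x * chr m x) - S x * chr m x)"
      by (simp add: algebra_simps)
    also have "\<dots> = covol L * (LINT x:cell|lborel. P x * chr m x) - (LINT x:cell|lborel. S x * chr m x)"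
      by (subst set_integral_diff(2)) (auto intro!: set_integrable_cell continuous_intros S_cont P_cont)
    also have "\<dots> = 0" using P_coeff[OF m] S_coeff[OF m] by simp
    finally show "(LINT x:cell|lborel. (covol L * P x - S x) * chr m x) = 0" .
  qed
  moreover have "P 0 = (\<Sum>l | l \<in> L \<and> norm l \<le> \<rho>. g l)"
    unfolding P_def using fin supp
    by (intro sum.mono_neutral_cong_right) (auto simp: \<Lambda>_def radius_def add_increasing2 not_le)
  moreover have "S 0 = (\<Sum>\<^sub>\<infinity>m\<in>dual_lattice L. G m)" by (simp add: S_def chr_def)
  ultimately show ?thesis by simp
qed

end

section \<open>The variance as a sum over the dual lattice\<close>

definition tent :: "real \<Rightarrow> real \<Rightarrow> real" where
  "tent A s = max 0 (2 * A - \<bar>s\<bar>)"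

lemma tent_nonneg [simp]: "0 \<le> tent A s"
  by (simp add: tent_def)

lemma continuous_tent: "continuous_on S (tent A)"
  unfolding tent_def by (intro continuous_intros)

lemma tent_measurable [measurable]: "tent A \<in> borel_measurable borel"
  by (intro borel_measurable_continuous_onI continuous_tent)

lemma tent_support: "tent A s \<noteq> 0 \<Longrightarrow> - (2 * A) \<le> s \<and> s \<le> 2 * A"
  by (auto simp: tent_def max_def split: if_splits)

lemma tent_eq_0: "2 * A \<le> \<bar>s\<bar> \<Longrightarrow> tent A s = 0"
  by (simp add: tent_def)

lemma nn_integral_overlap:
  "(\<integral>\<^sup>+y. indicator {-A..A} y * indicator {-A..A} (y + s) \<partial>lborel) = ennreal (tent A s)"
proof -
  have "(\<integral>\<^sup>+y. indicator {-A..A} y * indicator {-A..A} (y + s) \<partial>lborel) =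
      (\<integral>\<^sup>+y. indicator {max (-A) (-A-s)..min A (A-s)} y \<partial>lborel)"
    by (intro nn_integral_cong) (auto simp: indicator_def)
  also have "\<dots> = emeasure lborel {max (-A) (-A-s)..min A (A-s)}" by simp
  also have "\<dots> = ennreal (tent A s)"
    unfolding emeasure_lborel_Icc_eq tent_def by (auto simp: max_def min_def abs_if intro!: arg_cong[of _ _ ennreal])
  finally show ?thesis .
qed

text \<open>The square of the Fourier transform of the indicator of \<open>{-A..A}\<close>, of which
  the tent is the autocorrelation. The value at \<open>m = 0\<close> is the limit of the other
  branch.\<close>

definition tent_hat :: "real \<Rightarrow> real \<Rightarrow> real" where
  "tent_hat A m = (if m = 0 then (2 * A)\<^sup>2 else (sin (2 * pi * A * m) / (pi * m))\<^sup>2)"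

lemma integrable_tent_mult:
  assumes "continuous_on UNIV f"
  shows "integrable lborel (\<lambda>s. tent A s * f s)"
proof -
  have "integrable lborel (\<lambda>s. indicator {-(2*A)..2*A} s *\<^sub>R (tent A s * f s))"
    by (rule borel_integrable_compact) (auto intro!: continuous_intros continuous_tent continuous_on_subset[OF assms])
  also have "(\<lambda>s. indicator {-(2*A)..2*A} s *\<^sub>R (tent A s * f s)) = (\<lambda>s. tent A s * f s)"
    using tent_support[of A] by (auto simp: indicator_def fun_eq_iff)
  finally show ?thesis .
qed

lemma integral_tent_sin: "(\<integral>s. tent A s * sin (w * s) \<partial>lborel) = 0"
proof -
  have "(\<integral>s. tent A s * sin (w * s) \<partial>lborel) = (\<integral>s. tent A (- s) * sin (w * - s) \<partial>lborel)"
    by (subst lborel_integral_real_affine[of "-1" _ 0]) auto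
  also have "\<dots> = - (\<integral>s. tent A s * sin (w * s) \<partial>lborel)" by (simp add: tent_def)
  finally show ?thesis by simp
qed

lemma integral_tent_cos:
  assumes A: "0 \<le> A"
  shows "(\<integral>s. tent A s * cos (2 * pi * m * s) \<partial>lborel) = tent_hat A m"
proof -
  define w where "w = 2 * pi * m"
  define f where "f s = tent A s * cos (w * s)" for s
  have "continuous_on UNIV f" unfolding f_def by (intro continuous_intros continuous_tent)
  then have cont: "continuous_on X f" for X using continuous_on_subset by blast
  have "(\<integral>s. f s \<partial>lborel) = (LINT s:{-(2*A)..2*A}|lborel. f s)"
    unfolding set_lebesgue_integral_def f_def
    by (rule Bochner_Integration.integral_cong) (use tent_support[of A] in \<open>auto simp: indicator_def\<close>)
  also have "\<dots> = integral {-(2*A)..2*A} f"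
    by (rule set_borel_integral_eq_integral, unfold set_integrable_def, rule borel_integrable_compact) (auto intro: cont)
  also have "\<dots> = tent_hat A m"
  proof (cases "m = 0")
    case True
    have "(f has_integral ((2*A * 0 + 0\<^sup>2/2) - (2*A * (-(2*A)) + (-(2*A))\<^sup>2/2))) {-(2*A)..0}"
    proof (rule fundamental_theorem_of_calculus)
      fix s assume s: "s \<in> {-(2*A)..0}"
      show "((\<lambda>s. 2*A * s + s\<^sup>2/2) has_vector_derivative f s) (at s within {-(2*A)..0})"
        using s by (auto intro!: derivative_eq_intros simp: has_real_derivative_iff_has_vector_derivative[symmetric] f_def tent_def True w_def)
    qed (use A in simp)
    moreover have "(f has_integral ((2*A * (2*A) - (2*A)\<^sup>2/2) - (2*A * 0 - 0\<^sup>2/2))) {0..2*A}"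
    proof (rule fundamental_theorem_of_calculus)
      fix s assume s: "s \<in> {0..2*A}"
      show "((\<lambda>s. 2*A * s - s\<^sup>2/2) has_vector_derivative f s) (at s within {0..2*A})"
        using s by (auto intro!: derivative_eq_intros simp: has_real_derivative_iff_has_vector_derivative[symmetric] f_def tent_def True w_def)
    qed (use A in simp)
    ultimately have "(f has_integral (((2*A * 0 + 0\<^sup>2/2) - (2*A * (-(2*A)) + (-(2*A))\<^sup>2/2)) + ((2*A * (2*A) - (2*A)\<^sup>2/2) - (2*A * 0 - 0\<^sup>2/2)))) {-(2*A)..2*A}"
      using A by (intro has_integral_combine[of "-(2*A)" 0 "2*A"]) auto
    then show ?thesis by (simp add: integral_unique tent_hat_def True power2_eq_square algebra_simps)
  next
    case False
    then have w: "w \<noteq> 0" by (simp add: w_def)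
    \<comment> \<open>\<open>F1\<close> and \<open>F2\<close> are primitives on the two linear
      pieces of the tent, obtained by one integration by parts on each side of the kink at
      0.\<close>
    define F1 where "F1 s = (2*A + s) * sin (w * s) / w + cos (w * s) / w\<^sup>2" for s
    define F2 where "F2 s = (2*A - s) * sin (w * s) / w - cos (w * s) / w\<^sup>2" for s
    have "(f has_integral (F1 0 - F1 (-(2*A)))) {-(2*A)..0}"
    proof (rule fundamental_theorem_of_calculus)
      fix s assume s: "s \<in> {-(2*A)..0}"
      have "(F1 has_real_derivative (2*A + s) * cos (w * s)) (at s within {-(2*A)..0})"
        unfolding F1_def using w
        by (auto intro!: derivative_eq_intros simp: field_simps power2_eq_square)
      also have "(2*A + s) * cos (w * s) = f s" using s by (simp add: f_def tent_def)
      finally show "(F1 has_vector_derivative f s) (at s within {-(2*A)..0})"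
        by (simp add: has_real_derivative_iff_has_vector_derivative)
    qed (use A in simp)
    moreover have "(f has_integral (F2 (2*A) - F2 0)) {0..2*A}"
    proof (rule fundamental_theorem_of_calculus)
      fix s assume s: "s \<in> {0..2*A}"
      have "(F2 has_real_derivative (2*A - s) * cos (w * s)) (at s within {0..2*A})"
        unfolding F2_def using w
        by (auto intro!: derivative_eq_intros simp: field_simps power2_eq_square)
      also have "(2*A - s) * cos (w * s) = f s" using s by (simp add: f_def tent_def)
      finally show "(F2 has_vector_derivative f s) (at s within {0..2*A})"
        by (simp add: has_real_derivative_iff_has_vector_derivative)
    qed (use A in simp)
    ultimately have "(f has_integral ((F1 0 - F1 (-(2*A))) + (F2 (2*A) - F2 0))) {-(2*A)..2*A}"
      using A by (intro has_integral_combine[of "-(2*A)" 0 "2*A"]) auto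
    then have "integral {-(2*A)..2*A} f = 2 * (1 - cos (2 * (w * A))) / w\<^sup>2"
      by (simp add: integral_unique F1_def F2_def diff_divide_distrib mult_ac)
    also have "\<dots> = (2 * sin (w * A) / w)\<^sup>2"
      by (simp add: cos_double_sin power_divide power_mult_distrib)
    also have "2 * sin (w * A) / w = sin (2 * pi * A * m) / (pi * m)"
      by (simp add: w_def mult_ac)
    finally show ?thesis using False by (simp add: tent_hat_def)
  qed
  finally show ?thesis by (simp add: f_def w_def)
qed

lemma Rect_sets [measurable]: "Rect A B \<in> sets borel"
  unfolding Rect_def by measurable

context plane_lattice
begin

definition box_tent :: "real \<Rightarrow> real \<Rightarrow> real^2 \<Rightarrow> real" where
  "box_tent A B x = tent A (x$1) * tent B (x$2)"

lemma box_tent_nonneg: "0 \<le> box_tent A B x"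
  by (simp add: box_tent_def)

lemma continuous_box_tent: "continuous_on UNIV (box_tent A B)"
  unfolding box_tent_def
  by (intro continuous_intros continuous_on_compose2[OF continuous_tent[of UNIV]]) auto

lemma box_tent_support:
  assumes "2 * A + 2 * B < norm x" "0 \<le> A" "0 \<le> B"
  shows "box_tent A B x = 0"
proof -
  have "norm x \<le> \<bar>x$1\<bar> + \<bar>x$2\<bar>" using norm_le_l1_cart[of x] by (simp add: sum_2)
  then have "2 * A \<le> \<bar>x$1\<bar> \<or> 2 * B \<le> \<bar>x$2\<bar>" using assms by linarith
  then show ?thesis by (auto simp: box_tent_def tent_eq_0)
qed

lemma integral_box_tent_chr:
  assumes "0 \<le> A" "0 \<le> B"
  shows "(\<integral>x. box_tent A B x * chr m x \<partial>lborel) = tent_hat A (m$1) * tent_hat B (m$2)"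
proof -
  let ?c = "\<lambda>A m s. tent A s * cos (2 * pi * m * s)" and ?s = "\<lambda>A m s. tent A s * sin (2 * pi * m * s)"
  have ic: "integrable lborel (?c A m)" and si: "integrable lborel (?s A m)" for A m
    by (intro integrable_tent_mult continuous_intros)+
  have "box_tent A B x * chr m x = ?c A (m$1) (x$1) * ?c B (m$2) (x$2) - ?s A (m$1) (x$1) * ?s B (m$2) (x$2)" for x
    proof -
    have "chr m x = cos (2 * pi * m$1 * x$1 + 2 * pi * m$2 * x$2)"
      by (simp add: chr_def inner_2 distrib_left mult.assoc)
    then show ?thesis by (simp add: box_tent_def cos_add right_diff_distrib mult_ac)
  qed
  then have "(\<integral>x. box_tent A B x * chr m x \<partial>lborel) =
      (\<integral>x. ?c A (m$1) (x$1) * ?c B (m$2) (x$2) \<partial>(lborel :: (real^2) measure)) - (\<integral>x. ?s A (m$1) (x$1) * ?s B (m$2) (x$2) \<partial>(lborel :: (real^2) measure))"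
    by (simp only:) (rule Bochner_Integration.integral_diff[OF integral_vec2_product(1)[OF ic ic] integral_vec2_product(1)[OF si si]])
  also have "\<dots> = tent_hat A (m$1) * tent_hat B (m$2)"
    unfolding integral_vec2_product(2)[OF ic ic] integral_vec2_product(2)[OF si si] integral_tent_sin
      integral_tent_cos[OF assms(1)] integral_tent_cos[OF assms(2)] by simp
  finally show ?thesis .
qed

section \<open>The second moment of the lattice count\<close>

text \<open>The count as a sum in \<open>ennreal\<close>, so that Tonelli's theorem and unfolding
  apply before any finiteness is known.\<close>

definition ncount :: "(real^2) set \<Rightarrow> real^2 \<Rightarrow> ennreal" where
  "ncount S x = (\<integral>\<^sup>+l. indicator S (x + l) \<partial>count_space L)"

lemma ncount_measurable [measurable]:
  assumes [measurable]: "S \<in> sets borel"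
  shows "ncount S \<in> borel_measurable borel"
proof -
  interpret sigma_finite_measure "count_space L"
    by (rule sigma_finite_measure_count_space_countable[OF countable_L])
  have "(\<lambda>p. indicator S (fst p + snd p) :: ennreal) \<in> borel_measurable (borel \<Otimes>\<^sub>M count_space L)"
    by (rule measurable_compose_countable'[where f="\<lambda>l p. indicator S (fst p + l)" and g=snd, OF _ _ countable_L])
       measurable
  then show ?thesis unfolding ncount_def[abs_def] by (intro borel_measurable_nn_integral) (simp add: case_prod_beta')
qed

lemma ncount_periodic:
  assumes "l \<in> L"
  shows "ncount S (x + l) = ncount S x"
proof -
  have bij: "bij_betw (\<lambda>k. l + k) L L"
    using assms by (intro bij_betwI[of _ _ _ "\<lambda>k. k - l"]) auto
  show ?thesis unfolding ncount_def
    using nn_integral_bij_count_space[OF bij, of "\<lambda>k. indicator S (x + k)"] by (simp add: add.assoc)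
qed

lemma ncount_eq_card:
  assumes "\<And>x. x \<in> S \<Longrightarrow> norm x \<le> r"
  shows "ncount S x = ennreal (real (card {l\<in>L. x + l \<in> S}))" "finite {l\<in>L. x + l \<in> S}"
proof -
  have "{l\<in>L. x + l \<in> S} \<subseteq> {l\<in>L. norm l \<le> r + norm x}"
  proof
    fix l assume "l \<in> {l\<in>L. x + l \<in> S}"
    then show "l \<in> {l\<in>L. norm l \<le> r + norm x}"
      using assms[of "x + l"] norm_triangle_ineq4[of "x + l" x] by auto
  qed
  then show fin: "finite {l\<in>L. x + l \<in> S}" by (rule finite_subset[OF _ finite_L_bounded])
  have "ncount S x = (\<integral>\<^sup>+l. indicator {l\<in>L. x + l \<in> S} l \<partial>count_space L)"
    unfolding ncount_def by (intro nn_integral_cong) (auto simp: indicator_def)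
  also have "\<dots> = emeasure (count_space L) {l\<in>L. x + l \<in> S}" by simp
  also have "\<dots> = ennreal (real (card {l\<in>L. x + l \<in> S}))"
    using fin by (subst emeasure_count_space_finite) (auto simp: ennreal_of_nat_eq_real_of_nat)
  finally show "ncount S x = ennreal (real (card {l\<in>L. x + l \<in> S}))" .
qed

lemma nn_integral_ncount:
  assumes [measurable]: "S \<in> sets borel"
  shows "(\<integral>\<^sup>+x\<in>cell. ncount S x \<partial>lborel) = emeasure lborel S"
  unfolding ncount_def using nn_integral_unfold[of "indicator S"] by simp

text \<open>One factor is written as a sum over \<open>L\<close>, and the other moves under that sum
  by periodicity. Unfolding gives the integral of \<open>indicator S\<close> times
  \<open>ncount S\<close> over the plane, which expands into autocorrelations of \<open>S\<close> at
  lattice vectors.\<close>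

lemma nn_integral_ncount_square:
  assumes [measurable]: "S \<in> sets borel"
  shows "(\<integral>\<^sup>+x\<in>cell. ncount S x * ncount S x \<partial>lborel) =
    (\<integral>\<^sup>+k. (\<integral>\<^sup>+y. indicator S y * indicator S (y + k) \<partial>lborel) \<partial>count_space L)"
proof -
  define \<phi> where "\<phi> y = indicator S y * ncount S y" for y
  have [measurable]: "\<phi> \<in> borel_measurable borel" unfolding \<phi>_def by measurable
  have "ncount S x * ncount S x = (\<integral>\<^sup>+l. \<phi> (x + l) \<partial>count_space L)" for x
  proof -
    have "ncount S x * ncount S x = (\<integral>\<^sup>+l. indicator S (x + l) * ncount S x \<partial>count_space L)"
      by (subst (1) ncount_def) (simp add: nn_integral_multc)
    also have "\<dots> = (\<integral>\<^sup>+l. \<phi> (x + l) \<partial>count_space L)"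
      by (intro nn_integral_cong) (simp add: \<phi>_def ncount_periodic)
    finally show ?thesis .
  qed
  then have "(\<integral>\<^sup>+x\<in>cell. ncount S x * ncount S x \<partial>lborel) = (\<integral>\<^sup>+y. \<phi> y \<partial>lborel)"
    using nn_integral_unfold[of \<phi>] by simp
  also have "\<dots> = (\<integral>\<^sup>+y. (\<integral>\<^sup>+k. indicator S y * indicator S (y + k) \<partial>count_space L) \<partial>lborel)"
    unfolding \<phi>_def ncount_def by (simp add: nn_integral_cmult)
  also have "\<dots> = (\<integral>\<^sup>+k. (\<integral>\<^sup>+y. indicator S y * indicator S (y + k) \<partial>lborel) \<partial>count_space L)"
    by (rule nn_integral_count_space_nn_integral[OF countable_L]) measurable
  finally show ?thesis .
qed

lemma nn_integral_Rect_overlap: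
  fixes k :: "real^2"
  shows "(\<integral>\<^sup>+y. indicator (Rect A B) y * indicator (Rect A B) (y + k) \<partial>lborel) = ennreal (box_tent A B k)"
proof -
  have "(\<integral>\<^sup>+y. indicator (Rect A B) y * indicator (Rect A B) (y + k) \<partial>lborel) =
      (\<integral>\<^sup>+y. (indicator {-A..A} (y$1) * indicator {-A..A} (y$1 + k$1)) * (indicator {-B..B} (y$2) * indicator {-B..B} (y$2 + k$2)) \<partial>(lborel :: (real^2) measure))"
    by (intro nn_integral_cong) (auto simp: Rect_def indicator_def)
  also have "\<dots> = ennreal (box_tent A B k)"
    by (subst nn_integral_vec2_product) (auto simp: nn_integral_overlap box_tent_def ennreal_mult)
  finally show ?thesis .
qed

lemma emeasure_Rect: "0 \<le> A \<Longrightarrow> 0 \<le> B \<Longrightarrow> emeasure lborel (Rect A B) = ennreal (4 * A * B)"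
proof -
  assume AB: "0 \<le> A" "0 \<le> B"
  have "indicator (Rect A B) y * indicator (Rect A B) (y + 0) = (indicator (Rect A B) y :: ennreal)" for y
    by (simp add: indicator_def)
  then show ?thesis using AB nn_integral_Rect_overlap[of A B 0] by (simp add: box_tent_def tent_def mult_ac)
qed

lemma norm_Rect: "x \<in> Rect A B \<Longrightarrow> norm x \<le> A + B"
  using norm_le_l1_cart[of x] by (auto simp: Rect_def sum_2)

text \<open>The mean of the count is the area divided by the covolume, so the second moment is
  reduced by the square of the mean. The norm bound on \<open>l\<close> comes from the support of
  the autocorrelation.\<close>

lemma torus_mean_count_square:
  assumes AB: "0 \<le> A" "0 \<le> B"
  defines "N \<equiv> \<lambda>x. real (card {l\<in>L. x + l \<in> Rect A B})"
  shows "torus_mean L (\<lambda>x. (N x - 4 * A * B / covol L)\<^sup>2) =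
    (\<Sum>l | l \<in> L \<and> norm l \<le> 2 * A + 2 * B. box_tent A B l) / covol L - (4 * A * B / covol L)\<^sup>2"
proof -
  let ?S = "Rect A B"
  define c where "c = 4 * A * B / covol L"
  define \<Sigma> where "\<Sigma> = (\<Sum>l | l \<in> L \<and> norm l \<le> 2 * A + 2 * B. box_tent A B l)"
  have N: "ncount ?S x = ennreal (N x)" for x
    unfolding N_def by (rule ncount_eq_card(1)[OF norm_Rect])
  have N_eq: "N = (\<lambda>x. enn2real (ncount ?S x))" by (simp add: N fun_eq_iff N_def)
  have [measurable]: "N \<in> borel_measurable borel" unfolding N_eq by measurable
  have per: "N (x + l) = N x" if "l \<in> L" for x l
    unfolding N_eq using ncount_periodic[OF that] by simp
  have 1: "(\<integral>\<^sup>+x. ennreal (indicator cell x *\<^sub>R N x) \<partial>lborel) = ennreal (4 * A * B)"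
  proof -
    have "(\<integral>\<^sup>+x. ennreal (indicator cell x *\<^sub>R N x) \<partial>lborel) = (\<integral>\<^sup>+x\<in>cell. ncount ?S x \<partial>lborel)"
      by (intro nn_integral_cong) (simp add: N indicator_def)
    then show ?thesis using nn_integral_ncount[of ?S] emeasure_Rect[OF AB] by simp
  qed
  have 2: "(\<integral>\<^sup>+x. ennreal (indicator cell x *\<^sub>R (N x)\<^sup>2) \<partial>lborel) = ennreal \<Sigma>"
  proof -
    have "(\<integral>\<^sup>+x. ennreal (indicator cell x *\<^sub>R (N x)\<^sup>2) \<partial>lborel) = (\<integral>\<^sup>+x\<in>cell. ncount ?S x * ncount ?S x \<partial>lborel)"
      by (intro nn_integral_cong) (simp add: N indicator_def power2_eq_square ennreal_mult N_def)
    also have "\<dots> = (\<integral>\<^sup>+k. ennreal (box_tent A B k) \<partial>count_space L)"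
      by (subst nn_integral_ncount_square) (auto simp: nn_integral_Rect_overlap)
    also have "\<dots> = (\<Sum>l | l \<in> L \<and> norm l \<le> 2 * A + 2 * B. ennreal (box_tent A B l))"
      using AB by (intro nn_integral_count_space' finite_L_bounded) (auto simp: box_tent_support not_le)
    also have "\<dots> = ennreal \<Sigma>" unfolding \<Sigma>_def by (rule sum_ennreal) (rule box_tent_nonneg)
    finally show ?thesis .
  qed
  have \<Sigma>: "0 \<le> \<Sigma>" unfolding \<Sigma>_def by (intro sum_nonneg box_tent_nonneg)
  have N_nonneg: "0 \<le> N x" for x by (simp add: N_def)
  have i1: "set_integrable lborel cell N" "(LINT x:cell|lborel. N x) = 4 * A * B"
    using nn_integral_eq_integrable[of "\<lambda>x. indicator cell x *\<^sub>R N x" lborel "4 * A * B"] 1 AB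
    unfolding set_integrable_def set_lebesgue_integral_def by (auto simp: N_nonneg)
  have i2: "set_integrable lborel cell (\<lambda>x. (N x)\<^sup>2)" "(LINT x:cell|lborel. (N x)\<^sup>2) = \<Sigma>"
    using nn_integral_eq_integrable[of "\<lambda>x. indicator cell x *\<^sub>R (N x)\<^sup>2" lborel \<Sigma>] 2 \<Sigma>
    unfolding set_integrable_def set_lebesgue_integral_def by auto
  have "torus_mean L (\<lambda>x. (N x - c)\<^sup>2) = 1 / covol L * (LINT x:cell|lborel. (N x - c)\<^sup>2)"
    by (rule torus_mean_eq[OF planar fundamental_domain_cell]) (auto simp: per)
  also have "(LINT x:cell|lborel. (N x - c)\<^sup>2) = (LINT x:cell|lborel. ((N x)\<^sup>2 - 2 * c * N x) + c\<^sup>2)"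
    by (simp add: power2_diff algebra_simps)
  also have "\<dots> = (LINT x:cell|lborel. (N x)\<^sup>2 - 2 * c * N x) + (LINT x:cell|lborel. c\<^sup>2)"
    using i1 i2 by (subst set_integral_add(2))
      (auto intro!: set_integral_diff(1) set_integrable_mult_right set_integrable_cell[of "\<lambda>_. c\<^sup>2"])
  also have "(LINT x:cell|lborel. (N x)\<^sup>2 - 2 * c * N x) = \<Sigma> - 2 * c * (4 * A * B)"
    using i1 i2 by (subst set_integral_diff(2)) (auto intro!: set_integrable_mult_right)
  also have "(LINT x:cell|lborel. c\<^sup>2) = c * (4 * A * B)"
    using covol_pos by (simp add: set_integral_cell_const c_def power2_eq_square)
  also have "1 / covol L * (\<Sigma> - 2 * c * (4 * A * B) + c * (4 * A * B)) = \<Sigma> / covol L - c\<^sup>2"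
    using covol_pos by (simp add: c_def power2_eq_square field_simps)
  finally show ?thesis unfolding c_def \<Sigma>_def .
qed

text \<open>The rectangle and the lattice are both symmetric about the origin; negation exchanges
  the points of the shifted rectangle with the translates \<open>X + l\<close> that land in the
  centred one.\<close>

lemma count_Rect:
  assumes t: "0 < t"
  shows "lattice_count (dilate_shift t (Rect a b) X) L = card {l\<in>L. X + l \<in> Rect (t * a) (t * b)}"
proof -
  have Rect: "x \<in> dilate_shift t (Rect a b) X \<longleftrightarrow> X - x \<in> Rect (t * a) (t * b)" for x
  proof
    assume "x \<in> dilate_shift t (Rect a b) X"
    then obtain y where y: "y \<in> Rect a b" "x = t *\<^sub>R y + X" unfolding dilate_shift_def by auto
    then show "X - x \<in> Rect (t * a) (t * b)"
      using t mult_left_mono[of "y$1" a t] mult_left_mono[of "y$2" b t] mult_left_mono[of "-a" "y$1" t] mult_left_mono[of "-b" "y$2" t]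
      by (auto simp: Rect_def)
  next
    assume *: "X - x \<in> Rect (t * a) (t * b)"
    show "x \<in> dilate_shift t (Rect a b) X"
      unfolding dilate_shift_def
    proof (rule image_eqI)
      show "x = t *\<^sub>R ((1 / t) *\<^sub>R (x - X)) + X" using t by simp
      show "(1 / t) *\<^sub>R (x - X) \<in> Rect a b"
        using * t by (auto simp: Rect_def field_simps)
    qed
  qed
  have "bij_betw uminus {l\<in>L. X + l \<in> Rect (t * a) (t * b)} (dilate_shift t (Rect a b) X \<inter> L)"
    by (rule bij_betwI[of _ _ _ uminus]) (auto simp: Rect L_closed)
  then show ?thesis unfolding lattice_count_def by (simp add: bij_betw_same_card)
qed

text \<open>The term \<open>m = 0\<close> of the Poisson sum is the squared area and cancels the
  squared mean exactly. Of the two factors \<open>covol L\<close> in the denominator, one comes from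
  Poisson summation and one from averaging over the torus.\<close>

lemma variance_formula:
  assumes a: "0 < a" and b: "0 < b" and t: "0 < t"
    and nz: "\<And>m. m \<in> dual_lattice L - {0} \<Longrightarrow> m$1 \<noteq> 0 \<and> m$2 \<noteq> 0"
    and summ: "(\<lambda>m. 1 / ((m$1)\<^sup>2 * (m$2)\<^sup>2) * ((sin (2 * pi * a * m$1 * t))\<^sup>2 * (sin (2 * pi * b * m$2 * t))\<^sup>2)) summable_on dual_lattice L - {0}"
  shows "torus_mean L (\<lambda>X. (discrepancy t (Rect a b) X L)\<^sup>2) =
    (\<Sum>\<^sub>\<infinity>m\<in>dual_lattice L - {0}. 1 / ((m$1)\<^sup>2 * (m$2)\<^sup>2) * ((sin (2 * pi * a * m$1 * t))\<^sup>2 * (sin (2 * pi * b * m$2 * t))\<^sup>2)) / (pi ^ 4 * (covol L)\<^sup>2)"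
    (is "_ = infsum ?h _ / _")
proof -
  define A B where "A = t * a" and "B = t * b"
  have AB: "0 \<le> A" "0 \<le> B" using a b t by (auto simp: A_def B_def)
  define G where "G m = (\<integral>x. box_tent A B x * chr m x \<partial>lborel)" for m
  have G: "G m = tent_hat A (m$1) * tent_hat B (m$2)" for m
    unfolding G_def by (rule integral_box_tent_chr[OF AB])
  have G_dual: "G m = ?h m * (1 / pi ^ 4)" if "m \<in> dual_lattice L - {0}" for m
    using nz[OF that] by (simp add: G tent_hat_def A_def B_def power_divide power_mult_distrib mult_ac)
  have G0: "G 0 = (4 * A * B)\<^sup>2" by (simp add: G tent_hat_def power_mult_distrib)
  have summ': "G summable_on dual_lattice L - {0}"
    using summable_on_cmult_left[OF summ, of "1 / pi ^ 4"] by (subst summable_on_cong[OF G_dual])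
  have dual: "dual_lattice L = insert 0 (dual_lattice L - {0})" by auto
  have "G summable_on dual_lattice L" by (subst dual) (intro summable_on_insert_iff[THEN iffD2] summ')
  moreover have "\<bar>G m\<bar> = G m" for m by (simp add: G tent_hat_def)
  ultimately have "(\<lambda>m. \<bar>G m\<bar>) summable_on dual_lattice L" by simp
  then have P: "covol L * (\<Sum>l | l \<in> L \<and> norm l \<le> 2 * A + 2 * B. box_tent A B l) = (\<Sum>\<^sub>\<infinity>m\<in>dual_lattice L. G m)"
    unfolding G_def using AB
    by (intro poisson_summation_at_zero continuous_box_tent box_tent_nonneg box_tent_support)
  also have "\<dots> = (4 * A * B)\<^sup>2 + infsum G (dual_lattice L - {0})"
    by (subst dual, subst infsum_insert[OF summ']) (auto simp: G0)
  also have "infsum G (dual_lattice L - {0}) = infsum ?h (dual_lattice L - {0}) * (1 / pi ^ 4)"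
    by (subst infsum_cong[OF G_dual]) (assumption, rule infsum_cmult_left')
  finally have P: "(\<Sum>l | l \<in> L \<and> norm l \<le> 2 * A + 2 * B. box_tent A B l) =
      ((4 * A * B)\<^sup>2 + infsum ?h (dual_lattice L - {0}) * (1 / pi ^ 4)) / covol L"
    using covol_pos by (simp add: field_simps)
  have "measure lebesgue (Rect a b) = 4 * a * b"
    using emeasure_Rect[of a b] a b Rect_sets[of a b] by (simp add: measure_def)
  then have "discrepancy t (Rect a b) X L = real (card {l\<in>L. X + l \<in> Rect A B}) - 4 * A * B / covol L" for X
    unfolding discrepancy_def count_Rect[OF t] by (simp add: A_def B_def power2_eq_square)
  then have "torus_mean L (\<lambda>X. (discrepancy t (Rect a b) X L)\<^sup>2) =
      (\<Sum>l | l \<in> L \<and> norm l \<le> 2 * A + 2 * B. box_tent A B l) / covol L - (4 * A * B / covol L)\<^sup>2"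
    using torus_mean_count_square[OF AB] by simp
  also have "\<dots> = infsum ?h (dual_lattice L - {0}) / (pi ^ 4 * (covol L)\<^sup>2)"
    using covol_pos unfolding P by (simp add: power2_eq_square add_divide_distrib mult_ac)
  finally show ?thesis .
qed

end

section \<open>Random dilations\<close>

lemma tendsto_zero_iff_eventually_small:
  fixes f :: "'a \<Rightarrow> real"
  assumes nonneg: "\<And>x. 0 \<le> f x" and small: "\<And>e. 0 < e \<Longrightarrow> \<forall>\<^sub>F x in F. f x \<le> e"
  shows "(f \<longlongrightarrow> 0) F"
proof (rule tendstoI)
  fix e :: real assume "0 < e"
  then have "\<forall>\<^sub>F x in F. f x \<le> e / 2" by (intro small) simp
  then show "\<forall>\<^sub>F x in F. dist (f x) 0 < e"
    proof eventually_elim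
    case (elim x)
    then show ?case using \<open>0 < e\<close> nonneg[of x] by (simp add: dist_real_def)
  qed
qed

text \<open>Uniform absolute continuity: the part of the density above a high level has small mass, and
  below that level the law is dominated by a multiple of the uniform law.\<close>

lemma dilation_law_tendsto_zero:
  assumes rho: "prob_density_01 \<rho>" and B [measurable]: "B \<in> sets borel"
    and lim: "((\<lambda>T. measure lborel (B \<inter> {0..T}) / T) \<longlongrightarrow> 0) at_top"
  shows "((\<lambda>T. measure (dilation_law \<rho> T) B) \<longlongrightarrow> 0) at_top"
proof (rule tendsto_zero_iff_eventually_small)
  fix e :: real assume e: "0 < e"
  define g where "g x = indicator {0..1} x * \<rho> x" for x
  have [measurable]: "g \<in> borel_measurable borel"
    using rho unfolding g_def prob_density_01_def set_borel_measurable_def by simp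
  have g0: "0 \<le> g x" for x using rho by (auto simp: g_def prob_density_01_def indicator_def)
  have g1: "(\<integral>\<^sup>+x. ennreal (g x) \<partial>lborel) = 1"
  proof -
    have "(\<lambda>x. ennreal (g x)) = (\<lambda>x. ennreal (\<rho> x) * indicator {0..1} x)"
      by (simp add: fun_eq_iff g_def indicator_def)
    then show ?thesis using rho by (simp add: prob_density_01_def)
  qed
  define h where "h N x = (if real N < g x then ennreal (g x) else 0)" for N x
  have [measurable]: "h N \<in> borel_measurable borel" for N unfolding h_def by measurable
  have "(\<lambda>N. \<integral>\<^sup>+x. h N x \<partial>lborel) \<longlonglongrightarrow> (\<integral>\<^sup>+x. 0 \<partial>(lborel :: real measure))"
  proof (rule nn_integral_dominated_convergence[where w="\<lambda>x. ennreal (g x)"])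
    show "AE x in lborel. (\<lambda>N. h N x) \<longlonglongrightarrow> 0"
    proof (rule AE_I2)
      fix x
      obtain N0 where "g x \<le> real N0" using real_arch_simple by blast
      then have "\<forall>\<^sub>F N in sequentially. h N x = 0"
        unfolding h_def by (intro eventually_sequentiallyI[of N0]) (auto simp: not_less intro: order_trans)
      then show "(\<lambda>N. h N x) \<longlonglongrightarrow> 0" by (rule tendsto_eventually)
    qed
  qed (auto simp: h_def g1)
  then have "\<forall>\<^sub>F N in sequentially. (\<integral>\<^sup>+x. h N x \<partial>lborel) < ennreal (e / 2)"
    using e by (intro order_tendstoD(2)[of _ 0]) auto
  then obtain N where N: "(\<integral>\<^sup>+x. h N x \<partial>lborel) < ennreal (e / 2)"
    unfolding eventually_sequentially by blast
  have key: "measure (dilation_law \<rho> T) B \<le> real N * (measure lborel (B \<inter> {0..T}) / T) + e / 2" if T: "0 < T" for T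
  proof -
    have dens: "ennreal (indicator {0..T} t * (1 / T * \<rho> (t / T))) = ennreal (1 / T * g (t / T)) * indicator {0..T} t" for t
      using T by (auto simp: g_def indicator_def)
    
    have "emeasure (dilation_law \<rho> T) B = (\<integral>\<^sup>+t. ennreal (1 / T * g (t / T)) * indicator {0..T} t * indicator B t \<partial>lborel)"
      unfolding dilation_law_def dens by (rule emeasure_density) measurable
    also have "\<dots> \<le> (\<integral>\<^sup>+t. ennreal (real N / T) * indicator (B \<inter> {0..T}) t + ennreal (1 / T) * h N (t / T) \<partial>lborel)"
    proof (rule nn_integral_mono)
      fix t :: real
      have "ennreal (1 / T * g (t / T)) \<le> ennreal (real N / T) + ennreal (1 / T) * h N (t / T)"
      proof (cases "real N < g (t / T)")
        case True
        then show ?thesis using T g0 by (simp add: h_def ennreal_mult[symmetric] add_increasing)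
      next
        case False
        then have "1 / T * g (t / T) \<le> real N / T" using T by (simp add: divide_right_mono)
        then show ?thesis by (intro add_increasing2) (auto intro: ennreal_leI)
      qed
      then show "ennreal (1 / T * g (t / T)) * indicator {0..T} t * indicator B t \<le>
          ennreal (real N / T) * indicator (B \<inter> {0..T}) t + ennreal (1 / T) * h N (t / T)"
        by (auto simp: indicator_def)
    qed
    also have "\<dots> = ennreal (real N / T) * emeasure lborel (B \<inter> {0..T}) + ennreal (1 / T) * (\<integral>\<^sup>+t. h N (t / T) \<partial>lborel)"
      by (simp add: nn_integral_add nn_integral_cmult)
    \<comment> \<open>Rescaling identifies this with the mass of the high part of the density
      itself, which does not depend on \<open>T\<close>; one level \<open>N\<close> thus works for
      all \<open>T\<close>.\<close>
    also have "ennreal (1 / T) * (\<integral>\<^sup>+t. h N (t / T) \<partial>lborel) = (\<integral>\<^sup>+x. h N x \<partial>lborel)"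
      using T nn_integral_real_affine[of "h N" "1 / T" 0] by simp
    also have "emeasure lborel (B \<inter> {0..T}) = ennreal (measure lborel (B \<inter> {0..T}))"
    proof (rule emeasure_eq_ennreal_measure)
      have "emeasure lborel (B \<inter> {0..T}) < \<infinity>"
        by (rule emeasure_bounded_finite) (rule bounded_subset[OF bounded_closed_interval[of 0 T]], auto)
      then show "emeasure lborel (B \<inter> {0..T}) \<noteq> \<top>" by simp
    qed
    also have "ennreal (real N / T) * ennreal (measure lborel (B \<inter> {0..T})) + (\<integral>\<^sup>+x. h N x \<partial>lborel) \<le>
        ennreal (real N * (measure lborel (B \<inter> {0..T}) / T)) + ennreal (e / 2)"
      using N T by (intro add_mono) (auto simp: ennreal_mult[symmetric] mult.commute)
    also have "\<dots> = ennreal (real N * (measure lborel (B \<inter> {0..T}) / T) + e / 2)"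
      using T e by (intro ennreal_plus[symmetric]) auto
    finally show ?thesis
      unfolding measure_def[of "dilation_law \<rho> T"] using T e by (intro enn2real_leI) auto
  qed
  have "((\<lambda>T. real N * (measure lborel (B \<inter> {0..T}) / T)) \<longlongrightarrow> real N * 0) at_top"
    by (intro tendsto_mult tendsto_const lim)
  then have "\<forall>\<^sub>F T in at_top. real N * (measure lborel (B \<inter> {0..T}) / T) < e / 2"
    using e by (intro order_tendstoD(2)[of _ "real N * 0"]) auto
  then show "\<forall>\<^sub>F T in at_top. measure (dilation_law \<rho> T) B \<le> e"
    using eventually_gt_at_top[of 0]
  proof eventually_elim
    case (elim T)
    then show ?case using key[of T] by linarith
  qed
qed simp

section \<open>From convergence in probability to convergence in distribution\<close>

lemma cdf_return: "cdf (return borel c) x = (if c \<le> x then 1 else 0)"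
  by (simp add: cdf_def measure_return indicator_def)

lemma not_isCont_cdf_return: "\<not> isCont (cdf (return borel c)) c"
proof
  assume "isCont (cdf (return borel c)) c"
  then have "(cdf (return borel c) \<longlongrightarrow> cdf (return borel c) c) (at_left c)"
    unfolding isCont_def by (rule tendsto_within_subset) simp
  then have "((\<lambda>x. cdf (return borel c) x) \<longlongrightarrow> 1) (at_left c)" by (simp add: cdf_return[of c c])
  moreover have "\<forall>\<^sub>F x in at_left c. cdf (return borel c) x = 0"
    by (auto simp: cdf_return eventually_at_filter)
  then have "((\<lambda>x. cdf (return borel c) x) \<longlongrightarrow> 0) (at_left c)" by (rule tendsto_eventually)
  ultimately have "(1::real) = 0" using tendsto_unique[OF trivial_limit_at_left_real] by blast
  then show False by simp
qed

text \<open>The limiting distribution function jumps at \<open>c\<close>, so only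
  \<open>x \<noteq> c\<close> matters. With \<open>e\<close> half the distance from \<open>x\<close>
  to \<open>c\<close>, the event \<open>Z t \<le> x\<close> for \<open>x < c\<close>, or its
  complement for \<open>x > c\<close>, is contained in the deviation event.\<close>

lemma converges_in_distribution_if_in_probability:
  fixes Z :: "real \<Rightarrow> real"
  assumes rho: "prob_density_01 \<rho>" and Z [measurable]: "Z \<in> borel_measurable borel"
    and lim: "converges_in_probability (dilation_law \<rho>) Z c at_top"
  shows "converges_in_distribution (\<lambda>T. distr (dilation_law \<rho> T) borel Z) (return borel c) at_top"
  unfolding converges_in_distribution_def
proof (intro allI impI)
  fix x assume "isCont (cdf (return borel c)) x"
  then have x: "x \<noteq> c" using not_isCont_cdf_return by auto
  define e where "e = \<bar>x - c\<bar> / 2"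
  have e: "0 < e" using x by (simp add: e_def)
  let ?m = "\<lambda>T. measure (dilation_law \<rho> T) {t. e < \<bar>Z t - c\<bar>}"
  have m0: "(?m \<longlongrightarrow> 0) at_top"
    using lim e unfolding converges_in_probability_def by (simp add: dilation_law_def)
  have [measurable_cong]: "sets (dilation_law \<rho> T) = sets borel" for T by (simp add: dilation_law_def)
  have space: "space (dilation_law \<rho> T) = UNIV" for T by (simp add: dilation_law_def)
  have cdf: "cdf (distr (dilation_law \<rho> T) borel Z) x = measure (dilation_law \<rho> T) {t. Z t \<le> x}" for T
    unfolding cdf_def by (subst measure_distr) (auto simp: space vimage_def)
  show "((\<lambda>T. cdf (distr (dilation_law \<rho> T) borel Z) x) \<longlongrightarrow> cdf (return borel c) x) at_top"
  proof (cases "x < c")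
    case True
    have "\<forall>\<^sub>F T in at_top. norm (cdf (distr (dilation_law \<rho> T) borel Z) x) \<le> ?m T"
      using eventually_gt_at_top[of 0]
    proof eventually_elim
      fix T :: real assume "0 < T"
      then interpret prob_space "dilation_law \<rho> T" by (rule prob_space_dilation_law[OF rho])
      show "norm (cdf (distr (dilation_law \<rho> T) borel Z) x) \<le> ?m T"
        unfolding cdf real_norm_def abs_of_nonneg[OF measure_nonneg]
        using True by (intro finite_measure_mono) (auto simp: e_def)
    qed
    then have "((\<lambda>T. cdf (distr (dilation_law \<rho> T) borel Z) x) \<longlongrightarrow> 0) at_top"
      by (rule Lim_null_comparison[OF _ m0])
    then show ?thesis using True by (simp add: cdf_return)
  next
    case False
    have "\<forall>\<^sub>F T in at_top. norm (cdf (distr (dilation_law \<rho> T) borel Z) x - 1) \<le> ?m T"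
      using eventually_gt_at_top[of 0]
    proof eventually_elim
      fix T :: real assume "0 < T"
      then interpret prob_space "dilation_law \<rho> T" by (rule prob_space_dilation_law[OF rho])
      have "prob {t. \<not> Z t \<le> x} = 1 - prob {t. Z t \<le> x}"
        using prob_neg[of "\<lambda>t. Z t \<le> x"] by (simp add: space)
      moreover have "prob {t. \<not> Z t \<le> x} \<le> ?m T"
        using False by (intro finite_measure_mono) (auto simp: e_def)
      ultimately show "norm (cdf (distr (dilation_law \<rho> T) borel Z) x - 1) \<le> ?m T"
        unfolding cdf by simp
    qed
    then have "((\<lambda>T. cdf (distr (dilation_law \<rho> T) borel Z) x - 1) \<longlongrightarrow> 0) at_top"
      by (rule Lim_null_comparison[OF _ m0])
    then show ?thesis using False by (simp add: cdf_return LIM_zero_iff)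
  qed
qed

section \<open>Deviation of the variance from its mean\<close>

lemma markov_interval:
  fixes f :: "real \<Rightarrow> real"
  assumes cont: "continuous_on UNIV f" and nonneg: "\<And>t. 0 \<le> f t" and c: "0 < c"
  shows "measure lborel {t\<in>{0..T}. c \<le> f t} \<le> integral {0..T} f / c"
proof -
  have [measurable]: "f \<in> borel_measurable borel" by (rule borel_measurable_continuous_onI[OF cont])
  let ?S = "{t\<in>{0..T}. c \<le> f t}"
  have fin: "emeasure lborel ?S < \<infinity>"
    by (rule emeasure_bounded_finite) (rule bounded_subset[OF bounded_closed_interval[of 0 T]], auto)
  have int: "set_integrable lborel {0..T} f"
    unfolding set_integrable_def by (rule borel_integrable_compact) (auto intro: continuous_on_subset[OF cont])
  have "c * measure lborel ?S = (\<integral>t. c * indicator ?S t \<partial>lborel)" by simp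
  also have "\<dots> \<le> (\<integral>t. indicator {0..T} t *\<^sub>R f t \<partial>lborel)"
    using fin int nonneg unfolding set_integrable_def
    by (intro integral_mono integrable_mult_right integrable_real_indicator) (auto simp: indicator_def)
  also have "\<dots> = integral {0..T} f"
    using set_borel_integral_eq_integral(2)[OF int] by (simp add: set_lebesgue_integral_def)
  finally show ?thesis using c by (simp add: field_simps)
qed

lemma sin_squared_product:
  "4 * ((sin x)\<^sup>2 * (sin y)\<^sup>2) = 1 - cos (2 * x) - cos (2 * y) + (cos (2 * x + 2 * y) + cos (2 * x - 2 * y)) / (2::real)"
proof -
  have "(cos (2 * x + 2 * y) + cos (2 * x - 2 * y)) / 2 = cos (2 * x) * cos (2 * y)"
    by (simp add: cos_add cos_diff)
  moreover have "2 * (sin x)\<^sup>2 = 1 - cos (2 * x)" "2 * (sin y)\<^sup>2 = 1 - cos (2 * y)"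
    by (simp_all add: cos_double_sin)
  then have "(2 * (sin x)\<^sup>2) * (2 * (sin y)\<^sup>2) = (1 - cos (2 * x)) * (1 - cos (2 * y))" by simp
  ultimately show ?thesis by (simp add: algebra_simps)
qed

context admissible_group
begin

section \<open>The oscillating sum and its truncation\<close>

text \<open>For \<open>M\<close> the dual lattice, \<open>\<alpha> = 2 * pi * a\<close> and
  \<open>\<beta> = 2 * pi * b\<close> this is \<open>pi ^ 4 * (covol L)\<^sup>2\<close> times the
  variance at \<open>t > 0\<close>.\<close>

definition osc_sum :: "real \<Rightarrow> real \<Rightarrow> real \<Rightarrow> real" where
  "osc_sum \<alpha> \<beta> t = (\<Sum>\<^sub>\<infinity>l\<in>M - {0}. weight l * ((sin (\<alpha> * l$1 * t))\<^sup>2 * (sin (\<beta> * l$2 * t))\<^sup>2))"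

text \<open>Finite sums over vectors beyond norm \<open>T\<close> share one bound \<open>K\<close>,
  and for nonnegative terms this gives summability and the tail estimate at once. Squared sines are
  even in \<open>t\<close>, so negative \<open>t\<close> are covered and the sum is a function on
  the whole line.\<close>

lemma osc_sum_ball:
  assumes al: "0 < \<alpha>" and be: "0 < \<beta>"
  defines "f \<equiv> \<lambda>t l. weight l * ((sin (\<alpha> * l$1 * t))\<^sup>2 * (sin (\<beta> * l$2 * t))\<^sup>2)"
  shows "\<exists>K>0. \<forall>t T. \<bar>t\<bar> \<le> T \<longrightarrow> 0 < T \<longrightarrow> f t summable_on (M - {0}) \<and>
     \<bar>osc_sum \<alpha> \<beta> t - (\<Sum>l | l \<in> M - {0} \<and> norm l \<le> T. f t l)\<bar> \<le> K"
proof -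
  obtain K where K: "0 < K" and tail: "\<And>t T A. 0 \<le> t \<Longrightarrow> t \<le> T \<Longrightarrow> 0 < T \<Longrightarrow> finite A \<Longrightarrow> A \<subseteq> M - {0} \<Longrightarrow>
      (\<forall>l\<in>A. T \<le> norm l) \<Longrightarrow> sum (f t) A \<le> K"
    using tail_bound[OF al be] unfolding f_def by auto
  have nonneg: "0 \<le> f t l" for t l unfolding f_def by (simp add: weight_nonneg)
  have abs: "f t l = f \<bar>t\<bar> l" for t l by (simp add: f_def abs_if)
  show ?thesis
  proof (intro exI[of _ K] conjI K allI impI)
    fix t T :: real assume t: "\<bar>t\<bar> \<le> T" "0 < T"
    let ?B = "{l. l \<in> M - {0} \<and> norm l \<le> T}" and ?R = "{l\<in>M - {0}. T < norm l}"
    have finB: "finite ?B" by (rule finite_ball)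
    have le: "sum (f t) A \<le> K" if "finite A" "A \<subseteq> ?R" for A
      proof -
      have "sum (f t) A = sum (f \<bar>t\<bar>) A" by (rule sum.cong[OF refl abs])
      also have "\<dots> \<le> K" using t that by (intro tail) fastforce+
      finally show ?thesis .
    qed
    have "f t summable_on ?R"
      proof (rule nonneg_bdd_above_summable_on[OF nonneg])
      show "bdd_above (sum (f t) ` {F. F \<subseteq> ?R \<and> finite F})"
        by (rule bdd_aboveI2[where M=K]) (use le in blast)
    qed
    note R = this
    have B: "f t summable_on ?B" using finB by simp
    have un: "M - {0} = ?B \<union> ?R" by auto
    show "f t summable_on (M - {0})" by (subst un) (rule summable_on_Un_disjoint[OF B R], auto)
    have "osc_sum \<alpha> \<beta> t = infsum (f t) (?B \<union> ?R)" unfolding osc_sum_def f_def by (subst un) simp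
    also have "\<dots> = sum (f t) ?B + infsum (f t) ?R"
      using finB by (subst infsum_Un_disjoint[OF B R]) auto
    finally have "osc_sum \<alpha> \<beta> t - sum (f t) ?B = infsum (f t) ?R" by simp
    moreover have "infsum (f t) ?R \<le> K" by (rule infsum_le_finite_sums[OF R le])
    moreover have "0 \<le> infsum (f t) ?R" by (rule infsum_nonneg) (rule nonneg)
    ultimately show "\<bar>osc_sum \<alpha> \<beta> t - sum (f t) ?B\<bar> \<le> K" by simp
  qed
qed

lemma osc_sum_summable:
  assumes "0 < \<alpha>" "0 < \<beta>"
  shows "(\<lambda>l. weight l * ((sin (\<alpha> * l$1 * t))\<^sup>2 * (sin (\<beta> * l$2 * t))\<^sup>2)) summable_on (M - {0})"
proof -
  obtain K where "\<forall>t T. \<bar>t\<bar> \<le> T \<longrightarrow> 0 < T \<longrightarrow>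
      (\<lambda>l. weight l * ((sin (\<alpha> * l$1 * t))\<^sup>2 * (sin (\<beta> * l$2 * t))\<^sup>2)) summable_on (M - {0})"
    using osc_sum_ball[OF assms] by blast
  from this[rule_format, of t "\<bar>t\<bar> + 1"] show ?thesis by simp
qed

text \<open>A pointwise limit of continuous functions: the balls of integer radius are finite and
  eventually contain every finite set of vectors.\<close>

lemma osc_sum_measurable [measurable]:
  assumes "0 < \<alpha>" "0 < \<beta>"
  shows "osc_sum \<alpha> \<beta> \<in> borel_measurable borel"
proof (rule borel_measurable_LIMSEQ_real)
  let ?f = "\<lambda>t l. weight l * ((sin (\<alpha> * l$1 * t))\<^sup>2 * (sin (\<beta> * l$2 * t))\<^sup>2)"
  let ?B = "\<lambda>n. {l\<in>M - {0}. norm l \<le> real n}"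
  show "(\<lambda>t. \<Sum>l\<in>?B n. ?f t l) \<in> borel_measurable borel" for n by measurable
  fix t :: real
  have "filterlim ?B (finite_subsets_at_top (M - {0})) sequentially"
    unfolding filterlim_finite_subsets_at_top
  proof (intro allI impI)
    fix X assume X: "finite X \<and> X \<subseteq> M - {0}"
    obtain n0 where n0: "Max (insert 0 (norm ` X)) \<le> real n0" using real_arch_simple by blast
    have "norm l \<le> real n0" if "l \<in> X" for l
    proof -
      have "norm l \<le> Max (insert 0 (norm ` X))" using X that by (intro Max_ge) auto
      then show ?thesis using n0 by simp
    qed
    then have "finite (?B n) \<and> X \<subseteq> ?B n \<and> ?B n \<subseteq> M - {0}" if "n0 \<le> n" for n
      using X finite_ball[of "real n"] that by fastforce
    then show "\<forall>\<^sub>F n in sequentially. finite (?B n) \<and> X \<subseteq> ?B n \<and> ?B n \<subseteq> M - {0}"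
      unfolding eventually_sequentially by blast
  qed
  moreover have "(sum (?f t) \<longlongrightarrow> osc_sum \<alpha> \<beta> t) (finite_subsets_at_top (M - {0}))"
    using has_sum_infsum[OF osc_sum_summable[OF assms, of t]] unfolding has_sum_def osc_sum_def .
  ultimately show "(\<lambda>n. \<Sum>l\<in>?B n. ?f t l) \<longlonglongrightarrow> osc_sum \<alpha> \<beta> t"
    using filterlim_compose by blast
qed

text \<open>\<open>W\<close> collects the squares of the four oscillating sums, all truncated at
  norm \<open>T\<close>, so that the second moment bounds apply on the whole of
  \<open>{0..T}\<close>. The inequality between the sum of four terms and the sum of their squares
  gives \<open>2 * sqrt\<close>; the tail and the cone go into \<open>K\<close>.\<close>

lemma osc_sum_deviation:
  assumes al: "0 < \<alpha>" and be: "0 < \<beta>"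
  shows "\<exists>K>0. \<exists>W. (\<forall>T. continuous_on UNIV (W T)) \<and> (\<forall>T t. 0 \<le> W T t) \<and>
     (\<forall>T>0. integral {0..T} (W T) \<le> K * T * V M T) \<and>
     (\<forall>t T. \<bar>t\<bar> \<le> T \<longrightarrow> 0 < T \<longrightarrow> \<bar>4 * osc_sum \<alpha> \<beta> t - V M T\<bar> \<le> K + 2 * sqrt (W T t))"
proof -
  \<comment> \<open>The last two entries are what \<open>mixed_second_moment_bound\<close> requires
    of \<open>e\<close> for the coefficients \<open>2 * \<alpha>\<close> and
    \<open>2 * \<beta>\<close> with either sign.\<close>
  define e where "e = min (1/2) (min (\<alpha> / (2 * \<beta>)) (\<beta> / (2 * \<alpha>)))"
  have e: "0 < e" "e \<le> 1/2" "e \<le> \<alpha> / (2 * \<beta>)" "e \<le> \<beta> / (2 * \<alpha>)" using al be by (auto simp: e_def)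
  have e': "e * \<bar>2 * \<beta>\<bar> \<le> 2 * \<alpha> / 2" "e * (2 * \<alpha>) \<le> \<bar>2 * \<beta>\<bar> / 2"
    using e(3,4) al be by (auto simp: field_simps)
  define cone where "cone l \<longleftrightarrow> e * \<bar>l$1\<bar> \<le> \<bar>l$2\<bar> \<and> e * \<bar>l$2\<bar> \<le> \<bar>l$1\<bar>" for l :: "real^2"
  define D where "D = {l\<in>M - {0}. \<not> cone l}"
  define B where "B T = {l. l \<in> M - {0} \<and> norm l \<le> T}" for T
  define S1 where "S1 T t = (\<Sum>l | l \<in> M - {0} \<and> norm l \<le> T. weight l * cos (2 * \<alpha> * l$1 * t))" for T t
  define S2 where "S2 T t = (\<Sum>l | l \<in> M - {0} \<and> norm l \<le> T. weight l * cos (2 * \<beta> * l$2 * t))" for T t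
  define S3 where "S3 T t = (\<Sum>l | l \<in> D \<and> norm l \<le> T. weight l * cos ((2 * \<alpha> * l$1 + 2 * \<beta> * l$2) * t))" for T t
  define S4 where "S4 T t = (\<Sum>l | l \<in> D \<and> norm l \<le> T. weight l * cos ((2 * \<alpha> * l$1 + (- 2 * \<beta>) * l$2) * t))" for T t
  obtain K1 where K1: "0 < K1" "\<And>T. 0 < T \<Longrightarrow> integral {0..T} (\<lambda>t. (S1 T t)\<^sup>2) \<le> K1 * T * V M T"
    using nth_second_moment_bound[of 1 2 "2 * \<alpha>"] al unfolding S1_def by auto
  obtain K2 where K2: "0 < K2" "\<And>T. 0 < T \<Longrightarrow> integral {0..T} (\<lambda>t. (S2 T t)\<^sup>2) \<le> K2 * T * V M T"
    using nth_second_moment_bound[of 2 1 "2 * \<beta>"] be unfolding S2_def by auto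
  obtain K3 where K3: "0 < K3" "\<And>T. 0 < T \<Longrightarrow> integral {0..T} (\<lambda>t. (S3 T t)\<^sup>2) \<le> K3 * T * V M T"
    using mixed_second_moment_bound[of "2 * \<alpha>" "2 * \<beta>" e] al be e e' unfolding S3_def D_def cone_def by auto
  obtain K4 where K4: "0 < K4" "\<And>T. 0 < T \<Longrightarrow> integral {0..T} (\<lambda>t. (S4 T t)\<^sup>2) \<le> K4 * T * V M T"
    using mixed_second_moment_bound[of "2 * \<alpha>" "- 2 * \<beta>" e] al be e e' unfolding S4_def D_def cone_def by auto
  obtain Kc where Kc: "0 < Kc" "\<And>A. finite A \<Longrightarrow> A \<subseteq> M - {0} \<Longrightarrow> (\<forall>l\<in>A. cone l) \<Longrightarrow> sum weight A \<le> Kc"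
    using weight_cone_bound[OF e(1)] unfolding cone_def by auto
  obtain Kt where Kt: "0 < Kt" "\<And>t T. \<bar>t\<bar> \<le> T \<Longrightarrow> 0 < T \<Longrightarrow>
      \<bar>osc_sum \<alpha> \<beta> t - (\<Sum>l\<in>B T. weight l * ((sin (\<alpha> * l$1 * t))\<^sup>2 * (sin (\<beta> * l$2 * t))\<^sup>2))\<bar> \<le> Kt"
    using osc_sum_ball[OF al be] unfolding B_def by blast
  define W where "W T t = (S1 T t)\<^sup>2 + (S2 T t)\<^sup>2 + (S3 T t)\<^sup>2 + (S4 T t)\<^sup>2" for T t
  have c: "continuous_on X (S1 T)" "continuous_on X (S2 T)" "continuous_on X (S3 T)" "continuous_on X (S4 T)" for T X
    unfolding S1_def[abs_def] S2_def[abs_def] S3_def[abs_def] S4_def[abs_def] by (intro continuous_intros)+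
  define K where "K = (K1 + K2 + K3 + K4) + (4 * Kt + Kc)"
  have Kp: "0 < K" using K1 K2 K3 K4 Kc Kt by (simp add: K_def add_pos_pos)
  show ?thesis
  proof (intro exI[of _ K] exI[of _ W] conjI allI impI Kp)
    show "continuous_on UNIV (W T)" for T unfolding W_def[abs_def] by (intro continuous_intros c)
    show "0 \<le> W T t" for T t unfolding W_def by simp
  next
    fix T :: real assume T: "0 < T"
    have "integral {0..T} (W T) = integral {0..T} (\<lambda>t. (S1 T t)\<^sup>2) + integral {0..T} (\<lambda>t. (S2 T t)\<^sup>2)
        + integral {0..T} (\<lambda>t. (S3 T t)\<^sup>2) + integral {0..T} (\<lambda>t. (S4 T t)\<^sup>2)"
      unfolding W_def[abs_def]
      by (subst integral_add; (intro integrable_continuous_interval continuous_intros c)?)+ simp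
    also have "\<dots> \<le> (K1 + K2 + K3 + K4) * (T * V M T)"
      using K1(2)[OF T] K2(2)[OF T] K3(2)[OF T] K4(2)[OF T] by (simp add: algebra_simps)
    also have "\<dots> \<le> K * (T * V M T)"
      using T Kc Kt V_nonneg[of T] by (intro mult_right_mono) (auto simp: K_def)
    finally show "integral {0..T} (W T) \<le> K * T * V M T" by (simp add: mult.assoc)
  next
    fix t T :: real assume t: "\<bar>t\<bar> \<le> T" "0 < T"
    have finB: "finite (B T)" unfolding B_def by (rule finite_ball)
    have split: "\<bar>(\<Sum>l\<in>B T. weight l * cos (g l)) - (\<Sum>l | l \<in> D \<and> norm l \<le> T. weight l * cos (g l))\<bar> \<le> Kc"
      for g :: "real^2 \<Rightarrow> real"
    proof -
      let ?C = "{l\<in>B T. cone l}"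
      have disj: "{l. l \<in> D \<and> norm l \<le> T} \<inter> ?C = {}" unfolding D_def by auto
      have "B T = {l. l \<in> D \<and> norm l \<le> T} \<union> ?C" unfolding B_def D_def by auto
      then have "(\<Sum>l\<in>B T. weight l * cos (g l)) = (\<Sum>l | l \<in> D \<and> norm l \<le> T. weight l * cos (g l)) + (\<Sum>l\<in>?C. weight l * cos (g l))"
        using finB by (metis (lifting) sum.union_disjoint finite_Un disj)
      moreover have "\<bar>\<Sum>l\<in>?C. weight l * cos (g l)\<bar> \<le> sum weight ?C"
        by (rule order_trans[OF sum_abs], rule sum_mono) (simp add: abs_mult weight_nonneg mult_left_le)
      moreover have "sum weight ?C \<le> Kc" by (intro Kc(2) finite_subset[OF _ finB]) (auto simp: B_def)
      ultimately show ?thesis by linarith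
    qed
    \<comment> \<open>Here \<open>x\<close>, \<open>y\<close> stand for the mixed sums over the
      whole ball and \<open>s3\<close>, \<open>s4\<close> for their parts off the cone. Each pair
      differs by at most \<open>Kc\<close> and enters with the factor 1/2, so a single
      \<open>Kc\<close> remains.\<close>
    have triangle: "\<bar>4 * z - v\<bar> \<le> 4 * Kt + Kc + (\<bar>s1\<bar> + \<bar>s2\<bar> + \<bar>s3\<bar> + \<bar>s4\<bar>)"
      if "4 * s = v - s1 - s2 + (x + y) / 2" "\<bar>z - s\<bar> \<le> Kt" "\<bar>x - s3\<bar> \<le> Kc" "\<bar>y - s4\<bar> \<le> Kc"
      for z v s s1 s2 s3 s4 x y :: real
    proof -
      have "4 * z - v = 4 * (z - s) - s1 - s2 + ((x - s3) + (y - s4)) / 2 + s3 / 2 + s4 / 2"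
        using that(1) by (simp add: field_simps)
      also have "\<bar>\<dots>\<bar> \<le> 4 * \<bar>z - s\<bar> + \<bar>s1\<bar> + \<bar>s2\<bar> + (\<bar>x - s3\<bar> + \<bar>y - s4\<bar>) / 2 + \<bar>s3\<bar> / 2 + \<bar>s4\<bar> / 2"
        by (intro order_trans[OF abs_triangle_ineq] order_trans[OF abs_triangle_ineq4] add_mono)
          (simp_all add: abs_mult del: right_diff_distrib_numeral)
      also have "\<dots> \<le> 4 * Kt + \<bar>s1\<bar> + \<bar>s2\<bar> + (Kc + Kc) / 2 + \<bar>s3\<bar> + \<bar>s4\<bar>"
        using that(2-4) by (intro add_mono mult_left_mono divide_right_mono) auto
      finally show ?thesis by (simp add: add_ac)
    qed
    have "4 * (\<Sum>l\<in>B T. weight l * ((sin (\<alpha> * l$1 * t))\<^sup>2 * (sin (\<beta> * l$2 * t))\<^sup>2)) =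
        (\<Sum>l\<in>B T. weight l - weight l * cos (2 * \<alpha> * l$1 * t) - weight l * cos (2 * \<beta> * l$2 * t)
          + (weight l * cos ((2 * \<alpha> * l$1 + 2 * \<beta> * l$2) * t) + weight l * cos ((2 * \<alpha> * l$1 + (- 2 * \<beta>) * l$2) * t)) / 2)"
      unfolding sum_distrib_left
    proof (rule sum.cong[OF refl], goal_cases)
      case (1 l)
      have "4 * (weight l * ((sin (\<alpha> * l$1 * t))\<^sup>2 * (sin (\<beta> * l$2 * t))\<^sup>2)) =
          weight l * (4 * ((sin (\<alpha> * l$1 * t))\<^sup>2 * (sin (\<beta> * l$2 * t))\<^sup>2))" by simp
      then show ?case unfolding sin_squared_product by (simp add: algebra_simps add_divide_distrib)
    qed
    also have "\<dots> = V M T - S1 T t - S2 T t + ((\<Sum>l\<in>B T. weight l * cos ((2 * \<alpha> * l$1 + 2 * \<beta> * l$2) * t))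
        + (\<Sum>l\<in>B T. weight l * cos ((2 * \<alpha> * l$1 + (- 2 * \<beta>) * l$2) * t))) / 2"
      unfolding V_eq S1_def S2_def B_def by (simp only: sum.distrib sum_subtractf sum_divide_distrib[symmetric])
    finally have "\<bar>4 * osc_sum \<alpha> \<beta> t - V M T\<bar> \<le> 4 * Kt + Kc + (\<bar>S1 T t\<bar> + \<bar>S2 T t\<bar> + \<bar>S3 T t\<bar> + \<bar>S4 T t\<bar>)"
      using Kt(2)[OF t] split[of "\<lambda>l. (2 * \<alpha> * l$1 + 2 * \<beta> * l$2) * t"]
        split[of "\<lambda>l. (2 * \<alpha> * l$1 + (- 2 * \<beta>) * l$2) * t"]
      unfolding S3_def[symmetric] S4_def[symmetric] by (rule triangle)
    also have "\<bar>S1 T t\<bar> + \<bar>S2 T t\<bar> + \<bar>S3 T t\<bar> + \<bar>S4 T t\<bar> \<le> 2 * sqrt (W T t)"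
    proof -
      have sq: "(w + x + y + z)\<^sup>2 \<le> 4 * (w\<^sup>2 + x\<^sup>2 + y\<^sup>2 + z\<^sup>2)" for w x y z :: real
      proof -
        have "0 \<le> (w - x)\<^sup>2 + (w - y)\<^sup>2 + (w - z)\<^sup>2 + (x - y)\<^sup>2 + (x - z)\<^sup>2 + (y - z)\<^sup>2" by simp
        then show ?thesis by (simp add: power2_eq_square algebra_simps)
      qed
      have "\<bar>S1 T t\<bar> + \<bar>S2 T t\<bar> + \<bar>S3 T t\<bar> + \<bar>S4 T t\<bar> \<le> sqrt (4 * W T t)"
        using sq[of "\<bar>S1 T t\<bar>" "\<bar>S2 T t\<bar>" "\<bar>S3 T t\<bar>" "\<bar>S4 T t\<bar>"] by (intro real_le_rsqrt) (simp add: W_def)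
      then show ?thesis by (simp add: real_sqrt_mult)
    qed
    finally show "\<bar>4 * osc_sum \<alpha> \<beta> t - V M T\<bar> \<le> K + 2 * sqrt (W T t)"
      using K1 K2 K3 K4 by (simp add: K_def)
  qed
qed

section \<open>Exceptional dilations have density zero\<close>

lemma V_measurable [measurable]: "V M \<in> borel_measurable borel"
  by (rule borel_measurable_mono[OF V_mono])

text \<open>Vectors with norm between \<open>\<delta> * T\<close> and \<open>T\<close> form a shell
  of fixed ratio \<open>1 / \<delta>\<close>. This allows \<open>V M T\<close>, natural for the
  whole interval, to be exchanged for \<open>V M t\<close>.\<close>

lemma V_diff_bound:
  assumes \<delta>: "0 < \<delta>" "\<delta> \<le> 1"
  shows "\<exists>K>0. \<forall>T>0. \<forall>t. \<delta> * T \<le> t \<longrightarrow> t \<le> T \<longrightarrow> \<bar>V M T - V M t\<bar> \<le> K"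
proof -
  obtain K where K: "0 < K" "\<And>r A. 0 < r \<Longrightarrow> finite A \<Longrightarrow> A \<subseteq> M - {0} \<Longrightarrow>
      (\<forall>l\<in>A. r \<le> norm l \<and> norm l \<le> 1 / \<delta> * r) \<Longrightarrow> sum weight A \<le> K"
    using weight_shell_bound[of "1 / \<delta>"] \<delta> by auto
  show ?thesis
  proof (intro exI[of _ K] conjI K(1) allI impI)
    fix T t :: real assume T: "0 < T" "\<delta> * T \<le> t" "t \<le> T"
    let ?B = "\<lambda>t. {l\<in>M - {0}. norm l \<le> t}"
    have "V M T - V M t = sum weight (?B T - ?B t)"
      unfolding V_eq using T by (intro sum_diff[symmetric] finite_ball) auto
    also have "\<dots> \<le> K"
      using T \<delta> finite_ball[of T] by (intro K(2)[of "\<delta> * T"]) auto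
    finally show "\<bar>V M T - V M t\<bar> \<le> K" using monoD[OF V_mono T(3)] by simp
  qed
qed

text \<open>Dilations below \<open>\<delta> * T\<close> fill at most the fraction
  \<open>e / 2\<close> of the interval and are discarded. On the rest \<open>V M t\<close> and
  \<open>V M T\<close> differ by a constant, and a large deviation forces \<open>W T t\<close> to be
  of order \<open>(V M T)\<^sup>2\<close>, against a mean of order \<open>V M T\<close>.\<close>

lemma osc_sum_deviation_tendsto_zero:
  assumes al: "0 < \<alpha>" and be: "0 < \<beta>" and \<eta>: "0 < \<eta>" and lim: "filterlim (V M) at_top at_top"
  shows "((\<lambda>T. measure lborel ({t. \<eta> * V M t \<le> \<bar>4 * osc_sum \<alpha> \<beta> t - V M t\<bar>} \<inter> {0..T}) / T) \<longlongrightarrow> 0) at_top"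
proof (rule tendsto_zero_iff_eventually_small)
  let ?S = "{t. \<eta> * V M t \<le> \<bar>4 * osc_sum \<alpha> \<beta> t - V M t\<bar>}"
  note [measurable] = osc_sum_measurable[OF al be]
  show "0 \<le> measure lborel (?S \<inter> {0..T}) / T" for T by (cases "0 \<le> T") auto
  fix e :: real assume e: "0 < e"
  obtain K W where K: "0 < K" and W: "\<And>T. continuous_on UNIV (W T)" "\<And>T t. 0 \<le> W T t"
      "\<And>T. 0 < T \<Longrightarrow> integral {0..T} (W T) \<le> K * T * V M T"
      "\<And>t T. \<bar>t\<bar> \<le> T \<Longrightarrow> 0 < T \<Longrightarrow> \<bar>4 * osc_sum \<alpha> \<beta> t - V M T\<bar> \<le> K + 2 * sqrt (W T t)"
    using osc_sum_deviation[OF al be] by auto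
  define \<delta> where "\<delta> = min (e / 2) 1"
  have \<delta>: "0 < \<delta>" "\<delta> \<le> 1" "\<delta> \<le> e / 2" using e by (auto simp: \<delta>_def)
  obtain Kd where Kd: "0 < Kd" "\<And>T t. 0 < T \<Longrightarrow> \<delta> * T \<le> t \<Longrightarrow> t \<le> T \<Longrightarrow> \<bar>V M T - V M t\<bar> \<le> Kd"
    using V_diff_bound[OF \<delta>(1,2)] by auto
  define K3 where "K3 = K + Kd + \<eta> * Kd"
  \<comment> \<open>The first threshold lets half of \<open>\<eta> * V M T\<close> absorb the
    bounded error \<open>K3\<close>, leaving \<open>\<eta> * V M T \<le> 4 * sqrt (W T t)\<close>.
    The second makes the Markov bound \<open>16 * K / (\<eta>\<^sup>2 * V M T)\<close> at most
    \<open>e / 2\<close>.\<close>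
  have "\<forall>\<^sub>F T in at_top. max (2 * K3 / \<eta>) (32 * K / (\<eta>\<^sup>2 * e)) < V M T"
    using lim unfolding filterlim_at_top_dense by blast
  then show "\<forall>\<^sub>F T in at_top. measure lborel (?S \<inter> {0..T}) / T \<le> e"
    using eventually_gt_at_top[of 0]
  proof eventually_elim
    fix T :: real assume V: "max (2 * K3 / \<eta>) (32 * K / (\<eta>\<^sup>2 * e)) < V M T" and T: "0 < T"
    have V1: "2 * K3 < \<eta> * V M T" using V \<eta> by (simp add: field_simps)
    have K3: "0 < K3" using K Kd \<eta> by (simp add: K3_def add_pos_pos)
    have V0: "0 < V M T" using V1 K3 \<eta> by (smt (verit, best) mult_nonneg_nonpos)
    have V2: "32 * K / (\<eta>\<^sup>2 * e) < V M T" using V by simp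
    define c where "c = (\<eta> * V M T / 4)\<^sup>2"
    have c: "0 < c" using \<eta> V0 by (simp add: c_def)
    let ?G = "{t\<in>{0..T}. c \<le> W T t}"
    have [measurable]: "W T \<in> borel_measurable borel" by (rule borel_measurable_continuous_onI[OF W(1)])
    have sub: "?S \<inter> {0..T} \<subseteq> {0..\<delta> * T} \<union> ?G"
    proof
      fix t assume t: "t \<in> ?S \<inter> {0..T}"
      show "t \<in> {0..\<delta> * T} \<union> ?G"
      proof (cases "t \<le> \<delta> * T")
        case False
        then have d: "\<bar>V M T - V M t\<bar> \<le> Kd" using t T by (intro Kd(2)) auto
        have "\<eta> * (V M T - Kd) \<le> \<eta> * V M t" using d \<eta> by (intro mult_left_mono) auto
        then have "\<eta> * V M T - \<eta> * Kd \<le> \<bar>4 * osc_sum \<alpha> \<beta> t - V M t\<bar>"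
          using t by (simp add: right_diff_distrib)
        also have "\<dots> \<le> K + 2 * sqrt (W T t) + Kd" using W(4)[of t T] t T d by auto
        finally have "\<eta> * V M T \<le> K3 + 2 * sqrt (W T t)" unfolding K3_def by simp
        then have "\<eta> * V M T \<le> 4 * sqrt (W T t)" using V1 by simp
        then have "\<eta> * V M T / 4 \<le> sqrt (W T t)" by simp
        then have "c \<le> (sqrt (W T t))\<^sup>2" unfolding c_def using \<eta> V0 by (intro power_mono) auto
        then show ?thesis using t W(2)[of T t] by simp
      qed (use t in auto)
    qed
    have fin: "emeasure lborel X < \<infinity>" if "bounded X" for X :: "real set"
      by (rule emeasure_bounded_finite[OF that])
    have bG: "bounded ?G" by (rule bounded_subset[OF bounded_closed_interval[of 0 T]]) auto
    have "measure lborel (?S \<inter> {0..T}) \<le> measure lborel ({0..\<delta> * T} \<union> ?G)"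
      using bG sub by (intro measure_mono_fmeasurable fmeasurableI fin) auto
    also have "\<dots> \<le> measure lborel {0..\<delta> * T} + measure lborel ?G"
      using bG by (intro measure_Un_le) auto
    also have "measure lborel {0..\<delta> * T} = \<delta> * T" using \<delta> T by simp
    also have "measure lborel ?G \<le> e / 2 * T"
    proof -
      have "measure lborel ?G \<le> integral {0..T} (W T) / c" by (rule markov_interval[OF W(1,2) c])
      also have "\<dots> \<le> K * T * V M T / c" using W(3)[OF T] c by (intro divide_right_mono) auto
      also have "\<dots> = 16 * K / (\<eta>\<^sup>2 * V M T) * T"
        using V0 \<eta> by (simp add: c_def power2_eq_square field_simps)
      also have "\<dots> \<le> e / 2 * T"
      proof (intro mult_right_mono)
        show "16 * K / (\<eta>\<^sup>2 * V M T) \<le> e / 2" using V2 V0 \<eta> e by (simp add: field_simps)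
      qed (use T in simp)
      finally show ?thesis .
    qed
    also have "\<delta> * T + e / 2 * T \<le> e / 2 * T + e / 2 * T" using \<delta> T by (intro add_mono mult_right_mono) auto
    finally show "measure lborel (?S \<inter> {0..T}) / T \<le> e" using T by (simp add: field_simps)
  qed
qed

end

section \<open>The limit theorem\<close>

lemma planar_lattice_imp_plane_lattice:
  assumes "planar_lattice L"
  shows "\<exists>u v d. plane_lattice L u v d"
proof -
  obtain u v where uv: "u \<noteq> v" "independent {u, v}"
    and L: "L = {of_int m *\<^sub>R u + of_int n *\<^sub>R v | m n. True}"
    using assms unfolding planar_lattice_def by (elim exE conjE)
  have ind: "s = 0 \<and> r = 0" if "s *\<^sub>R u + r *\<^sub>R v = 0" for s r
  proof -
    define c where "c = (\<lambda>x. if x = u then s else r)"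
    have "(\<Sum>x\<in>{u, v}. c x *\<^sub>R x) = 0" using uv(1) that by (simp add: c_def)
    then have "c u = 0" "c v = 0" by (auto intro!: independentD[OF uv(2), of "{u, v}" c])
    then show ?thesis using uv(1) by (simp add: c_def)
  qed
  have "u$1 * v$2 - u$2 * v$1 \<noteq> 0"
  proof
    assume "u$1 * v$2 - u$2 * v$1 = 0"
    then have "v$2 *\<^sub>R u + (- u$2) *\<^sub>R v = 0" "v$1 *\<^sub>R u + (- u$1) *\<^sub>R v = 0"
      by (simp_all add: vec_eq_iff forall_2 algebra_simps)
    from ind[OF this(1)] ind[OF this(2)] have "u = 0" "v = 0"
      by (simp_all add: vec_eq_iff forall_2)
    with uv(1) show False by simp
  qed
  then have "plane_lattice L u v (u$1 * v$2 - u$2 * v$1)" using L unfolding plane_lattice_def by blast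
  then show ?thesis by blast
qed

lemma torus_mean_divide: "torus_mean L (\<lambda>X. f X / c) = torus_mean L f / c"
  by (simp add: torus_mean_def set_lebesgue_integral_def)

lemma torus_mean_zero [simp]: "torus_mean L (\<lambda>X. 0) = 0"
  by (simp add: torus_mean_def set_lebesgue_integral_def)

lemma V_nonpos_eq_0:
  assumes "t \<le> 0"
  shows "V L t = 0"
proof -
  have "{l. l \<in> L \<and> 0 < norm l \<and> norm l \<le> t} = {}"
    using assms by (auto simp del: zero_less_norm_iff)
  then show ?thesis unfolding V_def by (simp only: sum.empty)
qed

text \<open>Holds at every real \<open>t\<close>: where \<open>V\<close> vanishes, division by zero
  makes both sides 0. The right side is built from Borel functions, which is how the random variable
  is seen to be measurable.\<close>

lemma normalized_variance_eq:
  assumes "plane_lattice L u v d" "admissible_group (dual_lattice L) C" "0 < a" "0 < b"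
  shows "normalized_variance (Rect a b) L t = (if t \<le> 0 then 0 else
    admissible_group.osc_sum (dual_lattice L) (2 * pi * a) (2 * pi * b) t / (pi ^ 4 * (covol L)\<^sup>2) / V (dual_lattice L) t)"
proof (cases "t \<le> 0")
  case True
  then show ?thesis by (simp add: normalized_variance_def V_nonpos_eq_0)
next
  case False
  interpret plane_lattice L u v d by fact
  interpret M: admissible_group "dual_lattice L" C by fact
  have "normalized_variance (Rect a b) L t =
      torus_mean L (\<lambda>X. (discrepancy t (Rect a b) X L)\<^sup>2) / V (dual_lattice L) t"
    unfolding normalized_variance_def power_divide torus_mean_divide
    using M.V_nonneg by simp
  also have "torus_mean L (\<lambda>X. (discrepancy t (Rect a b) X L)\<^sup>2) = M.osc_sum (2 * pi * a) (2 * pi * b) t / (pi ^ 4 * (covol L)\<^sup>2)"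
    unfolding M.osc_sum_def weight_def
    using False assms(3,4) M.nth_nonzero M.osc_sum_summable[of "2 * pi * a" "2 * pi * b" t]
    by (intro variance_formula) (auto simp: weight_def)
  finally show ?thesis using False by simp
qed

theorem theorem1:
  fixes L :: "(real^2) set"
  assumes "planar_lattice L" and "admissible L"
  shows "(\<exists>C>0. \<forall>\<^sub>F t in at_top. 1 / C * ln t \<le> V L t \<and> V L t \<le> C * ln t) \<and>
    (\<forall>a b \<rho>. 0 < a \<longrightarrow> 0 < b \<longrightarrow> prob_density_01 \<rho> \<longrightarrow>
       (let Z = normalized_variance (Rect a b) L;
            c = 1 / (4 * pi ^ 4 * (covol L)\<^sup>2)
        in Z \<in> borel_measurable borel \<and>
           converges_in_distribution
             (\<lambda>T. distr (dilation_law \<rho> T) borel Z) (return borel c) at_top \<and>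
           converges_in_probability (dilation_law \<rho>) Z c at_top))"
proof -
  obtain u v d where pl: "plane_lattice L u v d" using planar_lattice_imp_plane_lattice[OF assms(1)] by blast
  interpret plane_lattice L u v d by fact
  obtain C where C: "0 < C" "\<And>l. l \<in> L \<Longrightarrow> l \<noteq> 0 \<Longrightarrow> C \<le> \<bar>l$1 * l$2\<bar>"
    using assms(2) unfolding admissible_def by auto
  interpret A: admissible_group L C using C by unfold_locales auto
  define M where "M = dual_lattice L"
  have ag: "admissible_group (dual_lattice L) (C / d\<^sup>2)"
    using C(1) d_nonzero dual_admissible[OF C] by unfold_locales auto
  then interpret M: admissible_group M "C / d\<^sup>2" unfolding M_def .
  have V_infinity: "filterlim (V M) at_top at_top"
  proof -
    obtain c where c: "0 < c" "\<forall>\<^sub>F t in at_top. c * ln t \<le> V M t"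
      using M.V_lower[OF dual_eq[folded M_def] dual_independent] by blast
    have "filterlim (\<lambda>t. c * ln t) at_top at_top"
      by (rule filterlim_tendsto_pos_mult_at_top[OF tendsto_const c(1) ln_at_top])
    then show ?thesis using c(2) by (rule filterlim_at_top_mono)
  qed
  show ?thesis
  proof (intro conjI allI impI)
    obtain K where K: "0 < K" "\<forall>\<^sub>F t in at_top. V L t \<le> K * ln t" using A.V_upper by blast
    obtain c where c: "0 < c" "\<forall>\<^sub>F t in at_top. c * ln t \<le> V L t"
      using A.V_lower[OF L_eq basis_independent] by blast
    define C' where "C' = max K (1 / c)"
    have C': "0 < C'" "K \<le> C'" "1 / C' \<le> c"
      using K(1) c(1) by (auto simp: C'_def field_simps max_def)
    show "\<exists>C>0. \<forall>\<^sub>F t in at_top. 1 / C * ln t \<le> V L t \<and> V L t \<le> C * ln t"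
    proof (intro exI[of _ C'] conjI C'(1))
      show "\<forall>\<^sub>F t in at_top. 1 / C' * ln t \<le> V L t \<and> V L t \<le> C' * ln t"
        using K(2) c(2) eventually_ge_at_top[of 1]
      proof eventually_elim
        case (elim t)
        have "1 / C' * ln t \<le> c * ln t" "K * ln t \<le> C' * ln t"
          using C'(2,3) elim by (intro mult_right_mono; simp)+
        then show ?case using elim by linarith
      qed
    qed
  next
    fix a b :: real and \<rho>
    assume a: "0 < a" and b: "0 < b" and rho: "prob_density_01 \<rho>"
    define Z where "Z = normalized_variance (Rect a b) L"
    \<comment> \<open>The product of two squared sines has mean 1/4, so \<open>4 * Q t\<close> is
      the quantity to compare with \<open>V M t\<close>; the 4 in \<open>c\<close> compensates for
      it.\<close>
    define c where "c = 1 / (4 * pi ^ 4 * (covol L)\<^sup>2)"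
    define Q where "Q = M.osc_sum (2 * pi * a) (2 * pi * b)"
    have c0: "0 < c" using covol_pos by (simp add: c_def)
    have ab: "0 < 2 * pi * a" "0 < 2 * pi * b" using a b by auto
    note [measurable] = M.osc_sum_measurable[OF ab, folded Q_def]
    have Z: "Z t = (if t \<le> 0 then 0 else c * (4 * Q t) / V M t)" for t
      unfolding Z_def normalized_variance_eq[OF pl ag a b] by (simp add: Q_def M_def c_def)
    have Z_meas [measurable]: "Z \<in> borel_measurable borel"
      unfolding Z[abs_def] by measurable
    have prob: "converges_in_probability (dilation_law \<rho>) Z c at_top"
      unfolding converges_in_probability_def
    proof (intro allI impI)
      fix \<epsilon> :: real assume \<epsilon>: "0 < \<epsilon>"
      let ?S = "{t. \<epsilon> / c * V M t \<le> \<bar>4 * Q t - V M t\<bar>}"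
      have sub: "{t. \<epsilon> < \<bar>Z t - c\<bar>} \<inter> {0..T} \<subseteq> ?S \<inter> {0..T}" for T
      proof
        fix t assume t: "t \<in> {t. \<epsilon> < \<bar>Z t - c\<bar>} \<inter> {0..T}"
        show "t \<in> ?S \<inter> {0..T}"
        \<comment> \<open>If \<open>V M t = 0\<close>, the inequality defining \<open>?S\<close> is
          trivially true, so the small \<open>t\<close> at which the quotient has its default value
          are counted in \<open>?S\<close> as well.\<close>
        proof (cases "V M t = 0")
          case False
          then have V: "0 < V M t" using M.V_nonneg[of t] by simp
          then have "0 < t" using V_nonpos_eq_0[of t M] by force
          then have "Z t - c = c * (4 * Q t - V M t) / V M t"
            using V by (simp add: Z field_simps)
          then have "\<bar>Z t - c\<bar> = c * \<bar>4 * Q t - V M t\<bar> / V M t" using c0 V by (simp add: abs_mult)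
          then have "\<epsilon> * V M t \<le> c * \<bar>4 * Q t - V M t\<bar>" using t V by (simp add: pos_less_divide_eq)
          then show ?thesis using t c0 by (simp add: pos_divide_le_eq mult.commute)
        qed (use t in auto)
      qed
      have "((\<lambda>T. measure lborel ({t. \<epsilon> < \<bar>Z t - c\<bar>} \<inter> {0..T}) / T) \<longlongrightarrow> 0) at_top"
      proof (rule Lim_null_comparison)
        show "((\<lambda>T. measure lborel (?S \<inter> {0..T}) / T) \<longlongrightarrow> 0) at_top"
          unfolding Q_def using \<epsilon> c0 by (intro M.osc_sum_deviation_tendsto_zero ab V_infinity) auto
        show "\<forall>\<^sub>F T in at_top. norm (measure lborel ({t. \<epsilon> < \<bar>Z t - c\<bar>} \<inter> {0..T}) / T)
            \<le> measure lborel (?S \<inter> {0..T}) / T"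
          using eventually_gt_at_top[of 0]
        proof eventually_elim
          case (elim T)
          have "bounded (?S \<inter> {0..T})" by (rule bounded_subset[OF bounded_closed_interval[of 0 T]]) auto
          then have "measure lborel ({t. \<epsilon> < \<bar>Z t - c\<bar>} \<inter> {0..T}) \<le> measure lborel (?S \<inter> {0..T})"
            using sub[of T] by (intro measure_mono_fmeasurable fmeasurableI emeasure_bounded_finite) auto
          then show ?case using elim by (simp add: divide_right_mono)
        qed
      qed
      from dilation_law_tendsto_zero[OF rho _ this]
      show "((\<lambda>T. measure (dilation_law \<rho> T) {t \<in> space (dilation_law \<rho> T). \<epsilon> < \<bar>Z t - c\<bar>}) \<longlongrightarrow> 0) at_top"
        by (simp add: dilation_law_def)
    qed
    have dist: "converges_in_distribution (\<lambda>T. distr (dilation_law \<rho> T) borel Z) (return borel c) at_top"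
      by (rule converges_in_distribution_if_in_probability[OF rho Z_meas prob])
    show "let Z = normalized_variance (Rect a b) L; c = 1 / (4 * pi ^ 4 * (covol L)\<^sup>2)
        in Z \<in> borel_measurable borel \<and>
           converges_in_distribution (\<lambda>T. distr (dilation_law \<rho> T) borel Z) (return borel c) at_top \<and>
           converges_in_probability (dilation_law \<rho>) Z c at_top"
      unfolding Let_def Z_def[symmetric] c_def[symmetric] using Z_meas dist prob by blast
  qed
qed

end
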